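(* Let $\Gamma\subset PSL(3,\mathbb{C})$ be a discrete group. Suppose that each of the sets $\Lambda(\Gamma)$ and $C(\Gamma)$ contains at least three complex lines in general position. Then $$\Lambda(\Gamma)=C(\Gamma)=\overline{\bigcup_{\gamma\in\Gamma}\Lambda(\gamma)},$$ and $\Lambda(\Gamma)$ is a union of complex lines. Moreover, the Kulkarni discontinuity region $\Omega(\Gamma)$ agrees with the equicontinuity set $Eq(\Gamma)$. Furthermore, when $\Gamma$ acts on $\mathbb{P}^2_{\mathbb{C}}$ without global fixed points, $\Omega(\Gamma)$ is the largest open set on which $\Gamma$ acts properly and discontinuously.
   Context: $PSL(3,\mathbb{C})$ acts on the complex projective plane $\mathbb{P}^2_{\mathbb{C}}$ by projective transformations. A complex line is the projectivization of a 2-dimensional linear subspace of $\mathbb{C}^3$. Complex lines are in general position if they are pairwise distinct and no three of them pass through a common point. A global fixed point is a point of $\mathbb{P}^2_{\mathbb{C}}$ fixed by every element of $\Gamma$. Kulkarni's limit set. For a subgroup $G\subset PSL(3,\mathbb{C})$ and a nonempty set $K\subset\mathbb{P}^2_{\mathbb{C}}$, a point $q$ is a cluster point of the family $\{g(K)\}_{g\in G}$ if there are a sequence $(k_m)\subset K$ and a sequence $(g_m)\subset G$ of distinct elements with $g_m(k_m)\to q$; the cluster points of the orbit of a point $z$ are those of the family with $K=\{z\}$. Let $L_0(G)$ be the closure of the set of points of $\mathbb{P}^2_{\mathbb{C}}$ with infinite isotropy group in $G$; let $L_1(G)$ be the closure of the set of cluster points of the $G$-orbits of $z$, where $z$ runs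 over $\mathbb{P}^2_{\mathbb{C}}\setminus L_0(G)$; let $L_2(G)$ be the closure of the set of cluster points of the families $\{g(K)\}_{g\in G}$, where $K$ runs over all compact subsets of $\mathbb{P}^2_{\mathbb{C}}\setminus(L_0(G)\cup L_1(G))$. Then $\Lambda(G)=L_0(G)\cup L_1(G)\cup L_2(G)$ and $\Omega(G)=\mathbb{P}^2_{\mathbb{C}}\setminus\Lambda(G)$. For $\gamma\in PSL(3,\mathbb{C})$, $\Lambda(\gamma)$ denotes $\Lambda(\langle\gamma\rangle)$, the Kulkarni limit set of the cyclic group generated by $\gamma$. Define $C(\Gamma)=\overline{\bigcup_{\gamma\in\Gamma}\Lambda(\gamma)}$. Equicontinuity set: $Eq(\Gamma)$ is the set of points $z\in\mathbb{P}^2_{\mathbb{C}}$ having an open neighborhood $U$ such that $\{\gamma|_U:\gamma\in\Gamma\}$ is a normal family, meaning that every sequence of distinct elements has a subsequence which converges uniformly on compact subsets of $U$. Properly and discontinuously: $\Gamma$ acts properly and discontinuously on a $\Gamma$-invariant open set $V$ if for every compact $K\subset V$ the set $\{\gamma\in\Gamma:\gamma(K)\cap K\neq\emptyset\}$ is finite. "Largest" means that it is such a set and contains every other $\Gamma$-invariant open set on which $\Gamma$ acts properly and discontinuously. *)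

theory Defs
  imports "HOL-Analysis.Analysis" "HOL-Algebra.Generated_Groups"
begin

section \<open>The complex projective plane\<close>

text \<open>Points are the one-dimensional complex subspaces of \<open>\<complex>\<^sup>3\<close>.  Note that \<open>vec.dim\<close> is the
  dimension over the scalar field \<open>complex\<close>, unlike \<open>dim\<close>, which is the real dimension.\<close>

typedef cp2 = "{L :: (complex^3) set. vec.subspace L \<and> vec.dim L = 1}"
proof -
  have "vec.dim (vec.span {axis 1 1 :: complex^3}) = 1"
    by (simp add: axis_eq_0_iff)
  then show ?thesis
    using vec.subspace_span by blast
qed

definition point_of :: "complex^3 \<Rightarrow> cp2" where
  "point_of v = Abs_cp2 (vec.span {v})"

lemma Rep_point_of: "v \<noteq> 0 \<Longrightarrow> Rep_cp2 (point_of v) = vec.span {v}"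
  unfolding point_of_def by (rule Abs_cp2_inverse) simp

lemma Rep_cp2_nonzero: "\<exists>v \<in> Rep_cp2 p. v \<noteq> 0"
  using Rep_cp2[of p] vec.dim_eq_0[of "Rep_cp2 p"] by auto

lemma Rep_cp2_span:
  assumes "v \<in> Rep_cp2 p" "v \<noteq> 0"
  shows "Rep_cp2 p = vec.span {v}"
proof -
  have "vec.subspace (Rep_cp2 p)" "vec.dim (Rep_cp2 p) = 1"
    using Rep_cp2[of p] by auto
  then show ?thesis
    using assms vec.subspace_dim_equal[of "vec.span {v}" "Rep_cp2 p"]
    by (simp add: vec.span_minimal)
qed

lemma point_of_eq: "v \<in> Rep_cp2 p \<Longrightarrow> v \<noteq> 0 \<Longrightarrow> point_of v = p"
  by (simp add: point_of_def Rep_cp2_inverse flip: Rep_cp2_span)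

lemma mem_point_of: "v \<noteq> 0 \<Longrightarrow> v \<in> Rep_cp2 (point_of v)"
  by (simp add: Rep_point_of vec.span_base)

text \<open>The matrix of the Hermitian orthogonal projector onto the line spanned by \<open>v\<close>.\<close>

definition projector :: "complex^3 \<Rightarrow> complex^3^3" where
  "projector v = (\<chi> i j. v $ i * cnj (v $ j) / complex_of_real ((norm v)\<^sup>2))"

definition line_projector :: "cp2 \<Rightarrow> complex^3^3" where
  "line_projector p = projector (SOME v. v \<in> Rep_cp2 p \<and> v \<noteq> 0)"

lemma norm_sq_eq_sum: "complex_of_real ((norm (v::complex^3))\<^sup>2) = (\<Sum>j\<in>UNIV. cnj (v $ j) * v $ j)"
proof -
  have "(norm v)\<^sup>2 = (\<Sum>j\<in>UNIV. (norm (v $ j))\<^sup>2)"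
    by (simp add: norm_vec_def L2_set_def sum_nonneg)
  then show ?thesis
    by (simp only: of_real_sum complex_norm_square mult.commute)
qed

lemma projector_mult: "projector v *v w = ((\<Sum>j\<in>UNIV. cnj (v $ j) * w $ j) / complex_of_real ((norm v)\<^sup>2)) *s v"
  by (simp add: vec_eq_iff projector_def matrix_vector_mult_def sum_distrib_left
      sum_divide_distrib mult_ac)

lemma projector_self: "projector v *v v = v"
  by (cases "v = 0") (simp_all add: projector_mult flip: norm_sq_eq_sum)

lemma projector_scale:
  assumes "c \<noteq> 0"
  shows "projector (c *s v) = projector v"
proof -
  have "complex_of_real ((norm (c *s v))\<^sup>2) = c * cnj c * complex_of_real ((norm v)\<^sup>2)"
    unfolding norm_sq_eq_sum by (simp add: sum_distrib_left mult_ac)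
  then show ?thesis
    using assms by (simp add: projector_def vec_eq_iff)
qed

lemma line_projector:
  assumes "v \<in> Rep_cp2 p" "v \<noteq> 0"
  shows "line_projector p = projector v"
proof -
  define w where "w = (SOME v. v \<in> Rep_cp2 p \<and> v \<noteq> 0)"
  have w: "w \<in> Rep_cp2 p \<and> w \<noteq> 0"
    unfolding w_def using assms by (intro someI[of "\<lambda>v. v \<in> Rep_cp2 p \<and> v \<noteq> 0"]) simp
  then obtain c where c: "w = c *s v"
    using Rep_cp2_span[OF assms] by (auto simp: vec.span_singleton)
  then have "c \<noteq> 0" using w by auto
  then show ?thesis
    using c by (simp add: line_projector_def projector_scale flip: w_def)
qed

lemma line_projector_point_of: "v \<noteq> 0 \<Longrightarrow> line_projector (point_of v) = projector v"
  by (rule line_projector) (auto intro: mem_point_of)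

lemma inj_line_projector: "line_projector p = line_projector q \<Longrightarrow> p = q"
proof -
  assume eq: "line_projector p = line_projector q"
  obtain v where v: "v \<in> Rep_cp2 p" "v \<noteq> 0" using Rep_cp2_nonzero by blast
  obtain w where w: "w \<in> Rep_cp2 q" "w \<noteq> 0" using Rep_cp2_nonzero by blast
  have "v = projector w *v v"
    using projector_self[of v] eq line_projector[OF v] line_projector[OF w] by simp
  then have "v \<in> vec.span {w}"
    unfolding projector_mult[of w v] by (metis vec.span_base vec.span_scale singletonI)
  then have "v \<in> Rep_cp2 q"
    using Rep_cp2_span[OF w] by simp
  then show "p = q"
    using point_of_eq[of v p] point_of_eq[of v q] v by simp
qed

text \<open>The metric is the chordal one, the Hilbert--Schmidt distance of orthogonal projectors.
  Its topology is the quotient topology, see \<open>open_cp2_iff\<close> below; as the plane is compact,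
  uniform convergence does not depend on the choice of a compatible metric.\<close>

instantiation cp2 :: metric_space
begin

definition dist_cp2 :: "cp2 \<Rightarrow> cp2 \<Rightarrow> real" where
  "dist_cp2 p q = norm (line_projector p - line_projector q)"

definition uniformity_cp2 :: "(cp2 \<times> cp2) filter" where
  "uniformity_cp2 = (INF e\<in>{0<..}. principal {(x, y). dist x y < e})"

definition open_cp2 :: "cp2 set \<Rightarrow> bool" where
  "open_cp2 U = (\<forall>x\<in>U. \<forall>\<^sub>F (x', y) in uniformity. x' = x \<longrightarrow> y \<in> U)"

instance
proof
  fix x y z :: cp2
  show "(dist x y = 0) = (x = y)"
    using inj_line_projector by (auto simp: dist_cp2_def)
  show "dist x y \<le> dist x z + dist y z"
    unfolding dist_cp2_def
    using dist_triangle2[of "line_projector x" "line_projector y" "line_projector z"]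
    by (simp add: dist_norm)
qed (simp_all add: uniformity_cp2_def open_cp2_def)

end

lemma tendsto_projector:
  assumes "v \<noteq> 0"
  shows "(projector \<longlongrightarrow> projector v) (at v within S)"
  unfolding projector_def
  by (rule tendsto_vec_lambda)+ (intro tendsto_divide tendsto_mult tendsto_cnj
      tendsto_vec_nth tendsto_of_real tendsto_power tendsto_norm tendsto_ident_at; use assms in simp)

lemma continuous_on_point_of: "continuous_on (- {0}) point_of"
  unfolding continuous_on_def
proof
  fix v :: "complex^3" assume v: "v \<in> - {0}"
  have "(projector \<longlongrightarrow> projector v) (at v within - {0})"
    using v by (intro tendsto_projector) simp
  then have "((\<lambda>w. dist (projector w) (projector v)) \<longlongrightarrow> 0) (at v within - {0})"
    by (rule tendsto_dist_iff[THEN iffD1])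
  moreover have "\<forall>\<^sub>F w in at v within - {0}. dist (projector w) (projector v) = dist (point_of w) (point_of v)"
    using v by (auto simp: eventually_at_filter dist_cp2_def line_projector_point_of dist_norm)
  ultimately have "((\<lambda>w. dist (point_of w) (point_of v)) \<longlongrightarrow> 0) (at v within - {0})"
    by (rule Lim_transform_eventually)
  then show "(point_of \<longlongrightarrow> point_of v) (at v within - {0})"
    by (rule tendsto_dist_iff[THEN iffD2])
qed

lemma open_cp2_iff: "open U \<longleftrightarrow> open {v. v \<noteq> 0 \<and> point_of v \<in> U}"
proof
  assume "open U"
  then have "open (point_of -` U \<inter> - {0})"
    using continuous_on_point_of by (simp add: continuous_on_open_vimage open_Compl)
  then show "open {v. v \<noteq> 0 \<and> point_of v \<in> U}"
    by (simp add: vimage_def Int_def conj_commute)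
next
  assume *: "open {v. v \<noteq> 0 \<and> point_of v \<in> U}"
  show "open U"
    unfolding open_dist
  proof
    fix p assume "p \<in> U"
    obtain v where v: "v \<in> Rep_cp2 p" "v \<noteq> 0" using Rep_cp2_nonzero by blast
    with \<open>p \<in> U\<close> have "v \<in> {v. v \<noteq> 0 \<and> point_of v \<in> U}"
      by (simp add: point_of_eq)
    with * obtain e where e: "e > 0" "ball v e \<subseteq> {v. v \<noteq> 0 \<and> point_of v \<in> U}"
      by (meson openE)
    have "isCont (\<lambda>A :: complex^3^3. A *v v) (line_projector p)"
      unfolding matrix_vector_mult_def isCont_def
      by (intro tendsto_intros)
    then obtain d where d: "d > 0"
      "\<And>A. dist A (line_projector p) < d \<Longrightarrow> dist (A *v v) (line_projector p *v v) < e"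
      using e(1) unfolding continuous_at_eps_delta by blast
    show "\<exists>d>0. \<forall>q. dist q p < d \<longrightarrow> q \<in> U"
    proof (intro exI conjI allI impI)
      fix q assume "dist q p < d"
      obtain w where w: "w \<in> Rep_cp2 q" "w \<noteq> 0" using Rep_cp2_nonzero by blast
      have "dist (projector w *v v) v < e"
        using d(2)[of "line_projector q"] \<open>dist q p < d\<close> v w
        by (simp add: dist_cp2_def dist_norm line_projector projector_self)
      then have m: "projector w *v v \<in> {v. v \<noteq> 0 \<and> point_of v \<in> U}"
        using e(2) by (meson dist_commute_lessI mem_ball subsetD)
      have "projector w *v v \<in> Rep_cp2 q"
        using w by (simp add: Rep_cp2_span[OF w] projector_mult vec.span_base vec.span_scale)
      then show "q \<in> U"
        using m point_of_eq by auto
    qed (fact d(1))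
  qed
qed

definition complex_line :: "cp2 set \<Rightarrow> bool" where
  "complex_line l \<longleftrightarrow> (\<exists>W. vec.subspace W \<and> vec.dim W = 2 \<and> l = {p. Rep_cp2 p \<subseteq> W})"

text \<open>Pairwise distinctness is implicit, as the family is a set.\<close>

definition general_position :: "cp2 set set \<Rightarrow> bool" where
  "general_position \<L> \<longleftrightarrow> (\<forall>l\<in>\<L>. complex_line l) \<and>
     (\<forall>l1\<in>\<L>. \<forall>l2\<in>\<L>. \<forall>l3\<in>\<L>. l1 \<noteq> l2 \<and> l1 \<noteq> l3 \<and> l2 \<noteq> l3 \<longrightarrow> l1 \<inter> l2 \<inter> l3 = {})"

definition contains_three_lines_gp :: "cp2 set \<Rightarrow> bool" where
  "contains_three_lines_gp S \<longleftrightarrow> (\<exists>\<L>. general_position \<L> \<and> card \<L> = 3 \<and> (\<forall>l\<in>\<L>. l \<subseteq> S))"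


section \<open>The group \<open>PSL(3, \<complex>)\<close> and its action\<close>

definition SL3 :: "(complex^3^3) monoid" where
  "SL3 = \<lparr>carrier = {A. det A = 1}, mult = (**), one = mat 1\<rparr>"

text \<open>The center of \<open>SL(3, \<complex>)\<close> consists of the scalar matrices in it.\<close>

definition SL3_center :: "(complex^3^3) set" where
  "SL3_center = {A \<in> carrier SL3. \<exists>c. A = mat c}"

definition PSL3 :: "(complex^3^3) set monoid" where
  "PSL3 = SL3 Mod SL3_center"

lemma SL3_simps [simp]:
  "A \<in> carrier SL3 \<longleftrightarrow> det A = 1" "A \<otimes>\<^bsub>SL3\<^esub> B = A ** B" "\<one>\<^bsub>SL3\<^esub> = mat 1"
  by (simp_all add: SL3_def)

lemma mat_mult_vec: "mat c *v x = c *s (x :: complex^3)"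
  by (simp add: vec_eq_iff forall_3 sum_3 matrix_vector_mult_def mat_def)

lemma mat_mult_comm: "mat c ** A = A ** mat (c :: complex)" for A :: "complex^3^3"
  by (simp add: vec_eq_iff forall_3 sum_3 matrix_matrix_mult_def mat_def)

lemma mat_mult_mat: "mat c ** mat d = (mat (c * d) :: complex^3^3)"
  by (simp add: vec_eq_iff forall_3 sum_3 matrix_matrix_mult_def mat_def)

lemma group_SL3: "group SL3"
proof (rule groupI)
  fix A assume A: "A \<in> carrier SL3"
  then have "invertible A"
    by (simp add: invertible_det_nz)
  then obtain B where B: "B ** A = mat 1" "A ** B = mat 1"
    unfolding invertible_def by blast
  then have "det B = 1"
    using A by (metis SL3_simps(1) det_I det_mul mult.right_neutral)
  then show "\<exists>B\<in>carrier SL3. B \<otimes>\<^bsub>SL3\<^esub> A = \<one>\<^bsub>SL3\<^esub>"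
    using B by auto
qed (auto simp: det_mul matrix_mul_assoc)

lemma subgroup_SL3_center: "subgroup SL3_center SL3"
proof (rule group.subgroupI[OF group_SL3])
  have "mat 1 \<in> SL3_center"
    unfolding SL3_center_def by auto
  then show "SL3_center \<noteq> {}" by blast
next
  fix A assume A: "A \<in> SL3_center"
  then obtain c where c: "A = mat c" "det A = 1"
    by (auto simp: SL3_center_def)
  then have "c \<noteq> 0" by (auto simp: det_3 mat_def)
  define B :: "complex^3^3" where "B = mat (inverse c)"
  have BA: "B ** A = mat 1" using \<open>c \<noteq> 0\<close> by (simp add: B_def c mat_mult_mat)
  then have "det B = 1" using c by (metis det_I det_mul mult.right_neutral)
  then have "inv\<^bsub>SL3\<^esub> A = B"
    using group.inv_equality[OF group_SL3, of B A] BA c by simp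
  then show "inv\<^bsub>SL3\<^esub> A \<in> SL3_center"
    using \<open>det B = 1\<close> by (auto simp: SL3_center_def B_def)
next
  fix A B assume "A \<in> SL3_center" "B \<in> SL3_center"
  then obtain c d where cd: "det A = 1" "A = mat c" "det B = 1" "B = mat d"
    unfolding SL3_center_def by auto
  have "det (A ** B) = 1"
    using cd(1,3) by (simp add: det_mul)
  moreover have "A ** B = mat (c * d)"
    unfolding cd(2,4) by (rule mat_mult_mat)
  ultimately show "A \<otimes>\<^bsub>SL3\<^esub> B \<in> SL3_center"
    unfolding SL3_center_def SL3_simps by blast
next
  show "SL3_center \<subseteq> carrier SL3"
    unfolding SL3_center_def by blast
qed

lemma normal_SL3_center: "SL3_center \<lhd> SL3"
proof -
  have "A ** X = X ** A" if "A \<in> SL3_center" for A X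
    using that mat_mult_comm unfolding SL3_center_def by blast
  then have "SL3_center #>\<^bsub>SL3\<^esub> X = X <#\<^bsub>SL3\<^esub> SL3_center" for X
    unfolding r_coset_def l_coset_def SL3_simps by (metis (no_types, lifting) SUP_cong)
  then show ?thesis
    using subgroup_SL3_center group_SL3 by (simp add: normal_def normal_axioms_def)
qed

lemma group_PSL3: "group PSL3"
  unfolding PSL3_def by (rule normal.factorgroup_is_group[OF normal_SL3_center])

definition PSL3_topology :: "(complex^3^3) set topology" where
  "PSL3_topology = topology (\<lambda>U. U \<subseteq> carrier PSL3 \<and>
     openin (top_of_set (carrier SL3)) {A \<in> carrier SL3. SL3_center #>\<^bsub>SL3\<^esub> A \<in> U})"

lemma openin_PSL3_topology:
  "openin PSL3_topology U \<longleftrightarrow> U \<subseteq> carrier PSL3 \<and>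
     openin (top_of_set (carrier SL3)) {A \<in> carrier SL3. SL3_center #>\<^bsub>SL3\<^esub> A \<in> U}"
proof -
  have "istopology (\<lambda>U. U \<subseteq> carrier PSL3 \<and>
     openin (top_of_set (carrier SL3)) {A \<in> carrier SL3. SL3_center #>\<^bsub>SL3\<^esub> A \<in> U})"
    unfolding istopology_def
  proof (intro conjI allI impI; (elim conjE)?)
    fix S T
    assume "openin (top_of_set (carrier SL3)) {A \<in> carrier SL3. SL3_center #>\<^bsub>SL3\<^esub> A \<in> S}"
      "openin (top_of_set (carrier SL3)) {A \<in> carrier SL3. SL3_center #>\<^bsub>SL3\<^esub> A \<in> T}"
    then have "openin (top_of_set (carrier SL3))
        ({A \<in> carrier SL3. SL3_center #>\<^bsub>SL3\<^esub> A \<in> S} \<inter> {A \<in> carrier SL3. SL3_center #>\<^bsub>SL3\<^esub> A \<in> T})"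
      by (rule openin_Int)
    moreover have "{A \<in> carrier SL3. SL3_center #>\<^bsub>SL3\<^esub> A \<in> S} \<inter> {A \<in> carrier SL3. SL3_center #>\<^bsub>SL3\<^esub> A \<in> T}
        = {A \<in> carrier SL3. SL3_center #>\<^bsub>SL3\<^esub> A \<in> S \<inter> T}"
      by blast
    ultimately show "openin (top_of_set (carrier SL3)) {A \<in> carrier SL3. SL3_center #>\<^bsub>SL3\<^esub> A \<in> S \<inter> T}"
      by simp
  next
    fix K
    assume K: "\<forall>S\<in>K. S \<subseteq> carrier PSL3 \<and>
      openin (top_of_set (carrier SL3)) {A \<in> carrier SL3. SL3_center #>\<^bsub>SL3\<^esub> A \<in> S}"
    have "{A \<in> carrier SL3. SL3_center #>\<^bsub>SL3\<^esub> A \<in> \<Union>K} =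
        (\<Union>S\<in>K. {A \<in> carrier SL3. SL3_center #>\<^bsub>SL3\<^esub> A \<in> S})" by auto
    then show "openin (top_of_set (carrier SL3)) {A \<in> carrier SL3. SL3_center #>\<^bsub>SL3\<^esub> A \<in> \<Union>K}"
      using K by auto
  qed auto
  then show ?thesis
    unfolding PSL3_topology_def by (simp add: topology_inverse')
qed

lemma quotient_map_PSL3:
  "quotient_map (top_of_set (carrier SL3)) PSL3_topology (\<lambda>A. SL3_center #>\<^bsub>SL3\<^esub> A)"
proof -
  have c: "carrier PSL3 = (\<lambda>A. SL3_center #>\<^bsub>SL3\<^esub> A) ` carrier SL3"
    by (simp add: PSL3_def carrier_FactGroup)
  have "openin PSL3_topology (carrier PSL3)"
    unfolding openin_PSL3_topology by (force simp: c intro: openin_subtopology_self back_subst[of "openin _"])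
  then have "topspace PSL3_topology = carrier PSL3"
    by (meson openin_PSL3_topology openin_subset openin_topspace subset_antisym)
  then show ?thesis
    by (simp add: quotient_map_def openin_PSL3_topology flip: c)
qed

definition discrete_in_PSL3 :: "(complex^3^3) set set \<Rightarrow> bool" where
  "discrete_in_PSL3 \<Gamma> \<longleftrightarrow> subtopology PSL3_topology \<Gamma> = discrete_topology \<Gamma>"

text \<open>An element of \<open>PSL3\<close> is a coset, i.e. a set of matrices differing by scalars; these all map
  a given line through the origin onto the same line, so the union below is that line.\<close>

definition psl_act :: "(complex^3^3) set \<Rightarrow> cp2 \<Rightarrow> cp2" where
  "psl_act g p = Abs_cp2 (\<Union>A\<in>g. (*v) A ` Rep_cp2 p)"

lemma psl_act_point_of:
  assumes "g \<in> carrier PSL3" "A \<in> g" "v \<noteq> 0"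
  shows "psl_act g (point_of v) = point_of (A *v v)"
proof -
  obtain B where B: "det B = 1" "g = SL3_center #>\<^bsub>SL3\<^esub> B"
    using assms(1) by (auto simp: PSL3_def carrier_FactGroup)
  obtain c where c: "det (mat c :: complex^3^3) = 1" "A = mat c ** B"
    using assms(2) unfolding B(2) r_coset_def SL3_center_def by auto
  have span: "(*v) M ` vec.span {v} = vec.span {M *v v}" for M :: "complex^3^3"
    using vec.span_image[of M "{v}"] by simp
  have "vec.span {M *v v} = vec.span {B *v v}" if M_in: "M \<in> g" for M
  proof -
    obtain d where d: "det (mat d :: complex^3^3) = 1" "M = mat d ** B"
      using M_in unfolding B(2) r_coset_def SL3_center_def by auto
    have "d \<noteq> 0"
      using d(1) by (auto simp: det_3 mat_def)
    have M: "M *v v = d *s (B *v v)"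
      by (simp add: d(2) mat_mult_vec flip: matrix_vector_mul_assoc)
    show ?thesis
      unfolding M using \<open>d \<noteq> 0\<close> vec.span_image_scale[of "{B *v v}" "\<lambda>_. d"] by simp
  qed
  then have "(\<Union>M\<in>g. (*v) M ` vec.span {v}) = vec.span {A *v v}"
    using assms(2) by (force simp: span)
  then show ?thesis
    using assms(3) by (simp add: psl_act_def Rep_point_of) (simp add: point_of_def)
qed


section \<open>Kulkarni's limit set\<close>

definition cluster_points :: "(complex^3^3) set set \<Rightarrow> cp2 set \<Rightarrow> cp2 set" where
  "cluster_points G K = {q. \<exists>k g. (\<forall>m. k m \<in> K) \<and> (\<forall>m. g m \<in> G) \<and> inj g \<and>
     (\<lambda>m::nat. psl_act (g m) (k m)) \<longlonglongrightarrow> q}"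

definition L0 :: "(complex^3^3) set set \<Rightarrow> cp2 set" where
  "L0 G = closure {p. infinite {g \<in> G. psl_act g p = p}}"

definition L1 :: "(complex^3^3) set set \<Rightarrow> cp2 set" where
  "L1 G = closure (\<Union>z \<in> - L0 G. cluster_points G {z})"

definition L2 :: "(complex^3^3) set set \<Rightarrow> cp2 set" where
  "L2 G = closure (\<Union>K \<in> {K. compact K \<and> K \<subseteq> - (L0 G \<union> L1 G)}. cluster_points G K)"

definition kulkarni_limit_set :: "(complex^3^3) set set \<Rightarrow> cp2 set" where
  "kulkarni_limit_set G = L0 G \<union> L1 G \<union> L2 G"

definition kulkarni_region :: "(complex^3^3) set set \<Rightarrow> cp2 set" where
  "kulkarni_region G = - kulkarni_limit_set G"

definition C_set :: "(complex^3^3) set set \<Rightarrow> cp2 set" where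
  "C_set \<Gamma> = closure (\<Union>\<gamma>\<in>\<Gamma>. kulkarni_limit_set (generate PSL3 {\<gamma>}))"


section \<open>Equicontinuity set and properly discontinuous actions\<close>

text \<open>The limit \<open>h\<close> is only relevant on \<open>U\<close>; it takes values in the projective plane.\<close>

definition normal_family :: "cp2 set \<Rightarrow> (cp2 \<Rightarrow> cp2) set \<Rightarrow> bool" where
  "normal_family U F \<longleftrightarrow> (\<forall>f :: nat \<Rightarrow> cp2 \<Rightarrow> cp2. (\<forall>n. f n \<in> F) \<and> inj f \<longrightarrow>
     (\<exists>r h. strict_mono (r :: nat \<Rightarrow> nat) \<and>
       (\<forall>K. compact K \<and> K \<subseteq> U \<longrightarrow> uniform_limit K (\<lambda>n. f (r n)) h sequentially)))"

definition equicontinuity_set :: "(complex^3^3) set set \<Rightarrow> cp2 set" where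
  "equicontinuity_set \<Gamma> =
     {z. \<exists>U. open U \<and> z \<in> U \<and> normal_family U ((\<lambda>\<gamma>. restrict (psl_act \<gamma>) U) ` \<Gamma>)}"

definition prop_disc_domain :: "(complex^3^3) set set \<Rightarrow> cp2 set \<Rightarrow> bool" where
  "prop_disc_domain \<Gamma> V \<longleftrightarrow> open V \<and> (\<forall>\<gamma>\<in>\<Gamma>. psl_act \<gamma> ` V = V) \<and>
     (\<forall>K. compact K \<and> K \<subseteq> V \<longrightarrow> finite {\<gamma> \<in> \<Gamma>. psl_act \<gamma> ` K \<inter> K \<noteq> {}})"

definition global_fixed_point :: "(complex^3^3) set set \<Rightarrow> cp2 \<Rightarrow> bool" where
  "global_fixed_point \<Gamma> p \<longleftrightarrow> (\<forall>\<gamma>\<in>\<Gamma>. psl_act \<gamma> p = p)"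

end

theory Submission
  imports Defs
begin

text \<open>
  After rescaling, a sequence of different elements of a discrete group and the sequence of its inverses
  subconverge to nonzero singular matrices \<open>B\<close> and \<open>C\<close> with \<open>B C = C B = 0\<close> (\<open>collapsing\<close>,
  \<open>discrete_obtains_collapsing\<close>, \<open>collapsing_mult_zero\<close>). The transformations converge to \<open>B\<close> locally uniformly away
  from the kernel of \<open>B\<close>. The proof compares every set in the theorem with one set \<open>E\<close>, the closure of the
  union of all these kernels (\<open>kernel_closure\<close>).

  The main tool is elementary. If \<open>B v = 0\<close> and \<open>f\<close> is a functional with \<open>f \<circ> B \<noteq> 0\<close>, then zeros of the functionals
  \<open>f \<circ> A\<^sub>n\<close> converge to \<open>v\<close> (\<open>collapsing_zeros_persist\<close>), so the transformations move points near \<open>v\<close> into the line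
  of \<open>f\<close>. Since this line can be chosen freely, no uniform limit exists near a kernel point, and the
  equicontinuity set is the complement of \<open>E\<close> (\<open>equicontinuity_set_eq\<close>). Moreover, if an invariant open set contains a
  kernel point, then every line that it omits contains the image of \<open>B\<close>; three omitted lines in general position
  would give \<open>B = 0\<close> (\<open>omitted_three_lines_no_kernel_points\<close>).

  Any accumulation of orbits is governed by \<open>B\<close> and \<open>C\<close>, and the image of each lies in the kernel of the other,
  so Kulkarni's limit set of a discrete group is contained in \<open>E\<close> (\<open>kulkarni_subset_kernel_closure\<close>). Applied to cyclic
  subgroups, this also bounds \<open>C_set\<close>. Conversely, each of the two sets is closed, invariant and contains three
  lines in general position, so its complement contains no kernel points and the set is all of \<open>E\<close>
  (\<open>kernel_closure_subset_invariant\<close>). The set \<open>E\<close> is a union of lines because a kernel that is not a line is a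
  point at which images of lines in \<open>E\<close> accumulate, and limits of lines are lines (\<open>kernel_closure_union_of_lines\<close>).

  For maximality, let \<open>V\<close> be a domain of proper discontinuity that contains a kernel point. The lines omitted by
  \<open>V\<close> are permuted by the group, and three of them in general position are impossible. So if there are two, all of
  them pass through the intersection of these two, which is then a global fixed point. If there is
  at most one, proper discontinuity forces \<open>B\<close> and \<open>C\<close> to have rank one and \<open>V\<close> to omit the kernel \<open>W\<close> of \<open>C\<close>
  (\<open>kernel_meets_domain\<close>), which is therefore invariant. An element that moves the image of \<open>B\<close> is then
  conjugated by the sequence, and the limits of these conjugates contradict the uniqueness of \<open>W\<close>
  (\<open>prop_disc_domain_disjoint_kernel_points\<close>).
\<close>

section \<open>Vectors, functionals and matrices of size three\<close>

text \<open>Complex lines are the kernels of linear functionals. The pairing is bilinear, without a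
  conjugation, so that composing a functional with a matrix is the product \<open>a v* M\<close>.\<close>

definition pairing :: "complex^3 \<Rightarrow> complex^3 \<Rightarrow> complex" (infixl "\<cdot>" 75) where
  "a \<cdot> v = (\<Sum>i\<in>UNIV. a $ i * v $ i)"

definition conj_vec :: "complex^3 \<Rightarrow> complex^3" where
  "conj_vec v = (\<chi> i. cnj (v $ i))"

text \<open>The adjugate. It is the inverse on \<open>SL(3, \<complex>)\<close>, and since its entries are polynomials its
  continuity is immediate.\<close>

definition adj3 :: "complex^3^3 \<Rightarrow> complex^3^3" where
  "adj3 A = vector
     [vector [A$2$2 * A$3$3 - A$2$3 * A$3$2, A$1$3 * A$3$2 - A$1$2 * A$3$3, A$1$2 * A$2$3 - A$1$3 * A$2$2],
      vector [A$2$3 * A$3$1 - A$2$1 * A$3$3, A$1$1 * A$3$3 - A$1$3 * A$3$1, A$1$3 * A$2$1 - A$1$1 * A$2$3],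
      vector [A$2$1 * A$3$2 - A$2$2 * A$3$1, A$1$2 * A$3$1 - A$1$1 * A$3$2, A$1$1 * A$2$2 - A$1$2 * A$2$1]]"

lemma pairing_simps [simp]:
  "a \<cdot> (v + w) = a \<cdot> v + a \<cdot> w" "(a + b) \<cdot> v = a \<cdot> v + b \<cdot> v"
  "a \<cdot> (v - w) = a \<cdot> v - a \<cdot> w" "(a - b) \<cdot> v = a \<cdot> v - b \<cdot> v"
  "a \<cdot> (c *s v) = c * (a \<cdot> v)" "(c *s a) \<cdot> v = c * (a \<cdot> v)"
  "a \<cdot> (r *\<^sub>R v) = r *\<^sub>R (a \<cdot> v)" "(r *\<^sub>R a) \<cdot> v = r *\<^sub>R (a \<cdot> v)"
  "a \<cdot> 0 = 0" "0 \<cdot> a = 0" "a \<cdot> (- v) = - (a \<cdot> v)"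
  by (simp_all add: pairing_def sum_3 algebra_simps)

lemma pairing_commute: "a \<cdot> v = v \<cdot> a"
  by (simp add: pairing_def mult.commute)

lemma pairing_matrix: "a \<cdot> (M *v v) = (a v* M) \<cdot> v"
  by (simp add: pairing_def vector_matrix_mult_def matrix_vector_mult_def sum_3 algebra_simps)

lemma pairing_conj_self: "conj_vec v \<cdot> v = complex_of_real ((norm v)\<^sup>2)"
  unfolding norm_sq_eq_sum by (simp add: pairing_def conj_vec_def)

lemma pairing_conj_self_nonzero: "v \<noteq> 0 \<Longrightarrow> conj_vec v \<cdot> v \<noteq> 0"
  by (simp add: pairing_conj_self)

lemma pairing_self_conj_nonzero: "v \<noteq> 0 \<Longrightarrow> v \<cdot> conj_vec v \<noteq> 0"
  using pairing_conj_self_nonzero by (simp add: pairing_commute)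

lemma conj_vec_pairing_swap: "conj_vec w \<cdot> v = cnj (conj_vec v \<cdot> w)"
  by (simp add: pairing_def conj_vec_def mult.commute)

lemma pairing_all_zero:
  assumes "\<And>v. a \<cdot> v = 0" shows "a = 0"
  using pairing_self_conj_nonzero assms by blast

lemma tendsto_pairing [tendsto_intros]:
  "(f \<longlongrightarrow> a) F \<Longrightarrow> (g \<longlongrightarrow> v) F \<Longrightarrow> ((\<lambda>x. f x \<cdot> g x) \<longlongrightarrow> a \<cdot> v) F"
  unfolding pairing_def by (intro tendsto_intros)

lemma tendsto_matrix_vector [tendsto_intros]:
  fixes f :: "'a \<Rightarrow> complex^3^3"
  shows "(f \<longlongrightarrow> A) F \<Longrightarrow> (g \<longlongrightarrow> v) F \<Longrightarrow> ((\<lambda>x. f x *v g x) \<longlongrightarrow> A *v v) F"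
  unfolding matrix_vector_mult_def by (intro tendsto_intros)

lemma tendsto_vector_matrix [tendsto_intros]:
  fixes f :: "'a \<Rightarrow> complex^3^3"
  shows "(f \<longlongrightarrow> A) F \<Longrightarrow> (g \<longlongrightarrow> v) F \<Longrightarrow> ((\<lambda>x. g x v* f x) \<longlongrightarrow> v v* A) F"
  unfolding vector_matrix_mult_def by (intro tendsto_intros)

lemma tendsto_matrix_matrix [tendsto_intros]:
  fixes f :: "'a \<Rightarrow> complex^3^3"
  shows "(f \<longlongrightarrow> A) F \<Longrightarrow> (g \<longlongrightarrow> B) F \<Longrightarrow> ((\<lambda>x. f x ** g x) \<longlongrightarrow> A ** B) F"
  unfolding matrix_matrix_mult_def by (intro tendsto_intros)

lemma tendsto_vec_scale [tendsto_intros]: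
  fixes f :: "'a \<Rightarrow> complex"
  shows "(f \<longlongrightarrow> c) F \<Longrightarrow> (g \<longlongrightarrow> v) F \<Longrightarrow> ((\<lambda>x. f x *s g x) \<longlongrightarrow> c *s v) F"
  unfolding vector_scalar_mult_def by (intro tendsto_intros)

lemma tendsto_adj3 [tendsto_intros]:
  assumes "(f \<longlongrightarrow> A) F" shows "((\<lambda>x. adj3 (f x)) \<longlongrightarrow> adj3 A) F"
proof -
  have "((\<lambda>x. adj3 (f x) $ i $ j) \<longlongrightarrow> adj3 A $ i $ j) F" for i j
    using exhaust_3[of i] exhaust_3[of j] unfolding adj3_def
    by (elim disjE) (simp_all, (intro tendsto_intros assms)+)
  then show ?thesis
    by (intro vec_tendstoI)
qed

lemma tendsto_det3:
  assumes "(f \<longlongrightarrow> A) F" shows "((\<lambda>x. det (f x :: complex^3^3)) \<longlongrightarrow> det A) F"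
  unfolding det_3 by (intro tendsto_intros assms)

lemma adj3_mult: "A ** adj3 A = mat (det A)" "adj3 A ** A = mat (det A)"
  by (simp_all add: vec_eq_iff forall_3 sum_3 matrix_matrix_mult_def mat_def det_3 adj3_def
      algebra_simps)

lemma det_adj3: "det A = 1 \<Longrightarrow> det (adj3 A) = 1"
  by (metis adj3_mult(1) det_I det_mul mult_1)

lemma adj3_adj3: "det A = 1 \<Longrightarrow> adj3 (adj3 A) = A"
  by (metis adj3_mult det_adj3 matrix_mul_assoc matrix_mul_lid matrix_mul_rid)

lemma adj3_vec: "det A = 1 \<Longrightarrow> adj3 A *v (A *v v) = v" "det A = 1 \<Longrightarrow> A *v (adj3 A *v v) = v"
  by (simp_all add: matrix_vector_mul_assoc adj3_mult)

lemma adj3_matrix_mult: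
  assumes "det A = 1" "det B = 1"
  shows "adj3 (A ** B) = adj3 B ** adj3 A"
proof -
  have "adj3 (A ** B) ** (A ** B) = mat 1" "(A ** B) ** (adj3 B ** adj3 A) = mat 1"
    using assms by (simp_all add: adj3_mult det_mul)
      (metis adj3_mult(1) matrix_mul_assoc matrix_mul_rid)
  then show ?thesis
    by (metis matrix_mul_assoc matrix_mul_lid matrix_mul_rid)
qed

lemma scaleR_matrix_vector: "(r *\<^sub>R A) *v v = r *\<^sub>R (A *v v)" for A :: "complex^3^3"
  by (simp add: vec_eq_iff matrix_vector_mult_def sum_3 algebra_simps)

lemma matrix_vector_scaleR: "A *v (r *\<^sub>R v) = r *\<^sub>R (A *v v)" for A :: "complex^3^3"
  by (simp add: vec_eq_iff matrix_vector_mult_def sum_3 algebra_simps)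

lemma scaleR_eq_scale: "r *\<^sub>R v = complex_of_real r *s v" for v :: "complex^3"
  by (simp only: vec_eq_iff vector_scaleR_component vector_smult_component)
    (simp add: scaleR_conv_of_real)

lemma scaleR_matrix_matrix: "(r *\<^sub>R A) ** B = r *\<^sub>R (A ** B)" "A ** (r *\<^sub>R B) = r *\<^sub>R (A ** B)"
  for A :: "complex^3^3"
  by (simp_all add: vec_eq_iff matrix_matrix_mult_def sum_3 algebra_simps)

lemma matrix_eq_zero_iff: "M = 0 \<longleftrightarrow> (\<forall>v. M *v v = 0)" for M :: "complex^3^3"
  using matrix_eq[of M 0] by simp

subsection \<open>Linear dependence\<close>

text \<open>Not symmetric: the second vector may vanish. This is the form in which images under singular
  matrices are compared with a given direction.\<close>

definition parallel :: "complex^3 \<Rightarrow> complex^3 \<Rightarrow> bool" where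
  "parallel u v \<longleftrightarrow> (\<exists>c. v = c *s u)"

text \<open>For independent vectors this is a functional that defines the plane spanned by them.\<close>

definition cross :: "complex^3 \<Rightarrow> complex^3 \<Rightarrow> complex^3" where
  "cross u v = vector [u$2 * v$3 - u$3 * v$2, u$3 * v$1 - u$1 * v$3, u$1 * v$2 - u$2 * v$1]"

lemma cross_pairing [simp]: "cross u v \<cdot> u = 0" "cross u v \<cdot> v = 0"
  by (simp_all add: pairing_def cross_def sum_3 algebra_simps)

lemma cross_eq_0_iff:
  assumes "u \<noteq> 0" shows "cross u v = 0 \<longleftrightarrow> parallel u v"
proof
  assume "parallel u v"
  then show "cross u v = 0"
    by (auto simp: parallel_def cross_def vec_eq_iff forall_3)
next
  assume *: "cross u v = 0"
  then have e: "u$2 * v$3 = u$3 * v$2" "u$3 * v$1 = u$1 * v$3" "u$1 * v$2 = u$2 * v$1"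
    by (simp_all add: cross_def vec_eq_iff forall_3)
  obtain i where i: "u $ i \<noteq> 0" using assms by (auto simp: vec_eq_iff)
  have "v = (v $ i / u $ i) *s u"
    using i exhaust_3[of i] e by (auto simp: vec_eq_iff forall_3 field_simps)
  then show "parallel u v" unfolding parallel_def by blast
qed

text \<open>Cramer's rule for the coordinates of \<open>x\<close> with respect to \<open>u\<close>, \<open>v\<close> and \<open>w\<close>, cleared of its
  denominator. Read in \<open>x\<close> it describes the plane spanned by two vectors, and paired with a functional it
  describes the intersection of two planes.\<close>

lemma cross_expansion:
  "(cross u v \<cdot> w) *s x = (cross x v \<cdot> w) *s u + (cross u x \<cdot> w) *s v + (cross u v \<cdot> x) *s w"
  by (simp add: vec_eq_iff forall_3 pairing_def cross_def sum_3 algebra_simps)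

lemma in_span_of_cross:
  assumes n: "\<not> parallel u v" "u \<noteq> 0" and x: "cross u v \<cdot> x = 0"
  obtains s t where "x = s *s u + t *s v"
proof -
  define w where "w = conj_vec (cross u v)"
  define d where "d = cross u v \<cdot> w"
  have "d \<noteq> 0"
    using cross_eq_0_iff n pairing_self_conj_nonzero by (simp add: d_def w_def)
  moreover have "d *s x = (cross x v \<cdot> w) *s u + (cross u x \<cdot> w) *s v"
    using cross_expansion[of u v w x] x by (simp add: d_def)
  ultimately have "x = ((cross x v \<cdot> w) / d) *s u + ((cross u x \<cdot> w) / d) *s v"
    by (simp add: vec_eq_iff field_simps)
  then show ?thesis by (rule that)
qed

section \<open>Matrices representing projective transformations\<close>

definition cls :: "complex^3^3 \<Rightarrow> (complex^3^3) set" where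
  "cls A = SL3_center #>\<^bsub>SL3\<^esub> A"

text \<open>Limits of projective transformations need not be invertible, so sequences in a group are
  studied through their representatives of determinant one.\<close>

definition lifts :: "(complex^3^3) set set \<Rightarrow> (complex^3^3) set" where
  "lifts G = {A. det A = 1 \<and> cls A \<in> G}"

lemma cls_in_carrier: "det A = 1 \<Longrightarrow> cls A \<in> carrier PSL3"
  by (auto simp: cls_def PSL3_def carrier_FactGroup)

lemma cls_cases:
  assumes "g \<in> carrier PSL3" obtains A where "det A = 1" "g = cls A"
  using assms by (auto simp: cls_def PSL3_def carrier_FactGroup)

lemma mem_cls: "det A = 1 \<Longrightarrow> A \<in> cls A"
  unfolding cls_def by (rule group.rcos_self[OF group_SL3 _ subgroup_SL3_center]) simp

lemma cls_mult: "det A = 1 \<Longrightarrow> det B = 1 \<Longrightarrow> cls A \<otimes>\<^bsub>PSL3\<^esub> cls B = cls (A ** B)"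
  using normal.rcos_sum[OF normal_SL3_center, of A B] by (simp add: PSL3_def cls_def)

lemma cls_one: "cls (mat 1) = \<one>\<^bsub>PSL3\<^esub>"
  using group.coset_mult_one[OF group_SL3, of SL3_center]
    subgroup.subset[OF subgroup_SL3_center] by (simp add: PSL3_def cls_def)

lemma cls_adj3: "det A = 1 \<Longrightarrow> inv\<^bsub>PSL3\<^esub> (cls A) = cls (adj3 A)"
  by (rule group.inv_equality[OF group_PSL3])
    (simp_all add: cls_mult det_adj3 adj3_mult cls_one cls_in_carrier)

lemma cls_eq_obtains:
  assumes "det A = 1" "det B = 1" "cls A = cls B"
  obtains c where "c ^ 3 = 1" "B = mat c ** A"
proof -
  have "B \<in> SL3_center #>\<^bsub>SL3\<^esub> A"
    using mem_cls[OF assms(2)] assms(3) by (simp add: cls_def)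
  then obtain c where "det (mat c :: complex^3^3) = 1" "B = mat c ** A"
    unfolding r_coset_def SL3_center_def by auto
  then show ?thesis
    using that[of c] by (simp add: det_3 mat_def power3_eq_cube)
qed

lemma cls_scalar_mult:
  assumes "det A = 1" "det (mat c :: complex^3^3) = 1" shows "cls (mat c ** A) = cls A"
proof -
  have "mat c \<in> SL3_center" using assms(2) unfolding SL3_center_def by auto
  then have "cls (mat c) = \<one>\<^bsub>PSL3\<^esub>"
    using subgroup.rcos_const[OF subgroup_SL3_center group_SL3]
    by (simp add: cls_def PSL3_def)
  then have "cls (mat c ** A) = \<one>\<^bsub>PSL3\<^esub> \<otimes>\<^bsub>PSL3\<^esub> cls A"
    using cls_mult[OF assms(2,1)] by simp
  then show ?thesis
    using group.is_monoid[OF group_PSL3] cls_in_carrier[OF assms(1)] by (simp add: monoid.l_one)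
qed

text \<open>Representatives of determinant one differ by a cube root of unity. Divergence in the group can
  therefore be read off from the norms of representatives.\<close>

lemma norm_cong_cls:
  assumes "det A = 1" "det B = 1" "cls A = cls B"
  shows "norm A = norm B"
proof -
  obtain c where c: "c ^ 3 = 1" "B = mat c ** A"
    using cls_eq_obtains[OF assms] .
  have "norm c = 1"
    using power_eq_1_iff[OF c(1)] by simp
  then have "norm (B $ i $ j) = norm (A $ i $ j)" for i j
    using exhaust_3[of i] by (auto simp: c(2) matrix_matrix_mult_def mat_def sum_3 norm_mult)
  then have "norm (B $ i) = norm (A $ i)" for i
    by (subst (1 2) norm_vec_def) simp
  then show ?thesis
    by (subst (1 2) norm_vec_def) simp
qed

lemma psl_act_cls: "det A = 1 \<Longrightarrow> v \<noteq> 0 \<Longrightarrow> psl_act (cls A) (point_of v) = point_of (A *v v)"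
  by (rule psl_act_point_of[OF cls_in_carrier mem_cls])

lemma det_one_vec_nonzero: "det A = 1 \<Longrightarrow> v \<noteq> 0 \<Longrightarrow> A *v v \<noteq> 0"
  for A :: "complex^3^3"
  using adj3_vec(1)[of A v] by auto

lemma cp2_cases:
  obtains v where "v \<noteq> 0" "p = point_of v"
proof -
  obtain v where "v \<in> Rep_cp2 p" "v \<noteq> 0" using Rep_cp2_nonzero by blast
  then show ?thesis using that[of v] point_of_eq[of v p] by simp
qed

lemma psl_act_mult:
  assumes "g \<in> carrier PSL3" "h \<in> carrier PSL3"
  shows "psl_act (g \<otimes>\<^bsub>PSL3\<^esub> h) p = psl_act g (psl_act h p)"
proof -
  obtain A where A: "det A = 1" "g = cls A" using cls_cases assms(1) by blast
  obtain B where B: "det B = 1" "h = cls B" using cls_cases assms(2) by blast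
  obtain v where "v \<noteq> 0" "p = point_of v" by (rule cp2_cases)
  then show ?thesis
    using A B by (simp add: cls_mult psl_act_cls det_mul det_one_vec_nonzero matrix_vector_mul_assoc)
qed

lemma psl_act_one: "psl_act \<one>\<^bsub>PSL3\<^esub> p = p"
  by (rule cp2_cases[of p]) (simp add: psl_act_cls flip: cls_one)

lemma psl_act_inv:
  assumes "g \<in> carrier PSL3"
  shows "psl_act (inv\<^bsub>PSL3\<^esub> g) (psl_act g p) = p" "psl_act g (psl_act (inv\<^bsub>PSL3\<^esub> g) p) = p"
  using psl_act_mult[OF assms group.inv_closed[OF group_PSL3 assms], of p]
    psl_act_mult[OF group.inv_closed[OF group_PSL3 assms] assms, of p]
    group.l_inv[OF group_PSL3 assms] group.r_inv[OF group_PSL3 assms] psl_act_one[of p]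
  by simp_all

lemma lifts_det: "A \<in> lifts G \<Longrightarrow> det A = 1"
  by (simp add: lifts_def)

lemma lifts_cls: "A \<in> lifts G \<Longrightarrow> cls A \<in> G"
  by (simp add: lifts_def)

lemma lifts_cases:
  assumes "subgroup G PSL3" "g \<in> G" obtains A where "A \<in> lifts G" "g = cls A"
proof -
  obtain A where "det A = 1" "g = cls A"
    using cls_cases[OF subgroup.mem_carrier[OF assms]] .
  then show ?thesis using that[of A] assms(2) by (simp add: lifts_def)
qed

lemma lifts_mult: "subgroup G PSL3 \<Longrightarrow> A \<in> lifts G \<Longrightarrow> B \<in> lifts G \<Longrightarrow> A ** B \<in> lifts G"
  using subgroup.m_closed[of G PSL3 "cls A" "cls B"]
  by (simp add: lifts_def det_mul cls_mult)

lemma lifts_adj3: "subgroup G PSL3 \<Longrightarrow> A \<in> lifts G \<Longrightarrow> adj3 A \<in> lifts G"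
  using subgroup.m_inv_closed[of G PSL3 "cls A"]
  by (simp add: lifts_def det_adj3 cls_adj3)

section \<open>Convergence in the projective plane\<close>

lemma point_of_eq_iff:
  assumes "u \<noteq> 0" "v \<noteq> 0"
  shows "point_of u = point_of v \<longleftrightarrow> parallel u v"
proof
  assume "point_of u = point_of v"
  then have "v \<in> vec.span {u}"
    using mem_point_of[OF assms(2)] Rep_point_of[OF assms(1)] by metis
  then show "parallel u v"
    by (auto simp: parallel_def vec.span_singleton)
next
  assume "parallel u v"
  then have "v \<in> Rep_cp2 (point_of u)"
    using Rep_point_of[OF assms(1)] by (auto simp: parallel_def vec.span_singleton)
  then show "point_of u = point_of v"
    using point_of_eq assms(2) by metis
qed

lemma parallel_sym: "parallel u v \<Longrightarrow> v \<noteq> 0 \<Longrightarrow> parallel v u"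
proof -
  assume "parallel u v" "v \<noteq> 0"
  then obtain c where c: "v = c *s u" "c \<noteq> 0" unfolding parallel_def by auto
  then have "u = (1/c) *s v" by (simp add: vec_eq_iff)
  then show ?thesis unfolding parallel_def by blast
qed

lemma point_of_scale: "c \<noteq> 0 \<Longrightarrow> v \<noteq> 0 \<Longrightarrow> point_of (c *s v) = point_of v"
  by (rule sym) (subst point_of_eq_iff, auto simp: parallel_def)

lemma point_of_scaleR: "r \<noteq> 0 \<Longrightarrow> v \<noteq> 0 \<Longrightarrow> point_of (r *\<^sub>R v) = point_of v"
  unfolding scaleR_eq_scale by (rule point_of_scale) simp_all

lemma tendsto_point_of:
  assumes "(f \<longlongrightarrow> v) F" "v \<noteq> 0"
  shows "((\<lambda>x. point_of (f x)) \<longlongrightarrow> point_of v) F"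
proof -
  have "isCont point_of v"
    using continuous_on_point_of assms(2) by (simp add: continuous_on_eq_continuous_at open_Compl)
  then show ?thesis using assms(1) isCont_tendsto_compose by blast
qed

text \<open>The representatives are the orthogonal projections of \<open>v\<close> onto the lines \<open>p n\<close>. The finitely
  many of them that may vanish are replaced by arbitrary representatives.\<close>

lemma tendsto_cp2_lift:
  assumes "p \<longlonglongrightarrow> point_of v" "v \<noteq> 0"
  obtains u where "\<And>n::nat. u n \<noteq> 0" "\<And>n. p n = point_of (u n)" "u \<longlonglongrightarrow> v"
proof -
  define w where "w n = line_projector (p n) *v v" for n
  have "(\<lambda>n. dist (line_projector (p n)) (line_projector (point_of v))) \<longlonglongrightarrow> 0"
    using tendsto_dist_iff[of p "point_of v" sequentially] assms(1)
    unfolding dist_cp2_def dist_norm by (rule iffD1)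
  then have "(\<lambda>n. line_projector (p n)) \<longlonglongrightarrow> line_projector (point_of v)"
    using tendsto_dist_iff[of "\<lambda>n. line_projector (p n)"] by blast
  then have "w \<longlonglongrightarrow> line_projector (point_of v) *v v"
    unfolding w_def by (intro tendsto_intros)
  then have w: "w \<longlonglongrightarrow> v"
    using assms(2) by (simp add: line_projector_point_of projector_self)
  then have ev: "\<forall>\<^sub>F n in sequentially. w n \<noteq> 0"
    using assms(2) tendsto_imp_eventually_ne by blast
  have wp: "p n = point_of (w n)" if "w n \<noteq> 0" for n
  proof -
    obtain x where x: "x \<noteq> 0" "p n = point_of x" by (rule cp2_cases)
    then have "w n = ((\<Sum>j\<in>UNIV. cnj (x $ j) * v $ j) / complex_of_real ((norm x)\<^sup>2)) *s x"
      by (simp add: w_def line_projector_point_of projector_mult)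
    then have "parallel x (w n)" unfolding parallel_def by blast
    then show ?thesis using x that by (simp add: point_of_eq_iff)
  qed
  define u where "u n = (if w n \<noteq> 0 then w n else (SOME x. x \<noteq> 0 \<and> p n = point_of x))" for n
  have "u n \<noteq> 0 \<and> p n = point_of (u n)" for n
  proof (cases "w n = 0")
    case True
    have "\<exists>x. x \<noteq> 0 \<and> p n = point_of x" using cp2_cases by metis
    from someI_ex[OF this] show ?thesis using True by (simp add: u_def)
  qed (use wp in \<open>simp add: u_def\<close>)
  moreover have "u \<longlonglongrightarrow> v"
    by (rule Lim_transform_eventually[OF w]) (use ev in \<open>auto simp: u_def elim: eventually_mono\<close>)
  ultimately show ?thesis using that by blast
qed

lemma tendsto_psl_act:
  assumes "g \<in> carrier PSL3" "p \<longlonglongrightarrow> q"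
  shows "(\<lambda>n::nat. psl_act g (p n)) \<longlonglongrightarrow> psl_act g q"
proof -
  obtain A where A: "det A = 1" "g = cls A" using cls_cases assms(1) by blast
  obtain v where v: "v \<noteq> 0" "q = point_of v" by (rule cp2_cases)
  obtain u where u: "\<And>n::nat. u n \<noteq> 0" "\<And>n. p n = point_of (u n)" "u \<longlonglongrightarrow> v"
    using tendsto_cp2_lift assms(2) v by blast
  have "(\<lambda>n. A *v u n) \<longlonglongrightarrow> A *v v" by (intro tendsto_intros u)
  from tendsto_point_of[OF this] show ?thesis
    using A u v by (simp add: psl_act_cls det_one_vec_nonzero)
qed

lemma compact_UNIV_cp2: "compact (UNIV :: cp2 set)"
proof -
  have "point_of ` sphere 0 1 = UNIV"
  proof (intro equalityI subsetI)
    fix p :: cp2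
    obtain v where v: "v \<noteq> 0" "p = point_of v" by (rule cp2_cases)
    then have "p = point_of ((1 / norm v) *\<^sub>R v)" by (simp add: point_of_scaleR)
    moreover have "(1 / norm v) *\<^sub>R v \<in> sphere 0 1" using v by simp
    ultimately show "p \<in> point_of ` sphere 0 1" by blast
  qed simp
  moreover have "continuous_on (sphere 0 1) point_of"
    by (rule continuous_on_subset[OF continuous_on_point_of]) auto
  ultimately show ?thesis
    using compact_continuous_image[OF _ compact_sphere] by metis
qed

lemma cp2_subsequence:
  fixes p :: "nat \<Rightarrow> cp2"
  obtains r q where "strict_mono (r :: nat \<Rightarrow> nat)" "(\<lambda>n. p (r n)) \<longlonglongrightarrow> q"
  using compact_UNIV_cp2 unfolding compact_def o_def by (metis UNIV_I)

lemma compact_cball_cp2: "compact (cball (p :: cp2) e)"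
  using compact_UNIV_cp2 by (metis closed_cball compact_Int_closed inf_top_left)

section \<open>Complex lines as zero sets of functionals\<close>

definition line_of :: "complex^3 \<Rightarrow> cp2 set" where
  "line_of a = {p. \<exists>v. v \<noteq> 0 \<and> p = point_of v \<and> a \<cdot> v = 0}"

lemma point_of_in_line_of: "v \<noteq> 0 \<Longrightarrow> point_of v \<in> line_of a \<longleftrightarrow> a \<cdot> v = 0"
  by (auto simp: line_of_def point_of_eq_iff parallel_def)

lemma mem_line_of_iff: "p \<in> line_of a \<longleftrightarrow> Rep_cp2 p \<subseteq> {v. a \<cdot> v = 0}"
proof -
  obtain v where v: "v \<noteq> 0" "p = point_of v" by (rule cp2_cases)
  have "Rep_cp2 p \<subseteq> {v. a \<cdot> v = 0} \<longleftrightarrow> a \<cdot> v = 0"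
    using v mem_point_of[OF v(1)] by (auto simp: Rep_point_of vec.span_singleton)
  then show ?thesis using v by (simp add: point_of_in_line_of)
qed

lemma subspace_annihilator: "vec.subspace {v. a \<cdot> v = 0}"
  by (simp add: vec.subspace_def)

text \<open>One vector on which the functional does not vanish completes its kernel to the whole space.\<close>

lemma dim_annihilator:
  assumes "a \<noteq> 0" shows "vec.dim {v. a \<cdot> v = 0} = 2"
proof -
  define w where "w = conj_vec a"
  have w: "a \<cdot> w \<noteq> 0" using pairing_self_conj_nonzero[OF assms] by (simp add: w_def)
  let ?W = "{v. a \<cdot> v = 0}"
  have sp: "vec.span ?W = ?W"
    using subspace_annihilator by (simp add: vec.span_eq_iff)
  have "x \<in> vec.span (insert w ?W)" for x
  proof -
    have "x - ((a \<cdot> x) / (a \<cdot> w)) *s w \<in> ?W" using w by simp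
    then show ?thesis using sp vec.span_insert[of w ?W] by blast
  qed
  then have "vec.span (insert w ?W) = UNIV" by blast
  then have "vec.dim (insert w ?W) = 3"
    using vec_dim_card[where 'n=3 and 'a=complex] vec.dim_span[of "insert w ?W"] by simp
  moreover have "vec.dim (insert w ?W) = vec.dim ?W + 1"
    unfolding vec.dim_insert sp using w by simp
  ultimately show ?thesis by simp
qed

lemma complex_line_line_of: "a \<noteq> 0 \<Longrightarrow> complex_line (line_of a)"
  unfolding complex_line_def using subspace_annihilator dim_annihilator mem_line_of_iff by blast

text \<open>Two independent vectors of the plane span it: any further vector outside their span would,
  by Cramer's rule, make the plane the whole space.\<close>

lemma complex_line_obtains:
  assumes "complex_line l" obtains a where "a \<noteq> 0" "l = line_of a"
proof -
  obtain W where W: "vec.subspace W" "vec.dim W = 2" "l = {p. Rep_cp2 p \<subseteq> W}"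
    using assms unfolding complex_line_def by blast
  obtain u where u: "u \<in> W" "u \<noteq> 0"
    using W(2) vec.dim_eq_0[of W] by auto
  have "\<not> W \<subseteq> vec.span {u}"
    using vec.dim_le_card[of W "{u}"] W(2) by auto
  then obtain v where v: "v \<in> W" "v \<notin> vec.span {u}" by blast
  then have np: "\<not> parallel u v" by (auto simp: parallel_def vec.span_singleton)
  define a where "a = cross u v"
  have "a \<noteq> 0" using cross_eq_0_iff u np by (simp add: a_def)
  have 1: "x \<in> W" if ax: "a \<cdot> x = 0" for x
  proof -
    obtain s t where "x = s *s u + t *s v"
      using in_span_of_cross[OF np u(2) ax[unfolded a_def]] .
    then show ?thesis
      using W(1) u v by (simp add: vec.subspace_add vec.subspace_scale)
  qed
  have "a \<cdot> x = 0" if "x \<in> W" for x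
  proof (rule ccontr)
    assume nz: "a \<cdot> x \<noteq> 0"
    have "y \<in> W" for y
    proof -
      have "(a \<cdot> x) *s y \<in> W"
        unfolding a_def cross_expansion[of u v x y] using W(1) u v that
        by (simp add: vec.subspace_add vec.subspace_scale)
      then have "(1 / (a \<cdot> x)) *s ((a \<cdot> x) *s y) \<in> W" using W(1) vec.subspace_scale by blast
      then show ?thesis using nz by simp
    qed
    then have "W = UNIV" by blast
    then show False using W(2) vec_dim_card[where 'n=3 and 'a=complex] by simp
  qed
  with 1 have "W = {v. a \<cdot> v = 0}" by blast
  then have "l = line_of a" using W(3) mem_line_of_iff by blast
  then show ?thesis using that \<open>a \<noteq> 0\<close> by blast
qed

text \<open>Three lines are in general position if and only if the functionals that define them are linearly
  independent; independence is used in the form that they have no common zero.\<close>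

lemma three_lines_obtains:
  assumes "contains_three_lines_gp S"
  obtains a b c where "a \<noteq> 0" "b \<noteq> 0" "c \<noteq> 0" "line_of a \<subseteq> S" "line_of b \<subseteq> S" "line_of c \<subseteq> S"
    "\<And>v. a \<cdot> v = 0 \<Longrightarrow> b \<cdot> v = 0 \<Longrightarrow> c \<cdot> v = 0 \<Longrightarrow> v = 0"
proof -
  obtain \<L> where L: "general_position \<L>" "card \<L> = 3" "\<forall>l\<in>\<L>. l \<subseteq> S"
    using assms unfolding contains_three_lines_gp_def by blast
  then obtain l m k where lmk: "\<L> = {l, m, k}" "l \<noteq> m" "l \<noteq> k" "m \<noteq> k"
    by (auto simp: card_3_iff)
  have "complex_line l" "complex_line m" "complex_line k" and e: "l \<inter> m \<inter> k = {}"
    using L(1) lmk unfolding general_position_def by auto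
  obtain a where a: "a \<noteq> 0" "l = line_of a"
    using complex_line_obtains[OF \<open>complex_line l\<close>] .
  obtain b where b: "b \<noteq> 0" "m = line_of b"
    using complex_line_obtains[OF \<open>complex_line m\<close>] .
  obtain c where c: "c \<noteq> 0" "k = line_of c"
    using complex_line_obtains[OF \<open>complex_line k\<close>] .
  have 1: "v = 0" if "a \<cdot> v = 0" "b \<cdot> v = 0" "c \<cdot> v = 0" for v
  proof (rule ccontr)
    assume "v \<noteq> 0"
    then have "point_of v \<in> l \<inter> m \<inter> k" using that a b c by (simp add: point_of_in_line_of)
    then show False using e by blast
  qed
  have "line_of a \<subseteq> S" "line_of b \<subseteq> S" "line_of c \<subseteq> S"
    using L(3) lmk(1) a b c by auto
  then show ?thesis using that[of a b c] a b c 1 by blast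
qed

section \<open>Limits of divergent sequences of transformations\<close>

text \<open>The matrices \<open>B\<close> and \<open>C\<close> are limits of a divergent sequence and of its inverses in the projective
  space of all nonzero matrices. The scaling factors are left arbitrary, which makes the notion stable under
  products with a fixed group element. Divergence is expressed by the factors tending to zero: the
  representatives have determinant one, and their norms tend to infinity.\<close>

definition collapsing ::
    "(complex^3^3) set set \<Rightarrow> (nat \<Rightarrow> complex^3^3) \<Rightarrow> complex^3^3 \<Rightarrow> complex^3^3 \<Rightarrow> bool" where
  "collapsing G A B C \<longleftrightarrow> (\<forall>n. A n \<in> lifts G) \<and> B \<noteq> 0 \<and> C \<noteq> 0 \<and>
     (\<exists>s t :: nat \<Rightarrow> real. (\<forall>n. s n > 0 \<and> t n > 0) \<and> s \<longlonglongrightarrow> 0 \<and> t \<longlonglongrightarrow> 0 \<and>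
        (\<lambda>n. s n *\<^sub>R A n) \<longlonglongrightarrow> B \<and> (\<lambda>n. t n *\<^sub>R adj3 (A n)) \<longlonglongrightarrow> C)"

lemma collapsingI:
  fixes s t :: "nat \<Rightarrow> real"
  assumes "\<And>n. A n \<in> lifts G" "B \<noteq> 0" "C \<noteq> 0" "\<And>n. s n > 0" "\<And>n. t n > 0"
    "s \<longlonglongrightarrow> 0" "t \<longlonglongrightarrow> 0"
    "(\<lambda>n. s n *\<^sub>R A n) \<longlonglongrightarrow> B" "(\<lambda>n. t n *\<^sub>R adj3 (A n)) \<longlonglongrightarrow> C"
  shows "collapsing G A B C"
  unfolding collapsing_def using assms by blast

lemma collapsing_lifts: "collapsing G A B C \<Longrightarrow> A n \<in> lifts G"
  by (simp add: collapsing_def)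

lemma collapsing_det: "collapsing G A B C \<Longrightarrow> det (A n) = 1"
  using collapsing_lifts lifts_det by blast

lemma collapsing_nonzero: "collapsing G A B C \<Longrightarrow> B \<noteq> 0" "collapsing G A B C \<Longrightarrow> C \<noteq> 0"
  by (simp_all add: collapsing_def)

lemma collapsing_scales:
  assumes "collapsing G A B C"
  obtains s t :: "nat \<Rightarrow> real" where "\<And>n. s n > 0" "\<And>n. t n > 0" "s \<longlonglongrightarrow> 0" "t \<longlonglongrightarrow> 0"
    "(\<lambda>n. s n *\<^sub>R A n) \<longlonglongrightarrow> B" "(\<lambda>n. t n *\<^sub>R adj3 (A n)) \<longlonglongrightarrow> C"
  using assms unfolding collapsing_def by blast

lemma collapsing_scale:
  assumes "collapsing G A B C"
  shows "\<exists>s :: nat \<Rightarrow> real. (\<forall>n. s n > 0) \<and> s \<longlonglongrightarrow> 0 \<and> (\<lambda>n. s n *\<^sub>R A n) \<longlonglongrightarrow> B"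
proof -
  obtain s t :: "nat \<Rightarrow> real" where st: "\<And>n. s n > 0" "\<And>n. t n > 0" "s \<longlonglongrightarrow> 0" "t \<longlonglongrightarrow> 0"
    "(\<lambda>n. s n *\<^sub>R A n) \<longlonglongrightarrow> B" "(\<lambda>n. t n *\<^sub>R adj3 (A n)) \<longlonglongrightarrow> C"
    using collapsing_scales[OF assms] by blast
  show ?thesis by (intro exI[of _ s] conjI allI st(1,3,5))
qed

lemma collapsing_inverse:
  assumes "subgroup G PSL3" "collapsing G A B C"
  shows "collapsing G (\<lambda>n. adj3 (A n)) C B"
proof -
  obtain s t :: "nat \<Rightarrow> real" where st: "\<And>n. s n > 0" "\<And>n. t n > 0" "s \<longlonglongrightarrow> 0" "t \<longlonglongrightarrow> 0"
    "(\<lambda>n. s n *\<^sub>R A n) \<longlonglongrightarrow> B" "(\<lambda>n. t n *\<^sub>R adj3 (A n)) \<longlonglongrightarrow> C"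
    using collapsing_scales[OF assms(2)] by blast
  have "\<And>n. adj3 (A n) \<in> lifts G"
    using assms lifts_adj3 collapsing_lifts by blast
  moreover have "\<And>n. adj3 (adj3 (A n)) = A n"
    using assms(2) adj3_adj3 collapsing_det by blast
  ultimately show ?thesis
    using collapsing_nonzero[OF assms(2)] st
    by (intro collapsingI[where s = t and t = s]) simp_all
qed

lemma collapsing_subseq:
  assumes "collapsing G A B C" "strict_mono r"
  shows "collapsing G (\<lambda>n. A (r n)) B C"
proof -
  obtain s t :: "nat \<Rightarrow> real" where st: "\<And>n. s n > 0" "\<And>n. t n > 0" "s \<longlonglongrightarrow> 0" "t \<longlonglongrightarrow> 0"
    "(\<lambda>n. s n *\<^sub>R A n) \<longlonglongrightarrow> B" "(\<lambda>n. t n *\<^sub>R adj3 (A n)) \<longlonglongrightarrow> C"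
    using collapsing_scales[OF assms(1)] by blast
  note lims = LIMSEQ_subseq_LIMSEQ[OF _ assms(2), unfolded o_def]
  show ?thesis
    using collapsing_nonzero[OF assms(1)] collapsing_lifts[OF assms(1)] st(1,2)
      lims[OF st(3)] lims[OF st(4)] lims[OF st(5)] lims[OF st(6)]
    by (intro collapsingI[where s = "\<lambda>n. s (r n)" and t = "\<lambda>n. t (r n)"]) simp_all
qed

lemma collapsing_mono: "collapsing G A B C \<Longrightarrow> G \<subseteq> H \<Longrightarrow> collapsing H A B C"
  unfolding collapsing_def lifts_def by blast

lemma collapsing_mult_right:
  assumes "subgroup G PSL3" "collapsing G A B C" "h \<in> lifts G"
  shows "collapsing G (\<lambda>n. A n ** h) (B ** h) (adj3 h ** C)"
proof -
  obtain s t :: "nat \<Rightarrow> real" where st: "\<And>n. s n > 0" "\<And>n. t n > 0" "s \<longlonglongrightarrow> 0" "t \<longlonglongrightarrow> 0"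
    "(\<lambda>n. s n *\<^sub>R A n) \<longlonglongrightarrow> B" "(\<lambda>n. t n *\<^sub>R adj3 (A n)) \<longlonglongrightarrow> C"
    using collapsing_scales[OF assms(2)] by blast
  have h: "det h = 1" using assms(3) lifts_det by blast
  have "B ** h \<noteq> 0"
  proof
    assume "B ** h = 0"
    then have "B ** h ** adj3 h = 0" by simp
    then show False
      using collapsing_nonzero(1)[OF assms(2)] h by (simp add: adj3_mult flip: matrix_mul_assoc)
  qed
  moreover have "adj3 h ** C \<noteq> 0"
  proof
    assume "adj3 h ** C = 0"
    then have "h ** (adj3 h ** C) = 0" by simp
    then show False
      using collapsing_nonzero(2)[OF assms(2)] h by (simp add: adj3_mult matrix_mul_assoc)
  qed
  moreover have "(\<lambda>n. s n *\<^sub>R (A n ** h)) \<longlonglongrightarrow> B ** h"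
    using tendsto_matrix_matrix[OF st(5) tendsto_const[of h]] by (simp add: scaleR_matrix_matrix)
  moreover have "(\<lambda>n. t n *\<^sub>R adj3 (A n ** h)) \<longlonglongrightarrow> adj3 h ** C"
    using tendsto_matrix_matrix[OF tendsto_const[of "adj3 h"] st(6)]
    by (simp add: scaleR_matrix_matrix adj3_matrix_mult h collapsing_det[OF assms(2)])
  moreover have "\<And>n. A n ** h \<in> lifts G"
    using lifts_mult[OF assms(1) collapsing_lifts[OF assms(2)] assms(3)] .
  ultimately show ?thesis
    using st(1-4) by (intro collapsingI[where s = s and t = t]) simp_all
qed

text \<open>The product of the rescaled matrices is the identity times \<open>s n * t n\<close>, which tends to zero.
  Hence the image of each limit lies in the kernel of the other one; nearly everything below rests on this.\<close>

lemma collapsing_mult_zero: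
  assumes "subgroup G PSL3" "collapsing G A B C"
  shows "B *v (C *v v) = 0" "C *v (B *v v) = 0"
proof -
  have 1: "C *v (B *v v) = 0" if c: "collapsing G A B C" for A B C
  proof -
    obtain s t :: "nat \<Rightarrow> real" where st: "\<And>n. s n > 0" "\<And>n. t n > 0" "s \<longlonglongrightarrow> 0" "t \<longlonglongrightarrow> 0"
      "(\<lambda>n. s n *\<^sub>R A n) \<longlonglongrightarrow> B" "(\<lambda>n. t n *\<^sub>R adj3 (A n)) \<longlonglongrightarrow> C"
      using collapsing_scales[OF c] by blast
    have "(\<lambda>n. (t n *\<^sub>R adj3 (A n)) *v ((s n *\<^sub>R A n) *v v)) \<longlonglongrightarrow> C *v (B *v v)"
      using tendsto_matrix_vector[OF st(6) tendsto_matrix_vector[OF st(5) tendsto_const]] .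
    moreover have "(t n *\<^sub>R adj3 (A n)) *v ((s n *\<^sub>R A n) *v v) = (t n * s n) *\<^sub>R v" for n
      using collapsing_det[OF c, of n]
      by (simp add: scaleR_matrix_vector matrix_vector_scaleR adj3_vec)
    moreover have "(\<lambda>n. (t n * s n) *\<^sub>R v) \<longlonglongrightarrow> (0 * 0) *\<^sub>R v"
      by (intro tendsto_intros st)
    ultimately show ?thesis
      using LIMSEQ_unique[of _ "C *v (B *v v)" "(0 * 0) *\<^sub>R v"] by simp
  qed
  show "C *v (B *v v) = 0" using 1 assms(2) .
  show "B *v (C *v v) = 0" using 1 collapsing_inverse[OF assms] .
qed

lemma collapsing_tendsto:
  assumes "collapsing G A B C" "u \<longlonglongrightarrow> v" "\<And>n. u n \<noteq> 0" "B *v v \<noteq> 0"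
  shows "(\<lambda>n. point_of (A n *v u n)) \<longlonglongrightarrow> point_of (B *v v)"
proof -
  obtain s :: "nat \<Rightarrow> real"
    where s: "(\<forall>n. s n > 0) \<and> s \<longlonglongrightarrow> 0 \<and> (\<lambda>n. s n *\<^sub>R A n) \<longlonglongrightarrow> B"
    using collapsing_scale[OF assms(1)] ..
  then have st: "\<And>n. s n > 0" "(\<lambda>n. s n *\<^sub>R A n) \<longlonglongrightarrow> B" by simp_all
  have "(\<lambda>n. (s n *\<^sub>R A n) *v u n) \<longlonglongrightarrow> B *v v"
    using tendsto_matrix_vector[OF st(2) assms(2)] .
  then have "(\<lambda>n. point_of ((s n *\<^sub>R A n) *v u n)) \<longlonglongrightarrow> point_of (B *v v)"
    using assms(4) by (rule tendsto_point_of)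
  moreover have "point_of ((s n *\<^sub>R A n) *v u n) = point_of (A n *v u n)" for n
    using st(1)[of n] det_one_vec_nonzero[OF collapsing_det[OF assms(1)] assms(3)]
    by (simp add: scaleR_matrix_vector point_of_scaleR)
  ultimately show ?thesis by simp
qed

text \<open>If \<open>x\<^sub>n \<longlonglongrightarrow> x\<close> and \<open>A\<^sub>n x\<^sub>n \<longlonglongrightarrow> y\<close>, then \<open>x\<close> determines \<open>y\<close> unless it lies in the kernel of
  \<open>B\<close>, and \<open>y\<close> determines \<open>x\<close> unless it lies in the kernel of \<open>C\<close>. These two statements contain all of the
  dynamics that is needed.\<close>

lemma collapsing_relation_image:
  assumes "collapsing G A B C" "p \<longlonglongrightarrow> point_of v" "v \<noteq> 0"
    "(\<lambda>n. psl_act (cls (A n)) (p n)) \<longlonglongrightarrow> point_of w" "B *v v \<noteq> 0"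
  shows "point_of (B *v v) = point_of w"
proof -
  obtain u where u: "\<And>n::nat. u n \<noteq> 0" "\<And>n. p n = point_of (u n)" "u \<longlonglongrightarrow> v"
    using tendsto_cp2_lift[OF assms(2,3)] by blast
  have "(\<lambda>n. point_of (A n *v u n)) \<longlonglongrightarrow> point_of (B *v v)"
    using collapsing_tendsto[OF assms(1) u(3,1) assms(5)] .
  moreover have "psl_act (cls (A n)) (p n) = point_of (A n *v u n)" for n
    using psl_act_cls[OF collapsing_det[OF assms(1)] u(1)] u(2) by simp
  ultimately show ?thesis
    using LIMSEQ_unique[OF _ assms(4)] by simp
qed

lemma psl_act_adj3:
  assumes "det A = 1"
  shows "psl_act (cls (adj3 A)) (psl_act (cls A) p) = p" "psl_act (cls A) (psl_act (cls (adj3 A)) p) = p"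
  using psl_act_inv[OF cls_in_carrier[OF assms], of p] by (simp_all add: cls_adj3[OF assms])

lemma collapsing_relation_preimage:
  assumes "subgroup G PSL3" "collapsing G A B C" "p \<longlonglongrightarrow> point_of v"
    "(\<lambda>n. psl_act (cls (A n)) (p n)) \<longlonglongrightarrow> point_of w" "w \<noteq> 0" "C *v w \<noteq> 0"
  shows "point_of (C *v w) = point_of v"
proof (rule collapsing_relation_image[OF collapsing_inverse[OF assms(1,2)] assms(4,5) _ assms(6)])
  show "(\<lambda>n. psl_act (cls (adj3 (A n))) (psl_act (cls (A n)) (p n))) \<longlonglongrightarrow> point_of v"
    using assms(3) by (simp add: psl_act_adj3[OF collapsing_det[OF assms(2)]])
qed

subsection \<open>Persistence of zeros of functionals\<close>

text \<open>A linear counterpart of Hurwitz's theorem: a zero of the limit functional is a limit of zeros,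
  because it can be corrected along a fixed vector on which the limit does not vanish.\<close>

lemma functional_zeros_persist:
  assumes "f \<longlonglongrightarrow> a" "a \<noteq> 0" "a \<cdot> v = 0" "v \<noteq> 0"
  shows "\<exists>u. (\<forall>n::nat. u n \<noteq> 0) \<and> u \<longlonglongrightarrow> v \<and> (\<forall>\<^sub>F n in sequentially. f n \<cdot> u n = 0)"
proof -
  define w where "w = conj_vec a"
  have w: "a \<cdot> w \<noteq> 0" using pairing_self_conj_nonzero[OF assms(2)] by (simp add: w_def)
  \<comment> \<open>The correction of \<open>v\<close> along \<open>w\<close> to a zero of \<open>f n\<close>; it is nonzero only eventually.\<close>
  define x where "x n = v - (f n \<cdot> v / (f n \<cdot> w)) *s w" for n
  have "x \<longlonglongrightarrow> v - (a \<cdot> v / (a \<cdot> w)) *s w"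
    unfolding x_def by (intro tendsto_intros assms(1) w)
  then have x: "x \<longlonglongrightarrow> v" using assms(3) by simp
  have "(\<lambda>n. f n \<cdot> w) \<longlonglongrightarrow> a \<cdot> w"
    by (intro tendsto_intros assms(1))
  from tendsto_imp_eventually_ne[OF this w]
  have fw: "\<forall>\<^sub>F n in sequentially. f n \<cdot> w \<noteq> 0" .
  have ne: "\<forall>\<^sub>F n in sequentially. x n \<noteq> 0"
    using tendsto_imp_eventually_ne[OF x assms(4)] .
  define u where "u n = (if x n = 0 then v else x n)" for n
  have 1: "u \<longlonglongrightarrow> v"
  proof (rule Lim_transform_eventually[OF x])
    show "\<forall>\<^sub>F n in sequentially. x n = u n"
      using ne by eventually_elim (simp add: u_def)
  qed
  have 2: "\<forall>\<^sub>F n in sequentially. f n \<cdot> u n = 0"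
    using fw ne by eventually_elim (simp add: u_def x_def)
  have 3: "u n \<noteq> 0" for n using assms(4) by (simp add: u_def)
  show ?thesis by (intro exI[of _ u] conjI allI 1 2 3)
qed

text \<open>Near a point in the kernel of \<open>B\<close> the transformations \<open>A n\<close> therefore reach every line that does
  not contain the image of \<open>B\<close>. This is the obstruction to equicontinuity and to avoiding lines.\<close>

lemma collapsing_zeros_persist:
  assumes "collapsing G A B C" "a v* B \<noteq> 0" "B *v v = 0" "v \<noteq> 0"
  shows "\<exists>u. (\<forall>n::nat. u n \<noteq> 0) \<and> u \<longlonglongrightarrow> v \<and> (\<forall>\<^sub>F n in sequentially. a \<cdot> (A n *v u n) = 0)"
proof -
  obtain s :: "nat \<Rightarrow> real"
    where s: "(\<forall>n. s n > 0) \<and> s \<longlonglongrightarrow> 0 \<and> (\<lambda>n. s n *\<^sub>R A n) \<longlonglongrightarrow> B"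
    using collapsing_scale[OF assms(1)] ..
  then have st: "\<And>n. s n > 0" "(\<lambda>n. s n *\<^sub>R A n) \<longlonglongrightarrow> B" by simp_all
  have lim: "(\<lambda>n. a v* (s n *\<^sub>R A n)) \<longlonglongrightarrow> a v* B"
    using tendsto_vector_matrix[OF st(2) tendsto_const] .
  have 0: "(a v* B) \<cdot> v = 0" using assms(3) by (simp flip: pairing_matrix)
  obtain u where u: "(\<forall>n::nat. u n \<noteq> 0) \<and> u \<longlonglongrightarrow> v \<and>
      (\<forall>\<^sub>F n in sequentially. (a v* (s n *\<^sub>R A n)) \<cdot> u n = 0)"
    using functional_zeros_persist[OF lim assms(2) 0 assms(4)] ..
  from u have "\<forall>\<^sub>F n in sequentially. (a v* (s n *\<^sub>R A n)) \<cdot> u n = 0" by blast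
  then have "\<forall>\<^sub>F n in sequentially. a \<cdot> (A n *v u n) = 0"
  proof eventually_elim
    case (elim n)
    then show ?case
      using st(1)[of n] by (simp add: scaleR_matrix_vector flip: pairing_matrix)
  qed
  with u show ?thesis by blast
qed

lemma line_limit_subset:
  assumes "f \<longlonglongrightarrow> a" "a \<noteq> 0" "closed S" "\<And>n::nat. line_of (f n) \<subseteq> S"
  shows "line_of a \<subseteq> S"
proof
  fix p assume "p \<in> line_of a"
  then obtain v where v: "v \<noteq> 0" "p = point_of v" "a \<cdot> v = 0"
    unfolding line_of_def by blast
  obtain u where "(\<forall>n::nat. u n \<noteq> 0) \<and> u \<longlonglongrightarrow> v \<and> (\<forall>\<^sub>F n in sequentially. f n \<cdot> u n = 0)"
    using functional_zeros_persist[OF assms(1,2) v(3,1)] ..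
  then have u: "\<And>n. u n \<noteq> 0" "u \<longlonglongrightarrow> v" "\<forall>\<^sub>F n in sequentially. f n \<cdot> u n = 0"
    by simp_all
  from u(3) have "\<forall>\<^sub>F n in sequentially. point_of (u n) \<in> S"
    using assms(4) u(1) by (auto elim!: eventually_mono simp: point_of_in_line_of subset_iff)
  then show "p \<in> S"
    using Lim_in_closed_set[OF assms(3) _ _ tendsto_point_of[OF u(2) v(1)]] v(2) by simp
qed

subsection \<open>Discreteness\<close>

text \<open>Otherwise a subsequence of the matrices converges to an invertible matrix, and the quotients of
  consecutive terms tend to the identity. The identity is isolated in the group, so consecutive terms
  eventually coincide, against injectivity.\<close>

lemma discrete_norms_unbounded:
  assumes G: "subgroup G PSL3" "discrete_in_PSL3 G" and A: "\<And>n. A n \<in> lifts G"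
    and inj: "inj (\<lambda>n. cls (A n))"
  shows "filterlim (\<lambda>n. norm (A n)) at_top sequentially"
proof (rule ccontr)
  assume "\<not> ?thesis"
  then obtain M where M: "\<not> (\<forall>\<^sub>F n in sequentially. M \<le> norm (A n))"
    unfolding filterlim_at_top by blast
  have "infinite {n. norm (A n) \<le> M}"
  proof
    assume "finite {n. norm (A n) \<le> M}"
    then obtain N where "\<forall>n\<in>{n. norm (A n) \<le> M}. n < N"
      unfolding finite_nat_set_iff_bounded by blast
    then have "\<forall>n\<ge>N. \<not> norm (A n) \<le> M" by (auto simp flip: not_less)
    then have "\<forall>n\<ge>N. M \<le> norm (A n)" by auto
    with M show False unfolding eventually_sequentially by blast
  qed
  then obtain q where q: "strict_mono (q :: nat \<Rightarrow> nat)" "\<forall>n. q n \<in> {n. norm (A n) \<le> M}"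
    using infinite_enumerate by blast
  then have "\<forall>n. A (q n) \<in> cball 0 M" by simp
  then obtain L r where r: "strict_mono (r :: nat \<Rightarrow> nat)" "((\<lambda>n. A (q n)) \<circ> r) \<longlonglongrightarrow> L"
    using compact_cball[of "0 :: complex^3^3" M, unfolded compact_def, rule_format, of "\<lambda>n. A (q n)"]
    by blast
  note r = r[unfolded o_def]
  have det: "det (A n) = 1" for n using A lifts_det by blast
  \<comment> \<open>Quotients of consecutive terms lie in the group and tend to the identity.\<close>
  define E where "E n = A (q (r (Suc n))) ** adj3 (A (q (r n)))" for n
  have "(\<lambda>n. det (A (q (r n)))) \<longlonglongrightarrow> det L" using r(2) by (rule tendsto_det3)
  then have "det L = 1" using det by (simp add: LIMSEQ_const_iff)
  moreover have "E \<longlonglongrightarrow> L ** adj3 L"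
    unfolding E_def by (intro tendsto_intros r LIMSEQ_Suc)
  ultimately have E: "E \<longlonglongrightarrow> mat 1" by (simp add: adj3_mult)
  have Ed: "det (E n) = 1" for n by (simp add: E_def det_mul det det_adj3)
  have "\<one>\<^bsub>PSL3\<^esub> \<in> G" using G(1) by (rule subgroup.one_closed)
  then have "openin (subtopology PSL3_topology G) {\<one>\<^bsub>PSL3\<^esub>}"
    using G(2) unfolding discrete_in_PSL3_def by simp
  then obtain U where U: "openin PSL3_topology U" "{\<one>\<^bsub>PSL3\<^esub>} = U \<inter> G"
    unfolding openin_subtopology by blast
  then obtain T where T: "open T" "{X \<in> carrier SL3. cls X \<in> U} = carrier SL3 \<inter> T"
    unfolding openin_PSL3_topology openin_open cls_def by blast
  have "mat 1 \<in> {X \<in> carrier SL3. cls X \<in> U}"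
    using U(2) by (auto simp: cls_one)
  then have "mat 1 \<in> T" using T(2) by blast
  then have "\<forall>\<^sub>F n in sequentially. E n \<in> T"
    using E T(1) topological_tendstoD by blast
  then obtain n where "E n \<in> T" using eventually_happens'[OF sequentially_bot] by blast
  then have "E n \<in> {X \<in> carrier SL3. cls X \<in> U}" using T(2) Ed by auto
  moreover have "cls (E n) \<in> G"
    unfolding E_def using lifts_cls[OF lifts_mult[OF G(1) A lifts_adj3[OF G(1) A]]] .
  ultimately have "cls (E n) = \<one>\<^bsub>PSL3\<^esub>" using U(2) by blast
  then have "cls (A (q (r (Suc n)))) \<otimes>\<^bsub>PSL3\<^esub> inv\<^bsub>PSL3\<^esub> (cls (A (q (r n)))) = \<one>\<^bsub>PSL3\<^esub>"
    unfolding E_def cls_adj3[OF det] cls_mult[OF det det_adj3[OF det]] .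
  then have "inv\<^bsub>PSL3\<^esub> (inv\<^bsub>PSL3\<^esub> (cls (A (q (r n))))) = cls (A (q (r (Suc n))))"
    using group.inv_equality[OF group_PSL3]
      group.inv_closed[OF group_PSL3 cls_in_carrier[OF det]] cls_in_carrier[OF det] by blast
  then have "cls (A (q (r (Suc n)))) = cls (A (q (r n)))"
    using group.inv_inv[OF group_PSL3 cls_in_carrier[OF det]] by simp
  then have "q (r (Suc n)) = q (r n)"
    using injD[OF inj, of "q (r (Suc n))" "q (r n)"] by simp
  then show False
    using strict_monoD[OF q(1) strict_monoD[OF r(1), of n "Suc n"]] by simp
qed

lemma unit_rescaling:
  fixes A :: "nat \<Rightarrow> complex^3^3"
  assumes "\<And>n. A n \<noteq> 0"
  shows "\<exists>r. strict_mono (r :: nat \<Rightarrow> nat) \<and>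
    (\<exists>B. B \<noteq> 0 \<and> (\<lambda>n. inverse (norm (A (r n))) *\<^sub>R A (r n)) \<longlonglongrightarrow> B)"
proof -
  have "\<forall>n. inverse (norm (A n)) *\<^sub>R A n \<in> sphere 0 1" using assms by simp
  then obtain B r where r: "B \<in> sphere 0 1" "strict_mono (r :: nat \<Rightarrow> nat)"
      "((\<lambda>n. inverse (norm (A n)) *\<^sub>R A n) \<circ> r) \<longlonglongrightarrow> B"
    using compact_sphere[of "0 :: complex^3^3" 1, unfolded compact_def, rule_format,
        of "\<lambda>n. inverse (norm (A n)) *\<^sub>R A n"]
    by blast
  note r = r[unfolded o_def]
  have "B \<noteq> 0" using r(1) by auto
  then show ?thesis by (intro exI[of _ r] exI[of _ B] conjI r(2,3))
qed

text \<open>Compactness of the unit sphere of matrices gives the limits of the normalized matrices and, after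
  a second choice of a subsequence, of the normalized inverses.\<close>

lemma discrete_obtains_collapsing:
  assumes G: "subgroup G PSL3" "discrete_in_PSL3 G" and g: "\<And>n::nat. g n \<in> G" "inj g"
  obtains r A B C where "strict_mono (r :: nat \<Rightarrow> nat)" "collapsing G A B C" "\<And>n. cls (A n) = g (r n)"
proof -
  have "\<exists>X. X \<in> lifts G \<and> cls X = g n" for n
    using lifts_cases[OF G(1) g(1)] by metis
  then obtain A where A: "\<And>n. A n \<in> lifts G" "\<And>n. cls (A n) = g n" by metis
  have det: "det (A n) = 1" for n using A lifts_det by blast
  have nz: "X \<noteq> 0" if "det X = 1" for X :: "complex^3^3" using that by (auto simp: det_3)
  have inv: "cls (adj3 (A n)) = inv\<^bsub>PSL3\<^esub> (g n)" for n using cls_adj3[OF det] A(2) by simp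
  have "inj (\<lambda>n. cls (A n))" using g(2) A(2) by simp
  then have lim: "filterlim (\<lambda>n. norm (A n)) at_top sequentially"
    by (rule discrete_norms_unbounded[OF G A(1)])
  have "inj (\<lambda>n. cls (adj3 (A n)))"
    unfolding inv
  proof (rule injI)
    fix m n assume "inv\<^bsub>PSL3\<^esub> (g m) = inv\<^bsub>PSL3\<^esub> (g n)"
    then have "g m = g n"
      using inj_onD[OF group.inv_inj[OF group_PSL3]] subgroup.mem_carrier[OF G(1) g(1)] by blast
    then show "m = n" using g(2) by (simp add: inj_eq)
  qed
  then have lim': "filterlim (\<lambda>n. norm (adj3 (A n))) at_top sequentially"
    by (rule discrete_norms_unbounded[OF G lifts_adj3[OF G(1) A(1)]])
  obtain r where r: "strict_mono (r :: nat \<Rightarrow> nat) \<and>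
    (\<exists>B. B \<noteq> 0 \<and> (\<lambda>n. inverse (norm (A (r n))) *\<^sub>R A (r n)) \<longlonglongrightarrow> B)"
    using unit_rescaling[of A, OF nz[OF det]] ..
  note r1 = r[THEN conjunct1]
  obtain B where B: "B \<noteq> 0 \<and> (\<lambda>n. inverse (norm (A (r n))) *\<^sub>R A (r n)) \<longlonglongrightarrow> B"
    using r[THEN conjunct2] ..
  have lim2: "filterlim (\<lambda>n. norm (adj3 (A (r n)))) at_top sequentially"
    using filterlim_compose[OF lim' filterlim_subseq[OF r1]] .
  obtain q where q: "strict_mono (q :: nat \<Rightarrow> nat) \<and>
    (\<exists>C. C \<noteq> 0 \<and> (\<lambda>n. inverse (norm (adj3 (A (r (q n))))) *\<^sub>R adj3 (A (r (q n)))) \<longlonglongrightarrow> C)"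
    using unit_rescaling[of "\<lambda>n. adj3 (A (r n))", OF nz[OF det_adj3[OF det]]] ..
  note q1 = q[THEN conjunct1]
  obtain C where C: "C \<noteq> 0 \<and>
      (\<lambda>n. inverse (norm (adj3 (A (r (q n))))) *\<^sub>R adj3 (A (r (q n)))) \<longlonglongrightarrow> C"
    using q[THEN conjunct2] ..
  have rq: "strict_mono (\<lambda>n. r (q n))"
    using strict_mono_compose[OF r1 q1] by simp
  have 1: "collapsing G (\<lambda>n. A (r (q n))) B C"
  proof (rule collapsingI[where s = "\<lambda>n. inverse (norm (A (r (q n))))"
        and t = "\<lambda>n. inverse (norm (adj3 (A (r (q n)))))"])
    show "(\<lambda>n. inverse (norm (A (r (q n))))) \<longlonglongrightarrow> 0"
      using tendsto_inverse_0_at_top[OF filterlim_compose[OF lim filterlim_subseq[OF rq]]] .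
    show "(\<lambda>n. inverse (norm (adj3 (A (r (q n)))))) \<longlonglongrightarrow> 0"
      using tendsto_inverse_0_at_top[OF filterlim_compose[OF lim' filterlim_subseq[OF rq]]] .
    show "(\<lambda>n. inverse (norm (A (r (q n)))) *\<^sub>R A (r (q n))) \<longlonglongrightarrow> B"
      using LIMSEQ_subseq_LIMSEQ[OF B[THEN conjunct2] q1] by (simp add: o_def)
    show "inverse (norm (A (r (q n)))) > 0" "inverse (norm (adj3 (A (r (q n))))) > 0" for n
      using nz[OF det] nz[OF det_adj3[OF det]] by simp_all
  qed (use A B C in blast)+
  show ?thesis using that[OF rq 1 A(2)] .
qed

text \<open>Norms in a collapsing sequence tend to infinity, and the norm depends only on the class.\<close>

lemma collapsing_obtains_inj:
  assumes "collapsing G A B C"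
  obtains r where "strict_mono (r :: nat \<Rightarrow> nat)" "inj (\<lambda>n. cls (A (r n)))"
proof -
  obtain s :: "nat \<Rightarrow> real"
    where s: "(\<forall>n. s n > 0) \<and> s \<longlonglongrightarrow> 0 \<and> (\<lambda>n. s n *\<^sub>R A n) \<longlonglongrightarrow> B"
    using collapsing_scale[OF assms] ..
  then have st: "\<And>n. s n > 0" "s \<longlonglongrightarrow> 0" "(\<lambda>n. s n *\<^sub>R A n) \<longlonglongrightarrow> B" by simp_all
  have step: "\<exists>m>n. norm (A n) < norm (A m)" for n
  proof (rule ccontr)
    assume "\<not> ?thesis"
    then have le: "norm (A m) \<le> norm (A n)" if "m > n" for m using that by force
    have "(\<lambda>m. s m *\<^sub>R A m) \<longlonglongrightarrow> 0"
    proof (rule tendsto_0_le[OF tendsto_norm_zero[OF st(2)], of _ "norm (A n)"])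
      show "\<forall>\<^sub>F m in sequentially. norm (s m *\<^sub>R A m) \<le> norm (norm (s m)) * norm (A n)"
        using eventually_gt_at_top[of n] by eventually_elim (simp add: le mult_left_mono)
    qed
    then show False
      using LIMSEQ_unique[OF st(3)] collapsing_nonzero(1)[OF assms] by blast
  qed
  have "\<exists>r. \<forall>n. True \<and> r n < r (Suc n) \<and> norm (A (r n)) < norm (A (r (Suc n)))"
    by (rule dependent_nat_choice) (use step in blast)+
  then obtain r where r: "\<And>n. r n < r (Suc n)" "\<And>n. norm (A (r n)) < norm (A (r (Suc n)))"
    by blast
  have mono: "strict_mono (\<lambda>n. norm (A (r n)))" using r(2) by (simp add: strict_mono_Suc_iff)
  have 1: "inj (\<lambda>n. cls (A (r n)))"
  proof (rule injI)
    fix m n assume "cls (A (r m)) = cls (A (r n))"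
    then have "norm (A (r m)) = norm (A (r n))"
      by (rule norm_cong_cls[OF collapsing_det[OF assms] collapsing_det[OF assms]])
    then show "m = n" using strict_mono_eq[OF mono] by blast
  qed
  have 2: "strict_mono r" using r(1) by (simp add: strict_mono_Suc_iff)
  show ?thesis using that[OF 2 1] .
qed

section \<open>Kernel points\<close>

definition kernel_points :: "(complex^3^3) set set \<Rightarrow> cp2 set" where
  "kernel_points G = {p. \<exists>A B C v. collapsing G A B C \<and> v \<noteq> 0 \<and> B *v v = 0 \<and> p = point_of v}"

text \<open>This set turns out to be the complement of the equicontinuity set of any discrete group, and to
  be Kulkarni's limit set under the assumption of three lines.\<close>

definition kernel_closure :: "(complex^3^3) set set \<Rightarrow> cp2 set" where
  "kernel_closure G = closure (kernel_points G)"

lemma kernel_pointsI: "collapsing G A B C \<Longrightarrow> v \<noteq> 0 \<Longrightarrow> B *v v = 0 \<Longrightarrow> point_of v \<in> kernel_points G"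
  unfolding kernel_points_def by blast

lemma kernel_points_inverseI:
  "subgroup G PSL3 \<Longrightarrow> collapsing G A B C \<Longrightarrow> v \<noteq> 0 \<Longrightarrow> C *v v = 0 \<Longrightarrow> point_of v \<in> kernel_points G"
  using kernel_pointsI[OF collapsing_inverse] .

lemma kernel_points_cases:
  assumes "p \<in> kernel_points G"
  obtains A B C v where "collapsing G A B C" "v \<noteq> 0" "B *v v = 0" "p = point_of v"
  using assms unfolding kernel_points_def by blast

lemma kernel_points_subset_closure: "kernel_points G \<subseteq> kernel_closure G"
  unfolding kernel_closure_def by (rule closure_subset)

lemma closed_kernel_closure: "closed (kernel_closure G)"
  unfolding kernel_closure_def by (rule closed_closure)

lemma kernel_closure_mono:
  assumes "G \<subseteq> H" shows "kernel_closure G \<subseteq> kernel_closure H"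
proof -
  have "kernel_points G \<subseteq> kernel_points H"
  proof
    fix p assume "p \<in> kernel_points G"
    then obtain A B C v where c: "collapsing G A B C" "v \<noteq> 0" "B *v v = 0" "p = point_of v"
      by (rule kernel_points_cases)
    show "p \<in> kernel_points H"
      using kernel_pointsI[OF collapsing_mono[OF c(1) assms] c(2,3)] c(4) by simp
  qed
  then show ?thesis unfolding kernel_closure_def by (rule closure_mono)
qed

lemma psl_act_closure:
  assumes "g \<in> carrier PSL3" "p \<in> closure S" shows "psl_act g p \<in> closure (psl_act g ` S)"
proof -
  obtain x where x: "(\<forall>n. x n \<in> S) \<and> x \<longlonglongrightarrow> p"
    using assms(2) unfolding closure_sequential ..
  have "(\<lambda>n. psl_act g (x n)) \<longlonglongrightarrow> psl_act g p"
    using tendsto_psl_act[OF assms(1) x[THEN conjunct2]] .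
  then show ?thesis
    unfolding closure_sequential using x by (intro exI[of _ "\<lambda>n. psl_act g (x n)"]) simp
qed

lemma kernel_points_invariant:
  assumes "subgroup G PSL3" "h \<in> lifts G" "p \<in> kernel_points G"
  shows "psl_act (cls h) p \<in> kernel_points G"
proof -
  obtain A B C v where c: "collapsing G A B C" "v \<noteq> 0" "B *v v = 0" "p = point_of v"
    using assms(3) by (rule kernel_points_cases)
  have h: "det h = 1" using assms(2) by (rule lifts_det)
  have "(B ** adj3 h) *v (h *v v) = 0"
    using c(3) by (simp add: adj3_vec[OF h] flip: matrix_vector_mul_assoc)
  then show ?thesis
    using kernel_pointsI[OF collapsing_mult_right[OF assms(1) c(1) lifts_adj3[OF assms(1,2)]]]
      det_one_vec_nonzero[OF h c(2)] by (simp add: c(4) psl_act_cls[OF h c(2)])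
qed

lemma kernel_closure_invariant:
  assumes "subgroup G PSL3" "g \<in> G" "p \<in> kernel_closure G"
  shows "psl_act g p \<in> kernel_closure G"
proof -
  obtain h where h: "h \<in> lifts G" "g = cls h" using lifts_cases[OF assms(1,2)] .
  have "psl_act g ` kernel_points G \<subseteq> kernel_points G"
    using kernel_points_invariant[OF assms(1) h(1)] h(2) by blast
  then show ?thesis
    using psl_act_closure[OF subgroup.mem_carrier[OF assms(1,2)], of p "kernel_points G"] assms(3)
      closure_mono unfolding kernel_closure_def by blast
qed

section \<open>Invariant open sets that omit lines\<close>

text \<open>If \<open>a \<circ> B\<close> were not zero, points converging to \<open>v\<close> would be mapped into the line of \<open>a\<close>. But
  these points eventually lie in the invariant set \<open>V\<close>, which that line avoids.\<close>

lemma omitted_line_kills_limit: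
  assumes c: "collapsing G A B C" and V: "open V" "\<And>n p. p \<in> V \<Longrightarrow> psl_act (cls (A n)) p \<in> V"
    and v: "v \<noteq> 0" "point_of v \<in> V" "B *v v = 0" and a: "line_of a \<inter> V = {}"
  shows "a v* B = 0"
proof (rule ccontr)
  assume nz: "a v* B \<noteq> 0"
  obtain u where u: "(\<forall>n::nat. u n \<noteq> 0) \<and> u \<longlonglongrightarrow> v \<and> (\<forall>\<^sub>F n in sequentially. a \<cdot> (A n *v u n) = 0)"
    using collapsing_zeros_persist[OF c nz v(3,1)] ..
  then have u: "\<And>n. u n \<noteq> 0" "u \<longlonglongrightarrow> v" "\<forall>\<^sub>F n in sequentially. a \<cdot> (A n *v u n) = 0"
    by simp_all
  have "\<forall>\<^sub>F n in sequentially. point_of (u n) \<in> V"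
    using topological_tendstoD[OF tendsto_point_of[OF u(2) v(1)] V(1) v(2)] .
  with u(3) have "\<forall>\<^sub>F n in sequentially. point_of (A n *v u n) \<in> line_of a \<inter> V"
  proof eventually_elim
    case (elim n)
    then show ?case
      using V(2)[of "point_of (u n)" n] psl_act_cls[OF collapsing_det[OF c] u(1)]
        det_one_vec_nonzero[OF collapsing_det[OF c] u(1)] by (simp add: point_of_in_line_of)
  qed
  then show False using a eventually_happens'[OF sequentially_bot] by auto
qed

text \<open>The place where three lines in general position are needed: three independent functionals that
  annihilate the image of \<open>B\<close> force \<open>B = 0\<close>. It plays the part of Montel's theorem, which for general maps
  into the plane would require more lines.\<close>

lemma omitted_three_lines_no_kernel_points:
  assumes V: "open V" "\<And>h p. h \<in> lifts G \<Longrightarrow> p \<in> V \<Longrightarrow> psl_act (cls h) p \<in> V"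
    and "line_of a \<inter> V = {}" "line_of b \<inter> V = {}" "line_of c \<inter> V = {}"
    and gp: "\<And>v. a \<cdot> v = 0 \<Longrightarrow> b \<cdot> v = 0 \<Longrightarrow> c \<cdot> v = 0 \<Longrightarrow> v = 0"
  shows "V \<inter> kernel_points G = {}"
proof (rule ccontr)
  assume "V \<inter> kernel_points G \<noteq> {}"
  then obtain p where p: "p \<in> V" "p \<in> kernel_points G" by blast
  obtain A B C v where k: "collapsing G A B C" "v \<noteq> 0" "B *v v = 0" "p = point_of v"
    using p(2) by (rule kernel_points_cases)
  have kill: "x v* B = 0" if "line_of x \<inter> V = {}" for x
    using omitted_line_kills_limit[OF k(1) V(1) V(2)[OF collapsing_lifts[OF k(1)]] k(2) _ k(3) that]
      p(1) k(4) by blast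
  have "B *v w = 0" for w
    using gp[of "B *v w"] kill[OF assms(3)] kill[OF assms(4)] kill[OF assms(5)]
    by (simp add: pairing_matrix)
  then show False using collapsing_nonzero(1)[OF k(1)] matrix_eq_zero_iff by blast
qed

section \<open>The equicontinuity set\<close>

text \<open>On a compact set, uniform convergence to a continuous limit follows from convergence along
  convergent sequences of arguments.\<close>

lemma uniform_limit_continuous_convergence:
  fixes f :: "nat \<Rightarrow> 'a::metric_space \<Rightarrow> 'b::metric_space"
  assumes K: "compact K"
    and f: "\<And>x u r. (\<And>n. u n \<in> K) \<Longrightarrow> x \<in> K \<Longrightarrow> u \<longlonglongrightarrow> x \<Longrightarrow> strict_mono r \<Longrightarrow>
              (\<lambda>n. f (r n) (u n)) \<longlonglongrightarrow> h x"
    and h: "\<And>x u. (\<And>n. u n \<in> K) \<Longrightarrow> x \<in> K \<Longrightarrow> u \<longlonglongrightarrow> x \<Longrightarrow> (\<lambda>n::nat. h (u n)) \<longlonglongrightarrow> h x"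
  shows "uniform_limit K f h sequentially"
proof (rule ccontr)
  assume "\<not> ?thesis"
  then obtain e where e: "e > 0" "\<not> (\<forall>\<^sub>F n in sequentially. \<forall>x\<in>K. dist (f n x) (h x) < e)"
    unfolding uniform_limit_iff by blast
  define S where "S = {n. \<exists>x\<in>K. \<not> dist (f n x) (h x) < e}"
  have "infinite S"
  proof
    assume "finite S"
    then obtain N where "\<forall>n\<in>S. n < N" unfolding finite_nat_set_iff_bounded by blast
    then have "\<forall>n\<ge>N. n \<notin> S" by (auto simp flip: not_less)
    then have "\<forall>n\<ge>N. \<forall>x\<in>K. dist (f n x) (h x) < e" by (auto simp: S_def)
    with e(2) show False unfolding eventually_sequentially by blast
  qed
  then obtain r where r: "strict_mono (r :: nat \<Rightarrow> nat)" "\<forall>n. r n \<in> S"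
    using infinite_enumerate by blast
  then have "\<forall>n. \<exists>x. x \<in> K \<and> \<not> dist (f (r n) x) (h x) < e" by (auto simp: S_def)
  then obtain x where x: "\<forall>n. x n \<in> K \<and> \<not> dist (f (r n) (x n)) (h (x n)) < e"
    by (rule choice[THEN exE])
  then have xK: "\<forall>n. x n \<in> K" by blast
  obtain l q where q: "l \<in> K" "strict_mono (q :: nat \<Rightarrow> nat)" "(x \<circ> q) \<longlonglongrightarrow> l"
    using K[unfolded compact_def, rule_format, of x] xK by blast
  note lim = q(3)[unfolded o_def]
  have "strict_mono (\<lambda>n. r (q n))" using strict_mono_compose[OF r(1) q(2)] by simp
  then have 1: "(\<lambda>n. f (r (q n)) (x (q n))) \<longlonglongrightarrow> h l"
    using f[of "\<lambda>n. x (q n)" l "\<lambda>n. r (q n)"] xK q(1) lim by blast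
  have 2: "(\<lambda>n. h (x (q n))) \<longlonglongrightarrow> h l"
    using h[of "\<lambda>n. x (q n)" l] xK q(1) lim by blast
  have "(\<lambda>n. dist (f (r (q n)) (x (q n))) (h (x (q n)))) \<longlonglongrightarrow> dist (h l) (h l)"
    using tendsto_dist[OF 1 2] .
  then have "\<forall>\<^sub>F n in sequentially. dist (f (r (q n)) (x (q n))) (h (x (q n))) < e"
    by (rule order_tendstoD(2)) (use e(1) in simp)
  then show False
    using eventually_happens'[OF sequentially_bot] x by blast
qed

lemma point_of_matrix_cong:
  assumes "u \<noteq> 0" "v \<noteq> 0" "point_of u = point_of v" "B *v u \<noteq> 0"
  shows "B *v v \<noteq> 0 \<and> point_of (B *v u) = point_of (B *v v)"
proof -
  obtain c where c: "v = c *s u"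
    using assms(1-3) point_of_eq_iff unfolding parallel_def by blast
  then have "c \<noteq> 0" using assms(2) by auto
  moreover have "B *v v = c *s (B *v u)"
    unfolding c by (simp add: vec_eq_iff matrix_vector_mult_def sum_3 algebra_simps)
  ultimately show ?thesis using assms(4) by (simp add: point_of_scale)
qed

text \<open>On the complement every limit \<open>B\<close> has no kernel, so it induces a continuous map there, and
  projective convergence of matrices gives convergence along convergent sequences of points.\<close>

lemma complement_kernel_closure_equicontinuous:
  assumes G: "subgroup \<Gamma> PSL3" "discrete_in_PSL3 \<Gamma>"
  shows "- kernel_closure \<Gamma> \<subseteq> equicontinuity_set \<Gamma>"
proof -
  define U where "U = - kernel_closure \<Gamma>"
  have "open U" unfolding U_def using closed_kernel_closure by (rule open_Compl)
  have "normal_family U ((\<lambda>\<gamma>. restrict (psl_act \<gamma>) U) ` \<Gamma>)"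
    unfolding normal_family_def
  proof (intro allI impI, elim conjE)
    fix f :: "nat \<Rightarrow> cp2 \<Rightarrow> cp2"
    assume f: "\<forall>n. f n \<in> (\<lambda>\<gamma>. restrict (psl_act \<gamma>) U) ` \<Gamma>" "inj f"
    then have "\<forall>n. \<exists>\<gamma>. \<gamma> \<in> \<Gamma> \<and> f n = restrict (psl_act \<gamma>) U" by blast
    then obtain g where g: "\<forall>n. g n \<in> \<Gamma> \<and> f n = restrict (psl_act (g n)) U"
      by (rule choice[THEN exE])
    have "inj g"
    proof (rule injI)
      fix m n assume "g m = g n"
      then have "f m = f n" using g by simp
      then show "m = n" using f(2) by (simp add: inj_eq)
    qed
    then obtain r A B C where r: "strict_mono (r :: nat \<Rightarrow> nat)" "collapsing \<Gamma> A B C"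
        "\<And>n. cls (A n) = g (r n)"
      using discrete_obtains_collapsing[OF G, of g] g by blast
    \<comment> \<open>Well defined on \<open>U\<close>, where the choice of a representative does not matter.\<close>
    define h where "h p = point_of (B *v (SOME v. v \<noteq> 0 \<and> p = point_of v))" for p
    have h: "B *v v \<noteq> 0 \<and> h (point_of v) = point_of (B *v v)" if v: "v \<noteq> 0" "point_of v \<in> U" for v
    proof -
      define w where "w = (SOME w. w \<noteq> 0 \<and> point_of v = point_of w)"
      have w: "w \<noteq> 0 \<and> point_of v = point_of w"
        unfolding w_def by (rule someI[of _ v]) (use v in simp)
      have c: "B *v v \<noteq> 0"
        using kernel_pointsI[OF r(2) v(1)] kernel_points_subset_closure v(2) unfolding U_def by blast
      have "h (point_of v) = point_of (B *v w)" unfolding h_def w_def ..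
      moreover have "point_of (B *v v) = point_of (B *v w)"
        using point_of_matrix_cong[OF v(1) _ _ c] w by blast
      ultimately show ?thesis using c by simp
    qed
    have conv: "(\<lambda>n. f (r (q n)) (p n)) \<longlonglongrightarrow> h x"
      if pU: "\<And>n. p n \<in> U" and xU: "x \<in> U" and px: "p \<longlonglongrightarrow> x" and q: "strict_mono q" for p x and q :: "nat \<Rightarrow> nat"
    proof -
      obtain v where v: "v \<noteq> 0" "x = point_of v" by (rule cp2_cases)
      obtain u where u: "\<And>n::nat. u n \<noteq> 0" "\<And>n. p n = point_of (u n)" "u \<longlonglongrightarrow> v"
        using tendsto_cp2_lift[of p v] px v by blast
      have "(\<lambda>n. point_of (A (q n) *v u n)) \<longlonglongrightarrow> point_of (B *v v)"
        using collapsing_tendsto[OF collapsing_subseq[OF r(2) q] u(3,1)] h[of v] v xU by blast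
      moreover have "f (r (q n)) (p n) = point_of (A (q n) *v u n)" for n
        using g pU[of n] psl_act_cls[OF collapsing_det[OF r(2)] u(1), of "q n" n] r(3)[of "q n"] u(2)[of n]
        by simp
      ultimately show ?thesis using h[of v] v xU by simp
    qed
    have hconv: "(\<lambda>n. h (p n)) \<longlonglongrightarrow> h x"
      if pU: "\<And>n. p n \<in> U" and xU: "x \<in> U" and px: "p \<longlonglongrightarrow> x" for p :: "nat \<Rightarrow> cp2" and x
    proof -
      obtain v where v: "v \<noteq> 0" "x = point_of v" by (rule cp2_cases)
      obtain u where u: "\<And>n::nat. u n \<noteq> 0" "\<And>n. p n = point_of (u n)" "u \<longlonglongrightarrow> v"
        using tendsto_cp2_lift[of p v] px v by blast
      have "(\<lambda>n. point_of (B *v u n)) \<longlonglongrightarrow> point_of (B *v v)"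
        using tendsto_point_of[OF tendsto_matrix_vector[OF tendsto_const u(3)]] h[of v] v xU by blast
      moreover have "h (p n) = point_of (B *v u n)" for n
        using h[of "u n"] u(1,2)[of n] pU[of n] by simp
      ultimately show ?thesis using h[of v] v xU by simp
    qed
    have "uniform_limit K (\<lambda>n. f (r n)) h sequentially" if K: "compact K" "K \<subseteq> U" for K
    proof (rule uniform_limit_continuous_convergence[OF K(1)])
      fix x u and q :: "nat \<Rightarrow> nat"
      assume a: "\<And>n. u n \<in> K" "x \<in> K" "u \<longlonglongrightarrow> x"
      show "(\<lambda>n. h (u n)) \<longlonglongrightarrow> h x" by (rule hconv) (use a K(2) in auto)
      assume "strict_mono q"
      then show "(\<lambda>n. f (r (q n)) (u n)) \<longlonglongrightarrow> h x" by (intro conv) (use a K(2) in auto)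
    qed
    then show "\<exists>r h. strict_mono (r :: nat \<Rightarrow> nat) \<and>
        (\<forall>K. compact K \<and> K \<subseteq> U \<longrightarrow> uniform_limit K (\<lambda>n. f (r n)) h sequentially)"
      using r(1) by (intro exI[of _ r] exI[of _ h]) simp
  qed
  then show ?thesis
    using \<open>open U\<close> unfolding equicontinuity_set_def U_def by blast
qed

text \<open>If two transformations agree on an open set, then every vector of an open cone is an eigenvector
  of their quotient. Such a matrix is scalar: three vectors on one affine line have the same eigenvalue. This
  makes restrictions of different transformations different maps.\<close>

lemma psl_act_determined_on_open:
  assumes U: "open U" "p \<in> U" and A: "det A = 1" and B: "det B = 1"
    and eq: "\<And>x. x \<in> U \<Longrightarrow> psl_act (cls A) x = psl_act (cls B) x"
  shows "cls A = cls B"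
proof -
  define M where "M = adj3 B ** A"
  have M: "M *v v = adj3 B *v (A *v v)" for v by (simp add: M_def matrix_vector_mul_assoc)
  define W where "W = {v. v \<noteq> 0 \<and> point_of v \<in> U}"
  have "open W" using U(1) unfolding open_cp2_iff W_def .
  have eigen: "\<exists>c. M *v v = c *s v" if "v \<in> W" for v
  proof -
    have v: "v \<noteq> 0" "point_of v \<in> U" using that by (auto simp: W_def)
    have "point_of (B *v v) = point_of (A *v v)"
      using eq[OF v(2)] by (simp add: psl_act_cls A B v(1))
    then obtain c where "A *v v = c *s (B *v v)"
      using point_of_eq_iff[OF det_one_vec_nonzero[OF B v(1)] det_one_vec_nonzero[OF A v(1)]]
      unfolding parallel_def by blast
    then have "M *v v = c *s (adj3 B *v (B *v v))"
      unfolding M by (simp add: vec.scale)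
    then show ?thesis using adj3_vec(1)[OF B] by auto
  qed
  obtain v where v: "v \<noteq> 0" "p = point_of v" by (rule cp2_cases)
  then have "v \<in> W" using U(2) by (simp add: W_def)
  then obtain a where a: "M *v v = a *s v" using eigen by blast
  have "M *v w = a *s w" for w
  proof (cases "parallel v w")
    case True
    then obtain c where "w = c *s v" unfolding parallel_def by blast
    then show ?thesis using a by (simp add: vec.scale mult.commute)
  next
    case False
    have "(\<lambda>n. v + (1 / of_nat (Suc n)) *s w) \<longlonglongrightarrow> v + 0 *s w"
      by (intro tendsto_intros LIMSEQ_Suc lim_1_over_n)
    then have lim: "(\<lambda>n. v + (1 / of_nat (Suc n)) *s w) \<longlonglongrightarrow> v" by simp
    have "\<forall>\<^sub>F n in sequentially. v + (1 / of_nat (Suc n)) *s w \<in> W"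
      using topological_tendstoD[OF lim \<open>open W\<close> \<open>v \<in> W\<close>] .
    then obtain N where N: "\<And>n. n \<ge> N \<Longrightarrow> v + (1 / of_nat (Suc n)) *s w \<in> W"
      unfolding eventually_sequentially by blast
    \<comment> \<open>Two nonzero parameters for which \<open>v + s w\<close> and \<open>v + t w\<close> lie in the cone.\<close>
    define s t where "s = (1 / of_nat (Suc N) :: complex)" and "t = (1 / of_nat (Suc (Suc N)) :: complex)"
    have st: "s \<noteq> 0" "t \<noteq> 0" "s \<noteq> t" unfolding s_def t_def by (simp_all add: field_simps del: of_nat_Suc)
    obtain b where b: "M *v (v + s *s w) = b *s (v + s *s w)"
      using eigen[OF N[of N]] unfolding s_def by auto
    obtain c where c: "M *v (v + t *s w) = c *s (v + t *s w)"
      using eigen[OF N[of "Suc N"]] unfolding t_def by auto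
    have b': "s *s (M *v w) = (b - a) *s v + (b * s) *s w"
      using b a by (simp add: vec.add vec.scale vec_eq_iff algebra_simps)
    have c': "t *s (M *v w) = (c - a) *s v + (c * t) *s w"
      using c a by (simp add: vec.add vec.scale vec_eq_iff algebra_simps)
    have "t *s (s *s (M *v w)) = s *s (t *s (M *v w))" by (simp add: mult.commute)
    then have "(s * t * (b - c)) *s w = (s * (c - a) - t * (b - a)) *s v"
      unfolding b' c' by (simp add: vec_eq_iff algebra_simps)
    then have e1: "s * t * (b - c) = 0"
    proof (rule contrapos_pp)
      assume nz: "s * t * (b - c) \<noteq> 0"
      show "(s * t * (b - c)) *s w \<noteq> (s * (c - a) - t * (b - a)) *s v"
      proof
        assume "(s * t * (b - c)) *s w = (s * (c - a) - t * (b - a)) *s v"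
        then have "w = ((s * (c - a) - t * (b - a)) / (s * t * (b - c))) *s v"
          using nz by (simp add: vec_eq_iff field_simps)
        then show False using False unfolding parallel_def by blast
      qed
    qed
    then have "b = c" using st by simp
    then have "(s * (b - a) - t * (b - a)) *s v = 0"
      using \<open>(s * t * (b - c)) *s w = (s * (c - a) - t * (b - a)) *s v\<close> by simp
    then have "s * (b - a) - t * (b - a) = 0"
      using v(1) vec.scale_eq_0_iff by blast
    then have "(s - t) * (b - a) = 0" by (simp add: algebra_simps)
    then have "b = a" using st by simp
    then have "s *s (M *v w) = s *s (a *s w)" using b' by (simp add: mult.commute)
    then show ?thesis using st(1) by (simp add: vec_eq_iff)
  qed
  then have "M = mat a" unfolding matrix_eq mat_mult_vec by blast
  then have "B ** M = mat a ** B" by (simp add: mat_mult_comm)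
  then have "A = mat a ** B" unfolding M_def by (simp add: matrix_mul_assoc adj3_mult B)
  moreover have "det (mat a :: complex^3^3) = 1"
    using \<open>M = mat a\<close> A B by (simp add: M_def det_mul det_adj3 flip: \<open>M = mat a\<close>)
  ultimately show ?thesis using cls_scalar_mult[OF B] by simp
qed

lemma closed_line_of: "closed (line_of a)"
  unfolding closed_sequential_limits
proof (intro allI impI, elim conjE)
  fix p q assume p: "\<forall>n. p n \<in> line_of a" "p \<longlonglongrightarrow> q"
  obtain v where v: "v \<noteq> 0" "q = point_of v" by (rule cp2_cases)
  obtain u where u: "\<And>n::nat. u n \<noteq> 0" "\<And>n. p n = point_of (u n)" "u \<longlonglongrightarrow> v"
    using tendsto_cp2_lift[of p v] p(2) v by blast
  have "a \<cdot> u n = 0" for n using p(1) u(1,2) by (simp add: point_of_in_line_of)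
  then have "a \<cdot> v = 0"
    using tendsto_pairing[OF tendsto_const u(3), of a] by (simp add: LIMSEQ_const_iff)
  then show "q \<in> line_of a" using v by (simp add: point_of_in_line_of)
qed

text \<open>The conjugate of one vector works unless it annihilates the other; then the sum of both
  conjugates works.\<close>

lemma functional_nonzero_on_point_and_image:
  fixes B :: "complex^3^3"
  assumes "w \<noteq> 0" "B \<noteq> 0"
  shows "\<exists>a. a \<cdot> w \<noteq> 0 \<and> a v* B \<noteq> 0"
proof -
  obtain u where u: "B *v u \<noteq> 0" using assms(2) matrix_eq_zero_iff by blast
  have ww: "conj_vec w \<cdot> w \<noteq> 0" using pairing_conj_self_nonzero assms(1) .
  have "\<exists>a. a \<cdot> w \<noteq> 0 \<and> a \<cdot> (B *v u) \<noteq> 0"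
  proof (cases "conj_vec w \<cdot> (B *v u) = 0")
    case True
    then have "conj_vec (B *v u) \<cdot> w = 0"
      using conj_vec_pairing_swap[of "B *v u" w] by simp
    then show ?thesis
      using ww True pairing_conj_self_nonzero[OF u]
      by (intro exI[of _ "conj_vec w + conj_vec (B *v u)"]) simp
  qed (use ww in blast)
  then obtain a where a: "a \<cdot> w \<noteq> 0" "a \<cdot> (B *v u) \<noteq> 0" by blast
  then have "a v* B \<noteq> 0" using pairing_matrix[of a B u] by auto
  then show ?thesis using a(1) by blast
qed

text \<open>Suppose that a subsequence converges uniformly near a kernel point \<open>p\<close>, and let \<open>w\<close> represent the
  value of the limit at \<open>p\<close>. A line that avoids \<open>w\<close> and does not contain the image of \<open>B\<close> is reached by
  points converging to \<open>p\<close>, so it has to contain \<open>w\<close>, a contradiction.\<close>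

lemma equicontinuity_set_disjoint_kernel_points:
  assumes G: "subgroup \<Gamma> PSL3"
    and U: "open U" "normal_family U ((\<lambda>\<gamma>. restrict (psl_act \<gamma>) U) ` \<Gamma>)"
  shows "U \<inter> kernel_points \<Gamma> = {}"
proof (rule ccontr)
  assume "U \<inter> kernel_points \<Gamma> \<noteq> {}"
  then obtain p where p: "p \<in> U" "p \<in> kernel_points \<Gamma>" by blast
  obtain A0 B C v where c0: "collapsing \<Gamma> A0 B C" and v: "v \<noteq> 0" "B *v v = 0" "p = point_of v"
    using p(2) by (rule kernel_points_cases)
  \<comment> \<open>A normal family only concerns sequences of different maps.\<close>
  obtain r0 where r0: "strict_mono (r0 :: nat \<Rightarrow> nat)" "inj (\<lambda>n. cls (A0 (r0 n)))"
    using collapsing_obtains_inj[OF c0] .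
  define A where "A n = A0 (r0 n)" for n
  have c: "collapsing \<Gamma> A B C" unfolding A_def using collapsing_subseq[OF c0 r0(1)] .
  have injA: "inj (\<lambda>n. cls (A n))" unfolding A_def using r0(2) .
  define f where "f n = restrict (psl_act (cls (A n))) U" for n
  have "inj f"
  proof (rule injI)
    fix m n assume eq: "f m = f n"
    have "psl_act (cls (A m)) x = psl_act (cls (A n)) x" if "x \<in> U" for x
      using fun_cong[OF eq, of x] that by (simp add: f_def)
    then have "cls (A m) = cls (A n)"
      using psl_act_determined_on_open[OF U(1) p(1) collapsing_det[OF c] collapsing_det[OF c]] by blast
    then show "m = n" using injD[OF injA, of m n] by simp
  qed
  moreover have "\<forall>n. f n \<in> (\<lambda>\<gamma>. restrict (psl_act \<gamma>) U) ` \<Gamma>"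
    using lifts_cls[OF collapsing_lifts[OF c]] by (simp add: f_def)
  ultimately have f: "(\<forall>n. f n \<in> (\<lambda>\<gamma>. restrict (psl_act \<gamma>) U) ` \<Gamma>) \<and> inj f" by blast
  obtain r where "\<exists>h. strict_mono (r :: nat \<Rightarrow> nat) \<and>
      (\<forall>K. compact K \<and> K \<subseteq> U \<longrightarrow> uniform_limit K (\<lambda>n. f (r n)) h sequentially)"
    using U(2)[unfolded normal_family_def, THEN spec, THEN mp, OF f] ..
  then obtain h where r: "strict_mono r \<and>
      (\<forall>K. compact K \<and> K \<subseteq> U \<longrightarrow> uniform_limit K (\<lambda>n. f (r n)) h sequentially)" ..
  note r = r[THEN conjunct1] r[THEN conjunct2]
  obtain e where e: "e > 0" "cball p e \<subseteq> U" using U(1) p(1) open_contains_cball by blast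
  have lim: "uniform_limit (cball p e) (\<lambda>n. f (r n)) h sequentially"
    using r(2) e(2) compact_cball_cp2 by blast
  have "continuous_on (cball p e) (f n)" for n
    unfolding continuous_on_sequentially
  proof (intro allI ballI impI, elim conjE)
    fix x a assume a: "a \<in> cball p e" "\<forall>n. x n \<in> cball p e" "x \<longlonglongrightarrow> a"
    then have "f n (x m) = psl_act (cls (A n)) (x m)" for m
    proof -
      have "x m \<in> U" using a(2) e(2) by blast
      then show ?thesis by (simp add: f_def)
    qed
    moreover have "f n a = psl_act (cls (A n)) a" using a e(2) by (auto simp: f_def)
    ultimately show "(f n \<circ> x) \<longlonglongrightarrow> f n a"
      using tendsto_psl_act[OF cls_in_carrier[OF collapsing_det[OF c]] a(3)] by (simp add: o_def)
  qed
  then have hcont: "continuous_on (cball p e) h"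
    by (intro uniform_limit_theorem[OF _ lim]) auto
  have conv: "(\<lambda>n. psl_act (cls (A (r n))) (x n)) \<longlonglongrightarrow> h p" if xp: "x \<longlonglongrightarrow> p" for x
  proof (rule tendstoI)
    fix d :: real assume "d > 0"
    then have d: "d / 2 > 0" by simp
    have "p \<in> cball p e" using e(1) by simp
    then have "(h \<longlongrightarrow> h p) (at p within cball p e)"
      using hcont unfolding continuous_on_def by blast
    then obtain s where s: "s > 0" "\<And>y. y \<in> cball p e \<Longrightarrow> dist y p < s \<Longrightarrow> dist (h y) (h p) < d / 2"
      using continuous_on_iff[THEN iffD1, OF hcont, rule_format, OF \<open>p \<in> cball p e\<close> d] by blast
    have "\<forall>\<^sub>F n in sequentially. dist (x n) p < min s e"
      using tendstoD[OF xp, of "min s e"] s(1) e(1) by simp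
    moreover have "\<forall>\<^sub>F n in sequentially. \<forall>y\<in>cball p e. dist (f (r n) y) (h y) < d / 2"
      using uniform_limitD[OF lim d] .
    ultimately show "\<forall>\<^sub>F n in sequentially. dist (psl_act (cls (A (r n))) (x n)) (h p) < d"
    proof eventually_elim
      case (elim n)
      then have x: "x n \<in> cball p e" by (simp add: dist_commute)
      then have "dist (f (r n) (x n)) (h (x n)) < d / 2" "dist (h (x n)) (h p) < d / 2"
        using elim s(2) by auto
      moreover have "f (r n) (x n) = psl_act (cls (A (r n))) (x n)" using x e(2) by (auto simp: f_def)
      ultimately show ?case
        using dist_triangle_half_r[of "h (x n)" "f (r n) (x n)" d "h p"] by (simp add: dist_commute)
    qed
  qed
  obtain w where w: "w \<noteq> 0" "h p = point_of w" by (rule cp2_cases)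
  \<comment> \<open>A line that misses the supposed limit value but is reached near \<open>p\<close>.\<close>
  obtain a where a: "a \<cdot> w \<noteq> 0" "a v* B \<noteq> 0"
    using functional_nonzero_on_point_and_image[OF w(1) collapsing_nonzero(1)[OF c]] by blast
  have c': "collapsing \<Gamma> (\<lambda>n. A (r n)) B C" using collapsing_subseq[OF c r(1)] .
  obtain u where u: "(\<forall>n::nat. u n \<noteq> 0) \<and> u \<longlonglongrightarrow> v \<and>
      (\<forall>\<^sub>F n in sequentially. a \<cdot> (A (r n) *v u n) = 0)"
    using collapsing_zeros_persist[OF c' a(2) v(2,1)] ..
  then have u: "\<And>n. u n \<noteq> 0" "u \<longlonglongrightarrow> v" "\<forall>\<^sub>F n in sequentially. a \<cdot> (A (r n) *v u n) = 0"
    by simp_all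
  have act: "psl_act (cls (A (r n))) (point_of (u n)) = point_of (A (r n) *v u n)" for n
    using psl_act_cls[OF collapsing_det[OF c] u(1)] .
  have "(\<lambda>n. psl_act (cls (A (r n))) (point_of (u n))) \<longlonglongrightarrow> h p"
    using conv[of "\<lambda>n. point_of (u n)"] tendsto_point_of[OF u(2) v(1)] v(3) by simp
  then have lim2: "(\<lambda>n. point_of (A (r n) *v u n)) \<longlonglongrightarrow> h p" unfolding act .
  have "\<forall>\<^sub>F n in sequentially. point_of (A (r n) *v u n) \<in> line_of a"
    using u(3) det_one_vec_nonzero[OF collapsing_det[OF c] u(1)]
    by (auto elim!: eventually_mono simp: point_of_in_line_of)
  then have "h p \<in> line_of a"
    using Lim_in_closed_set[OF closed_line_of _ sequentially_bot lim2] by blast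
  then show False using a(1) w by (simp add: point_of_in_line_of)
qed

lemma equicontinuity_set_eq:
  assumes G: "subgroup \<Gamma> PSL3" "discrete_in_PSL3 \<Gamma>"
  shows "equicontinuity_set \<Gamma> = - kernel_closure \<Gamma>"
proof
  show "- kernel_closure \<Gamma> \<subseteq> equicontinuity_set \<Gamma>"
    by (rule complement_kernel_closure_equicontinuous[OF G])
  show "equicontinuity_set \<Gamma> \<subseteq> - kernel_closure \<Gamma>"
  proof
    fix z assume "z \<in> equicontinuity_set \<Gamma>"
    then obtain U where U: "open U" "z \<in> U" "normal_family U ((\<lambda>\<gamma>. restrict (psl_act \<gamma>) U) ` \<Gamma>)"
      unfolding equicontinuity_set_def by blast
    have "U \<inter> kernel_points \<Gamma> = {}"
      by (rule equicontinuity_set_disjoint_kernel_points[OF G(1) U(1,3)])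
    then have "U \<inter> kernel_closure \<Gamma> = {}"
      unfolding kernel_closure_def using open_Int_closure_eq_empty[OF U(1)] by blast
    then show "z \<in> - kernel_closure \<Gamma>" using U(2) by blast
  qed
qed

section \<open>Dynamics and Kulkarni's limit set\<close>

lemma dynamical_relation:
  assumes G: "subgroup G PSL3" "discrete_in_PSL3 G" and g: "\<And>n::nat. g n \<in> G" "inj g"
    and x: "x \<longlonglongrightarrow> point_of v" "v \<noteq> 0" and y: "(\<lambda>n. psl_act (g n) (x n)) \<longlonglongrightarrow> point_of w" "w \<noteq> 0"
  obtains A B C where "collapsing G A B C"
    "B *v v = 0 \<or> point_of (B *v v) = point_of w" "C *v w = 0 \<or> point_of (C *v w) = point_of v"
proof -
  obtain r A B C where r: "strict_mono (r :: nat \<Rightarrow> nat)" "collapsing G A B C" "\<And>n. cls (A n) = g (r n)"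
    using discrete_obtains_collapsing[OF G g] by blast
  have x': "(\<lambda>n. x (r n)) \<longlonglongrightarrow> point_of v" using LIMSEQ_subseq_LIMSEQ[OF x(1) r(1)] by (simp add: o_def)
  have y': "(\<lambda>n. psl_act (cls (A n)) (x (r n))) \<longlonglongrightarrow> point_of w"
    using LIMSEQ_subseq_LIMSEQ[OF y(1) r(1)] by (simp add: o_def r(3))
  have "B *v v = 0 \<or> point_of (B *v v) = point_of w"
    using collapsing_relation_image[OF r(2) x' x(2) y'] by blast
  moreover have "C *v w = 0 \<or> point_of (C *v w) = point_of v"
    using collapsing_relation_preimage[OF G(1) r(2) x' y' y(2)] by blast
  ultimately show ?thesis using that[OF r(2)] by blast
qed

text \<open>The image of \<open>B\<close> consists of kernel points, namely of the inverse sequence.\<close>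

lemma image_kernel_point:
  assumes "subgroup G PSL3" "collapsing G A B C" "B *v v \<noteq> 0"
  shows "point_of (B *v v) \<in> kernel_points G"
  using kernel_points_inverseI[OF assms(1,2,3)] collapsing_mult_zero[OF assms(1,2)] by blast

text \<open>A point fixed by a divergent sequence lies in the kernel or in the image of its limit.\<close>

lemma L0_subset_kernel_closure:
  assumes G: "subgroup G PSL3" "discrete_in_PSL3 G"
  shows "L0 G \<subseteq> kernel_closure G"
proof -
  have "p \<in> kernel_points G" if inf: "infinite {g \<in> G. psl_act g p = p}" for p
  proof -
    obtain g :: "nat \<Rightarrow> (complex^3^3) set" where g: "inj g" "range g \<subseteq> {g \<in> G. psl_act g p = p}"
      using infinite_countable_subset[OF inf] by blast
    obtain v where v: "v \<noteq> 0" "p = point_of v" by (rule cp2_cases)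
    have "(\<lambda>n. psl_act (g n) p) = (\<lambda>n. p)" using g(2) by auto
    then have lim: "(\<lambda>n. psl_act (g n) p) \<longlonglongrightarrow> point_of v" using v(2) by simp
    have gG: "\<And>n. g n \<in> G" using g(2) by auto
    have px: "(\<lambda>n::nat. p) \<longlonglongrightarrow> point_of v" using v(2) by simp
    obtain A B C where c: "collapsing G A B C" "B *v v = 0 \<or> point_of (B *v v) = point_of v"
      using dynamical_relation[OF G gG g(1) px v(1) lim v(1)] by blast
    show ?thesis
    proof (cases "B *v v = 0")
      case True
      then show ?thesis using kernel_pointsI[OF c(1) v(1)] v(2) by simp
    next
      case False
      then show ?thesis using image_kernel_point[OF G(1) c(1) False] c(2) v(2) by simp
    qed
  qed
  then show ?thesis unfolding L0_def kernel_closure_def by (intro closure_mono) blast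
qed

lemma cluster_points_singletonD:
  assumes "q \<in> cluster_points G {z}"
  shows "\<exists>g. (\<forall>m::nat. g m \<in> G) \<and> inj g \<and> (\<lambda>m. psl_act (g m) z) \<longlonglongrightarrow> q"
proof -
  obtain k where "\<exists>g. (\<forall>m. k m \<in> {z}) \<and> (\<forall>m. g m \<in> G) \<and> inj g \<and>
      (\<lambda>m::nat. psl_act (g m) (k m)) \<longlonglongrightarrow> q"
    using assms[unfolded cluster_points_def, THEN CollectD] ..
  then obtain g where g: "(\<forall>m. k m \<in> {z}) \<and> (\<forall>m. g m \<in> G) \<and> inj g \<and>
      (\<lambda>m::nat. psl_act (g m) (k m)) \<longlonglongrightarrow> q" ..
  then have "k = (\<lambda>_. z)" by auto
  with g show ?thesis by (intro exI[of _ g]) simp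
qed

text \<open>Outside of the kernels, orbits accumulate only on images of limits; the closure of the kernel points is
  invariant, so orbits inside of it stay there.\<close>

lemma L1_subset_kernel_closure:
  assumes G: "subgroup G PSL3" "discrete_in_PSL3 G"
  shows "L1 G \<subseteq> kernel_closure G"
proof -
  have "q \<in> kernel_closure G" if qz: "q \<in> cluster_points G {z}" for z q
  proof (cases "z \<in> kernel_closure G")
    case True
    obtain g where "(\<forall>m::nat. g m \<in> G) \<and> inj g \<and> (\<lambda>m. psl_act (g m) z) \<longlonglongrightarrow> q"
      using cluster_points_singletonD[OF qz] ..
    then have g: "\<And>m. g m \<in> G" "(\<lambda>m. psl_act (g m) z) \<longlonglongrightarrow> q" by simp_all
    show ?thesis
      using Lim_in_closed_set[OF closed_kernel_closure _ sequentially_bot g(2)]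
        kernel_closure_invariant[OF G(1) g(1) True] by simp
  next
    case False
    obtain g where "(\<forall>m::nat. g m \<in> G) \<and> inj g \<and> (\<lambda>m. psl_act (g m) z) \<longlonglongrightarrow> q"
      using cluster_points_singletonD[OF qz] ..
    then have g: "\<And>m. g m \<in> G" "inj g" "(\<lambda>m. psl_act (g m) z) \<longlonglongrightarrow> q" by simp_all
    obtain v where v: "v \<noteq> 0" "z = point_of v" by (rule cp2_cases)
    obtain w where w: "w \<noteq> 0" "q = point_of w" by (rule cp2_cases)
    have zx: "(\<lambda>n::nat. z) \<longlonglongrightarrow> point_of v" using v(2) by simp
    obtain A B C where c: "collapsing G A B C" "B *v v = 0 \<or> point_of (B *v v) = point_of w"
      using dynamical_relation[OF G g(1,2) zx v(1) g(3)[unfolded w(2)] w(1)] by blast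
    have nz: "B *v v \<noteq> 0"
      using False kernel_pointsI[OF c(1) v(1)] v(2) kernel_points_subset_closure by blast
    then have "q \<in> kernel_points G"
      using image_kernel_point[OF G(1) c(1) nz] c(2) w(2) by simp
    then show ?thesis using kernel_points_subset_closure by blast
  qed
  then have "(\<Union>z \<in> - L0 G. cluster_points G {z}) \<subseteq> kernel_closure G" by blast
  then show ?thesis unfolding L1_def using closure_minimal closed_kernel_closure by blast
qed

lemma collapsing_image_cluster_point:
  assumes "collapsing G A B C" "v \<noteq> 0" "B *v v \<noteq> 0"
  shows "point_of (B *v v) \<in> cluster_points G {point_of v}"
proof -
  obtain r where r: "strict_mono (r :: nat \<Rightarrow> nat)" "inj (\<lambda>n. cls (A (r n)))"
    using collapsing_obtains_inj[OF assms(1)] .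
  have "(\<lambda>n. point_of (A (r n) *v v)) \<longlonglongrightarrow> point_of (B *v v)"
    using collapsing_tendsto[OF collapsing_subseq[OF assms(1) r(1)] tendsto_const assms(2,3)] .
  then have "(\<lambda>n. psl_act (cls (A (r n))) (point_of v)) \<longlonglongrightarrow> point_of (B *v v)"
    using psl_act_cls[OF collapsing_det[OF assms(1)] assms(2)] by simp
  then show ?thesis
    unfolding cluster_points_def using r(2) lifts_cls[OF collapsing_lifts[OF assms(1)]]
    by (intro CollectI exI[of _ "\<lambda>_. point_of v"] exI[of _ "\<lambda>n. cls (A (r n))"]) simp
qed

text \<open>A cluster point \<open>q\<close> outside of the kernel of \<open>C\<close> determines the limit \<open>l\<close> of the points of \<open>K\<close>: the
  inverse transformations move \<open>q\<close> to \<open>l\<close>. Unless \<open>q\<close> lies in \<open>L0\<close> already, this makes \<open>l\<close> a cluster point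
  of an orbit, which \<open>K\<close> was chosen to avoid.\<close>

lemma L2_subset_kernel_closure:
  assumes G: "subgroup G PSL3" "discrete_in_PSL3 G"
  shows "L2 G \<subseteq> kernel_closure G"
proof -
  have "q \<in> kernel_closure G"
    if K: "compact K" "K \<subseteq> - (L0 G \<union> L1 G)" and q: "q \<in> cluster_points G K" for K q
  proof (cases "q \<in> L0 G")
    case True
    then show ?thesis using L0_subset_kernel_closure[OF G] by blast
  next
    case False
    obtain k where "\<exists>g. (\<forall>m. k m \<in> K) \<and> (\<forall>m. g m \<in> G) \<and> inj g \<and>
        (\<lambda>m::nat. psl_act (g m) (k m)) \<longlonglongrightarrow> q"
      using q[unfolded cluster_points_def, THEN CollectD] ..
    then obtain g where "(\<forall>m. k m \<in> K) \<and> (\<forall>m. g m \<in> G) \<and> inj g \<and>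
        (\<lambda>m::nat. psl_act (g m) (k m)) \<longlonglongrightarrow> q" ..
    then have kg: "\<forall>m. k m \<in> K" "\<And>m. g m \<in> G" "inj g" "(\<lambda>m. psl_act (g m) (k m)) \<longlonglongrightarrow> q"
      by simp_all
    obtain r l where r: "strict_mono (r :: nat \<Rightarrow> nat)" "(\<lambda>n. k (r n)) \<longlonglongrightarrow> l"
      using cp2_subsequence[of k] .
    have l: "l \<in> K"
      using Lim_in_closed_set[OF compact_imp_closed[OF K(1)] _ sequentially_bot r(2)] kg(1) by simp
    obtain v where v: "v \<noteq> 0" "l = point_of v" by (rule cp2_cases)
    obtain w where w: "w \<noteq> 0" "q = point_of w" by (rule cp2_cases)
    have lim1: "(\<lambda>n. k (r n)) \<longlonglongrightarrow> point_of v" using r(2) v(2) by simp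
    have lim2: "(\<lambda>n. psl_act (g (r n)) (k (r n))) \<longlonglongrightarrow> point_of w"
      using LIMSEQ_subseq_LIMSEQ[OF kg(4) r(1)] w(2) by (simp add: o_def)
    have inj: "inj (\<lambda>n. g (r n))"
      using inj_compose[OF kg(3) strict_mono_imp_inj_on[OF r(1)]] by (simp add: o_def)
    obtain A B C where c: "collapsing G A B C" "B *v v = 0 \<or> point_of (B *v v) = point_of w"
        "C *v w = 0 \<or> point_of (C *v w) = point_of v"
      using dynamical_relation[OF G kg(2) inj lim1 v(1) lim2 w(1)] .
    show ?thesis
    proof (cases "C *v w = 0")
      case True
      then show ?thesis
        using kernel_points_inverseI[OF G(1) c(1) w(1)] w(2) kernel_points_subset_closure by blast
    next
      case nz: False
      have "point_of (C *v w) = l" using c(3) nz v(2) by simp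
      then have "l \<in> cluster_points G {q}"
        using collapsing_image_cluster_point[OF collapsing_inverse[OF G(1) c(1)] w(1) nz] w(2) by simp
      then have "l \<in> (\<Union>z \<in> - L0 G. cluster_points G {z})" using False by blast
      then have "l \<in> L1 G" unfolding L1_def by (rule subsetD[OF closure_subset])
      then show ?thesis using K(2) l by blast
    qed
  qed
  then have "(\<Union>K \<in> {K. compact K \<and> K \<subseteq> - (L0 G \<union> L1 G)}. cluster_points G K) \<subseteq> kernel_closure G"
    by blast
  then show ?thesis unfolding L2_def using closure_minimal closed_kernel_closure by blast
qed

lemma kulkarni_subset_kernel_closure:
  assumes "subgroup G PSL3" "discrete_in_PSL3 G"
  shows "kulkarni_limit_set G \<subseteq> kernel_closure G"
  unfolding kulkarni_limit_set_def
  using L0_subset_kernel_closure[OF assms] L1_subset_kernel_closure[OF assms]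
    L2_subset_kernel_closure[OF assms] by blast

lemma closed_kulkarni: "closed (kulkarni_limit_set G)"
  unfolding kulkarni_limit_set_def L0_def L1_def L2_def by (intro closed_Un closed_closure)

text \<open>If a compact set in the complement returned infinitely often, limits \<open>p\<close> and \<open>q\<close> of points and their
  images would satisfy \<open>q = B p\<close>; but then \<open>q\<close> lies in the kernel of \<open>C\<close>.\<close>

lemma complement_kernel_closure_prop_disc:
  assumes G: "subgroup \<Gamma> PSL3" "discrete_in_PSL3 \<Gamma>"
  shows "prop_disc_domain \<Gamma> (- kernel_closure \<Gamma>)"
  unfolding prop_disc_domain_def
proof (intro conjI ballI allI impI)
  show "open (- kernel_closure \<Gamma>)" using closed_kernel_closure by (rule open_Compl)
next
  fix \<gamma> assume g: "\<gamma> \<in> \<Gamma>"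
  have gc: "\<gamma> \<in> carrier PSL3" using subgroup.mem_carrier[OF G(1) g] .
  have gi: "inv\<^bsub>PSL3\<^esub> \<gamma> \<in> \<Gamma>" using subgroup.m_inv_closed[OF G(1) g] .
  show "psl_act \<gamma> ` (- kernel_closure \<Gamma>) = - kernel_closure \<Gamma>"
  proof (intro equalityI subsetI)
    fix q assume "q \<in> psl_act \<gamma> ` (- kernel_closure \<Gamma>)"
    then obtain p where p: "q = psl_act \<gamma> p" "p \<notin> kernel_closure \<Gamma>" by blast
    then show "q \<in> - kernel_closure \<Gamma>"
      using kernel_closure_invariant[OF G(1) gi, of q] psl_act_inv(1)[OF gc, of p] by auto
  next
    fix q assume q: "q \<in> - kernel_closure \<Gamma>"
    then have "psl_act (inv\<^bsub>PSL3\<^esub> \<gamma>) q \<in> - kernel_closure \<Gamma>"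
      using kernel_closure_invariant[OF G(1) g, of "psl_act (inv\<^bsub>PSL3\<^esub> \<gamma>) q"]
        psl_act_inv(2)[OF gc, of q] by auto
    then show "q \<in> psl_act \<gamma> ` (- kernel_closure \<Gamma>)"
      using image_eqI[of q "psl_act \<gamma>" "psl_act (inv\<^bsub>PSL3\<^esub> \<gamma>) q"] psl_act_inv(2)[OF gc, of q] by simp
  qed
next
  fix K assume "compact K \<and> K \<subseteq> - kernel_closure \<Gamma>"
  then have K: "compact K" "K \<subseteq> - kernel_closure \<Gamma>" by auto
  show "finite {\<gamma> \<in> \<Gamma>. psl_act \<gamma> ` K \<inter> K \<noteq> {}}"
  proof (rule ccontr)
    assume "infinite {\<gamma> \<in> \<Gamma>. psl_act \<gamma> ` K \<inter> K \<noteq> {}}"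
    then obtain g :: "nat \<Rightarrow> (complex^3^3) set"
      where g: "inj g" "range g \<subseteq> {\<gamma> \<in> \<Gamma>. psl_act \<gamma> ` K \<inter> K \<noteq> {}}"
      using infinite_countable_subset by blast
    have "\<forall>n. \<exists>x. x \<in> K \<and> psl_act (g n) x \<in> K" using g(2) by blast
    then obtain x where x: "\<forall>n. x n \<in> K \<and> psl_act (g n) (x n) \<in> K" by (rule choice[THEN exE])
    obtain r p where r: "strict_mono (r :: nat \<Rightarrow> nat)" "(\<lambda>n. x (r n)) \<longlonglongrightarrow> p"
      using cp2_subsequence[of x] .
    obtain s q where s: "strict_mono (s :: nat \<Rightarrow> nat)" "(\<lambda>n. psl_act (g (r (s n))) (x (r (s n)))) \<longlonglongrightarrow> q"
      using cp2_subsequence[of "\<lambda>n. psl_act (g (r n)) (x (r n))"] .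
    have p: "(\<lambda>n. x (r (s n))) \<longlonglongrightarrow> p" using LIMSEQ_subseq_LIMSEQ[OF r(2) s(1)] by (simp add: o_def)
    have "closed K" using K(1) by (rule compact_imp_closed)
    then have pK: "p \<in> K" "q \<in> K"
      using Lim_in_closed_set[OF _ _ sequentially_bot p] Lim_in_closed_set[OF _ _ sequentially_bot s(2)] x
      by simp_all
    obtain v where v: "v \<noteq> 0" "p = point_of v" by (rule cp2_cases)
    obtain w where w: "w \<noteq> 0" "q = point_of w" by (rule cp2_cases)
    have gG: "\<And>n. g (r (s n)) \<in> \<Gamma>" using g(2) by blast
    have "inj (\<lambda>n. r (s n))"
      using inj_compose[OF strict_mono_imp_inj_on[OF r(1)] strict_mono_imp_inj_on[OF s(1)]] by (simp add: o_def)
    then have inj: "inj (\<lambda>n. g (r (s n)))" using inj_compose[OF g(1)] by (simp add: o_def)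
    obtain A B C where c: "collapsing \<Gamma> A B C" "B *v v = 0 \<or> point_of (B *v v) = point_of w"
      using dynamical_relation[OF G gG inj p[unfolded v(2)] v(1) s(2)[unfolded w(2)] w(1)] by blast
    have nz: "B *v v \<noteq> 0"
      using kernel_pointsI[OF c(1) v(1)] v(2) kernel_points_subset_closure pK(1) K(2) by blast
    then have "q \<in> kernel_points \<Gamma>"
      using image_kernel_point[OF G(1) c(1) nz] c(2) w(2) by simp
    then show False using kernel_points_subset_closure pK(2) K(2) by blast
  qed
qed

section \<open>Equivariance of Kulkarni's limit set under conjugation\<close>

definition conj_group :: "(complex^3^3) set \<Rightarrow> (complex^3^3) set set \<Rightarrow> (complex^3^3) set set" where
  "conj_group g G = (\<lambda>x. g \<otimes>\<^bsub>PSL3\<^esub> x \<otimes>\<^bsub>PSL3\<^esub> inv\<^bsub>PSL3\<^esub> g) ` G"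

interpretation PSL3: group PSL3 by (rule group_PSL3)

lemma PSL3_cancel:
  assumes "g \<in> carrier PSL3" "z \<in> carrier PSL3"
  shows "inv\<^bsub>PSL3\<^esub> g \<otimes>\<^bsub>PSL3\<^esub> (g \<otimes>\<^bsub>PSL3\<^esub> z) = z" "g \<otimes>\<^bsub>PSL3\<^esub> (inv\<^bsub>PSL3\<^esub> g \<otimes>\<^bsub>PSL3\<^esub> z) = z"
  using assms by (simp_all flip: PSL3.m_assoc)

lemma conj_group_inverse:
  assumes "g \<in> carrier PSL3" "G \<subseteq> carrier PSL3"
  shows "conj_group (inv\<^bsub>PSL3\<^esub> g) (conj_group g G) = G"
proof -
  have "inv\<^bsub>PSL3\<^esub> g \<otimes>\<^bsub>PSL3\<^esub> (g \<otimes>\<^bsub>PSL3\<^esub> x \<otimes>\<^bsub>PSL3\<^esub> inv\<^bsub>PSL3\<^esub> g) \<otimes>\<^bsub>PSL3\<^esub> inv\<^bsub>PSL3\<^esub> (inv\<^bsub>PSL3\<^esub> g) = x"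
    if "x \<in> G" for x
    using that assms by (simp add: PSL3.m_assoc PSL3_cancel subsetD[OF assms(2)])
  then show ?thesis unfolding conj_group_def image_image by simp
qed

lemma conj_group_carrier:
  assumes "g \<in> carrier PSL3" "G \<subseteq> carrier PSL3" shows "conj_group g G \<subseteq> carrier PSL3"
  using assms by (auto simp: conj_group_def subsetD)

lemma psl_act_conj:
  assumes "g \<in> carrier PSL3" "x \<in> carrier PSL3"
  shows "psl_act (g \<otimes>\<^bsub>PSL3\<^esub> x \<otimes>\<^bsub>PSL3\<^esub> inv\<^bsub>PSL3\<^esub> g) (psl_act g p) = psl_act g (psl_act x p)"
  using assms by (simp add: psl_act_mult psl_act_inv)

lemma inj_on_conj:
  assumes "g \<in> carrier PSL3"
  shows "inj_on (\<lambda>x. g \<otimes>\<^bsub>PSL3\<^esub> x \<otimes>\<^bsub>PSL3\<^esub> inv\<^bsub>PSL3\<^esub> g) (carrier PSL3)"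
proof (rule inj_onI)
  fix x y assume xy: "x \<in> carrier PSL3" "y \<in> carrier PSL3"
    and eq: "g \<otimes>\<^bsub>PSL3\<^esub> x \<otimes>\<^bsub>PSL3\<^esub> inv\<^bsub>PSL3\<^esub> g = g \<otimes>\<^bsub>PSL3\<^esub> y \<otimes>\<^bsub>PSL3\<^esub> inv\<^bsub>PSL3\<^esub> g"
  from eq have "inv\<^bsub>PSL3\<^esub> g \<otimes>\<^bsub>PSL3\<^esub> (g \<otimes>\<^bsub>PSL3\<^esub> x \<otimes>\<^bsub>PSL3\<^esub> inv\<^bsub>PSL3\<^esub> g) \<otimes>\<^bsub>PSL3\<^esub> g
      = inv\<^bsub>PSL3\<^esub> g \<otimes>\<^bsub>PSL3\<^esub> (g \<otimes>\<^bsub>PSL3\<^esub> y \<otimes>\<^bsub>PSL3\<^esub> inv\<^bsub>PSL3\<^esub> g) \<otimes>\<^bsub>PSL3\<^esub> g" by simp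
  then show "x = y" using assms xy by (simp add: PSL3.m_assoc PSL3_cancel)
qed

lemma L0_conj:
  assumes g: "g \<in> carrier PSL3" and G: "G \<subseteq> carrier PSL3" and p: "p \<in> L0 G"
  shows "psl_act g p \<in> L0 (conj_group g G)"
proof -
  let ?c = "\<lambda>x. g \<otimes>\<^bsub>PSL3\<^esub> x \<otimes>\<^bsub>PSL3\<^esub> inv\<^bsub>PSL3\<^esub> g"
  let ?S = "{p. infinite {x \<in> G. psl_act x p = p}}"
  let ?T = "{p. infinite {x \<in> conj_group g G. psl_act x p = p}}"
  have "psl_act g q \<in> ?T" if q: "q \<in> ?S" for q
  proof -
    have "?c ` {x \<in> G. psl_act x q = q} \<subseteq> {x \<in> conj_group g G. psl_act x (psl_act g q) = psl_act g q}"
      using psl_act_conj[OF g subsetD[OF G]] unfolding conj_group_def by auto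
    moreover have "infinite (?c ` {x \<in> G. psl_act x q = q})"
      using q finite_imageD[OF _ inj_on_subset[OF inj_on_conj[OF g]]] G by blast
    ultimately show ?thesis using finite_subset by blast
  qed
  then have "psl_act g ` ?S \<subseteq> ?T" by blast
  then have "closure (psl_act g ` ?S) \<subseteq> closure ?T" by (rule closure_mono)
  then show ?thesis using psl_act_closure[OF g] p unfolding L0_def by blast
qed

text \<open>An inclusion that holds for all groups and all conjugating elements is an equality, as
  conjugation by the inverse undoes it. This is how membership in the complements of \<open>L0\<close> and \<open>L1\<close>, on which
  the next stages of Kulkarni's construction depend, is transported.\<close>

lemma psl_act_mem_conj_iff:
  assumes g: "g \<in> carrier PSL3" and G: "G \<subseteq> carrier PSL3"
    and F: "\<And>g G p. g \<in> carrier PSL3 \<Longrightarrow> G \<subseteq> carrier PSL3 \<Longrightarrow> p \<in> F G \<Longrightarrow> psl_act g p \<in> F (conj_group g G)"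
  shows "psl_act g p \<in> F (conj_group g G) \<longleftrightarrow> p \<in> F G"
  using F[OF g G, of p] F[OF PSL3.inv_closed[OF g] conj_group_carrier[OF g G], of "psl_act g p"]
  by (auto simp: conj_group_inverse[OF g G] psl_act_inv[OF g])

lemma cluster_points_conj:
  assumes g: "g \<in> carrier PSL3" and G: "G \<subseteq> carrier PSL3" and q: "q \<in> cluster_points G K"
  shows "psl_act g q \<in> cluster_points (conj_group g G) (psl_act g ` K)"
proof -
  obtain k where "\<exists>x. (\<forall>m. k m \<in> K) \<and> (\<forall>m. x m \<in> G) \<and> inj x \<and>
      (\<lambda>m::nat. psl_act (x m) (k m)) \<longlonglongrightarrow> q"
    using q[unfolded cluster_points_def, THEN CollectD] ..
  then obtain x where "(\<forall>m. k m \<in> K) \<and> (\<forall>m. x m \<in> G) \<and> inj x \<and>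
      (\<lambda>m::nat. psl_act (x m) (k m)) \<longlonglongrightarrow> q" ..
  then have kx: "\<And>m. k m \<in> K" "\<And>m. x m \<in> G" "inj x" "(\<lambda>m. psl_act (x m) (k m)) \<longlonglongrightarrow> q"
    by simp_all
  define y where "y m = g \<otimes>\<^bsub>PSL3\<^esub> x m \<otimes>\<^bsub>PSL3\<^esub> inv\<^bsub>PSL3\<^esub> g" for m
  have "inj y"
  proof (rule injI)
    fix m n assume "y m = y n"
    then have "x m = x n"
      using inj_onD[OF inj_on_conj[OF g]] subsetD[OF G kx(2)] unfolding y_def by blast
    then show "m = n" using injD[OF kx(3)] by blast
  qed
  moreover have "\<forall>m. y m \<in> conj_group g G" using kx(2) by (simp add: y_def conj_group_def)
  moreover have "(\<lambda>m. psl_act (y m) (psl_act g (k m))) \<longlonglongrightarrow> psl_act g q"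
    using tendsto_psl_act[OF g kx(4)] by (simp add: y_def psl_act_conj[OF g subsetD[OF G kx(2)]])
  ultimately show ?thesis
    unfolding cluster_points_def using kx(1)
    by (intro CollectI exI[of _ "\<lambda>m. psl_act g (k m)"] exI[of _ y]) simp
qed

lemma L1_conj:
  assumes g: "g \<in> carrier PSL3" and G: "G \<subseteq> carrier PSL3" and p: "p \<in> L1 G"
  shows "psl_act g p \<in> L1 (conj_group g G)"
proof -
  let ?S = "\<Union>z \<in> - L0 G. cluster_points G {z}"
  let ?T = "\<Union>z \<in> - L0 (conj_group g G). cluster_points (conj_group g G) {z}"
  have "psl_act g q \<in> ?T" if q: "q \<in> ?S" for q
  proof -
    obtain z where z: "z \<notin> L0 G" "q \<in> cluster_points G {z}" using q by blast
    have "psl_act g z \<notin> L0 (conj_group g G)"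
      using psl_act_mem_conj_iff[OF g G, of L0, OF L0_conj] z(1) by blast
    moreover have "psl_act g q \<in> cluster_points (conj_group g G) {psl_act g z}"
      using cluster_points_conj[OF g G z(2)] by simp
    ultimately show ?thesis by blast
  qed
  then have "psl_act g ` ?S \<subseteq> ?T" by blast
  then have "closure (psl_act g ` ?S) \<subseteq> closure ?T" by (rule closure_mono)
  then show ?thesis using psl_act_closure[OF g] p unfolding L1_def by blast
qed

lemma compact_psl_act_image:
  assumes "g \<in> carrier PSL3" "compact K" shows "compact (psl_act g ` K)"
proof (rule compact_continuous_image[OF _ assms(2)])
  show "continuous_on K (psl_act g)"
    unfolding continuous_on_sequentially o_def using tendsto_psl_act[OF assms(1)] by blast
qed

lemma L2_conj:
  assumes g: "g \<in> carrier PSL3" and G: "G \<subseteq> carrier PSL3" and p: "p \<in> L2 G"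
  shows "psl_act g p \<in> L2 (conj_group g G)"
proof -
  let ?S = "\<Union>K \<in> {K. compact K \<and> K \<subseteq> - (L0 G \<union> L1 G)}. cluster_points G K"
  let ?H = "conj_group g G"
  let ?T = "\<Union>K \<in> {K. compact K \<and> K \<subseteq> - (L0 ?H \<union> L1 ?H)}. cluster_points ?H K"
  have "psl_act g q \<in> ?T" if q: "q \<in> ?S" for q
  proof -
    obtain K where K: "compact K" "K \<subseteq> - (L0 G \<union> L1 G)" "q \<in> cluster_points G K" using q by blast
    have "psl_act g z \<notin> L0 ?H \<union> L1 ?H" if "z \<in> K" for z
      using psl_act_mem_conj_iff[OF g G, of L0 z, OF L0_conj] psl_act_mem_conj_iff[OF g G, of L1 z, OF L1_conj] K(2) that
      by blast
    then have "psl_act g ` K \<subseteq> - (L0 ?H \<union> L1 ?H)" by blast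
    then show ?thesis
      using compact_psl_act_image[OF g K(1)] cluster_points_conj[OF g G K(3)] by blast
  qed
  then have "psl_act g ` ?S \<subseteq> ?T" by blast
  then have "closure (psl_act g ` ?S) \<subseteq> closure ?T" by (rule closure_mono)
  then show ?thesis using psl_act_closure[OF g] p unfolding L2_def by blast
qed

lemma kulkarni_conj:
  assumes "g \<in> carrier PSL3" "G \<subseteq> carrier PSL3" "p \<in> kulkarni_limit_set G"
  shows "psl_act g p \<in> kulkarni_limit_set (conj_group g G)"
  using assms(3) L0_conj[OF assms(1,2)] L1_conj[OF assms(1,2)] L2_conj[OF assms(1,2)]
  unfolding kulkarni_limit_set_def by blast

lemma conj_subgroup_self:
  assumes G: "subgroup G PSL3" and g: "g \<in> G" shows "conj_group g G = G"
proof -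
  have sub: "conj_group x G \<subseteq> G" if "x \<in> G" for x
    using that subgroup.m_closed[OF G] subgroup.m_inv_closed[OF G] by (auto simp: conj_group_def)
  have gc: "g \<in> carrier PSL3" "G \<subseteq> carrier PSL3"
    using subgroup.mem_carrier[OF G g] subgroup.subset[OF G] by auto
  have mono: "conj_group x A \<subseteq> conj_group x B" if "A \<subseteq> B" for x A B
    using that unfolding conj_group_def by blast
  have "G = conj_group (inv\<^bsub>PSL3\<^esub> (inv\<^bsub>PSL3\<^esub> g)) (conj_group (inv\<^bsub>PSL3\<^esub> g) G)"
    using conj_group_inverse[OF PSL3.inv_closed[OF gc(1)] gc(2)] by simp
  also have "\<dots> \<subseteq> conj_group g G"
    unfolding PSL3.inv_inv[OF gc(1)] by (rule mono[OF sub[OF subgroup.m_inv_closed[OF G g]]])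
  finally show ?thesis using sub[OF g] by blast
qed

lemma kulkarni_invariant:
  assumes "subgroup G PSL3" "g \<in> G" "p \<in> kulkarni_limit_set G"
  shows "psl_act g p \<in> kulkarni_limit_set G"
  using kulkarni_conj[OF subgroup.mem_carrier[OF assms(1,2)] subgroup.subset[OF assms(1)] assms(3)]
  by (simp add: conj_subgroup_self[OF assms(1,2)])

lemma conj_generate_subset:
  assumes g: "g \<in> carrier PSL3" and y: "y \<in> carrier PSL3"
  shows "conj_group g (generate PSL3 {y}) \<subseteq> generate PSL3 {g \<otimes>\<^bsub>PSL3\<^esub> y \<otimes>\<^bsub>PSL3\<^esub> inv\<^bsub>PSL3\<^esub> g}"
proof -
  have carr: "x \<in> carrier PSL3" if "x \<in> generate PSL3 {y}" for x
    using PSL3.generate_in_carrier[of "{y}" x] y that by simp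
  have "g \<otimes>\<^bsub>PSL3\<^esub> x \<otimes>\<^bsub>PSL3\<^esub> inv\<^bsub>PSL3\<^esub> g \<in> generate PSL3 {g \<otimes>\<^bsub>PSL3\<^esub> y \<otimes>\<^bsub>PSL3\<^esub> inv\<^bsub>PSL3\<^esub> g}"
    if "x \<in> generate PSL3 {y}" for x
    using that
  proof (induction x rule: generate.induct)
    case one
    then show ?case using g by (simp add: generate.one)
  next
    case (incl h)
    then show ?case by (simp add: generate.incl)
  next
    case (inv h)
    then have h: "h = y" by simp
    have "inv\<^bsub>PSL3\<^esub> (g \<otimes>\<^bsub>PSL3\<^esub> y \<otimes>\<^bsub>PSL3\<^esub> inv\<^bsub>PSL3\<^esub> g) = g \<otimes>\<^bsub>PSL3\<^esub> inv\<^bsub>PSL3\<^esub> y \<otimes>\<^bsub>PSL3\<^esub> inv\<^bsub>PSL3\<^esub> g"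
      using g y by (simp add: PSL3.inv_mult_group PSL3.m_assoc)
    then show ?case
      using generate.inv[of "g \<otimes>\<^bsub>PSL3\<^esub> y \<otimes>\<^bsub>PSL3\<^esub> inv\<^bsub>PSL3\<^esub> g" "{g \<otimes>\<^bsub>PSL3\<^esub> y \<otimes>\<^bsub>PSL3\<^esub> inv\<^bsub>PSL3\<^esub> g}" PSL3]
      by (simp add: h)
  next
    case (eng h1 h2)
    have c: "h1 \<in> carrier PSL3" "h2 \<in> carrier PSL3" using eng carr by auto
    have "g \<otimes>\<^bsub>PSL3\<^esub> (h1 \<otimes>\<^bsub>PSL3\<^esub> h2) \<otimes>\<^bsub>PSL3\<^esub> inv\<^bsub>PSL3\<^esub> g =
        (g \<otimes>\<^bsub>PSL3\<^esub> h1 \<otimes>\<^bsub>PSL3\<^esub> inv\<^bsub>PSL3\<^esub> g) \<otimes>\<^bsub>PSL3\<^esub> (g \<otimes>\<^bsub>PSL3\<^esub> h2 \<otimes>\<^bsub>PSL3\<^esub> inv\<^bsub>PSL3\<^esub> g)"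
      using g c by (simp add: PSL3.m_assoc PSL3_cancel)
    then show ?case using generate.eng[OF eng.IH] by simp
  qed
  then show ?thesis unfolding conj_group_def by blast
qed

lemma conj_generate:
  assumes g: "g \<in> carrier PSL3" and y: "y \<in> carrier PSL3"
  shows "conj_group g (generate PSL3 {y}) = generate PSL3 {g \<otimes>\<^bsub>PSL3\<^esub> y \<otimes>\<^bsub>PSL3\<^esub> inv\<^bsub>PSL3\<^esub> g}"
proof
  show "conj_group g (generate PSL3 {y}) \<subseteq> generate PSL3 {g \<otimes>\<^bsub>PSL3\<^esub> y \<otimes>\<^bsub>PSL3\<^esub> inv\<^bsub>PSL3\<^esub> g}"
    by (rule conj_generate_subset[OF g y])
  let ?z = "g \<otimes>\<^bsub>PSL3\<^esub> y \<otimes>\<^bsub>PSL3\<^esub> inv\<^bsub>PSL3\<^esub> g"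
  have z: "?z \<in> carrier PSL3" using g y by simp
  have carr: "generate PSL3 {?z} \<subseteq> carrier PSL3"
    using PSL3.generate_incl[of "{?z}"] z by simp
  have "inv\<^bsub>PSL3\<^esub> g \<otimes>\<^bsub>PSL3\<^esub> ?z \<otimes>\<^bsub>PSL3\<^esub> inv\<^bsub>PSL3\<^esub> (inv\<^bsub>PSL3\<^esub> g) = y"
    using g y by (simp add: PSL3.m_assoc PSL3_cancel)
  then have "conj_group (inv\<^bsub>PSL3\<^esub> g) (generate PSL3 {?z}) \<subseteq> generate PSL3 {y}"
    using conj_generate_subset[OF PSL3.inv_closed[OF g] z] by simp
  then have "conj_group g (conj_group (inv\<^bsub>PSL3\<^esub> g) (generate PSL3 {?z})) \<subseteq> conj_group g (generate PSL3 {y})"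
    unfolding conj_group_def by blast
  then show "generate PSL3 {?z} \<subseteq> conj_group g (generate PSL3 {y})"
    using conj_group_inverse[OF PSL3.inv_closed[OF g] carr] g by simp
qed

lemma C_set_invariant:
  assumes G: "subgroup \<Gamma> PSL3" and g: "g \<in> \<Gamma>" and p: "p \<in> C_set \<Gamma>"
  shows "psl_act g p \<in> C_set \<Gamma>"
proof -
  let ?S = "\<Union>\<gamma>\<in>\<Gamma>. kulkarni_limit_set (generate PSL3 {\<gamma>})"
  have gc: "g \<in> carrier PSL3" using subgroup.mem_carrier[OF G g] .
  have "psl_act g q \<in> ?S" if q: "q \<in> ?S" for q
  proof -
    obtain y where y: "y \<in> \<Gamma>" "q \<in> kulkarni_limit_set (generate PSL3 {y})" using q by blast
    have yc: "y \<in> carrier PSL3" using subgroup.mem_carrier[OF G y(1)] .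
    have "generate PSL3 {y} \<subseteq> carrier PSL3" using PSL3.generate_incl[of "{y}"] yc by simp
    then have "psl_act g q \<in> kulkarni_limit_set (generate PSL3 {g \<otimes>\<^bsub>PSL3\<^esub> y \<otimes>\<^bsub>PSL3\<^esub> inv\<^bsub>PSL3\<^esub> g})"
      using kulkarni_conj[OF gc _ y(2)] conj_generate[OF gc yc] by simp
    moreover have "g \<otimes>\<^bsub>PSL3\<^esub> y \<otimes>\<^bsub>PSL3\<^esub> inv\<^bsub>PSL3\<^esub> g \<in> \<Gamma>"
      using subgroup.m_closed[OF G subgroup.m_closed[OF G g y(1)] subgroup.m_inv_closed[OF G g]] .
    ultimately show ?thesis by blast
  qed
  then have "psl_act g ` ?S \<subseteq> ?S" by blast
  then have "closure (psl_act g ` ?S) \<subseteq> closure ?S" by (rule closure_mono)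
  then show ?thesis using psl_act_closure[OF gc] p unfolding C_set_def by blast
qed

lemma discrete_subset:
  assumes "discrete_in_PSL3 \<Gamma>" "G \<subseteq> \<Gamma>" shows "discrete_in_PSL3 G"
proof -
  have "subtopology PSL3_topology G = subtopology (subtopology PSL3_topology \<Gamma>) G"
    using assms(2) by (simp add: subtopology_subtopology Int_absorb1)
  also have "\<dots> = discrete_topology G"
    using assms unfolding discrete_in_PSL3_def by (simp add: Int_absorb1)
  finally show ?thesis unfolding discrete_in_PSL3_def .
qed

text \<open>The cyclic subgroups are discrete, and their collapsing sequences are collapsing in the whole
  group.\<close>

lemma C_set_subset_kernel_closure:
  assumes G: "subgroup \<Gamma> PSL3" "discrete_in_PSL3 \<Gamma>"
  shows "C_set \<Gamma> \<subseteq> kernel_closure \<Gamma>"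
proof -
  have "kulkarni_limit_set (generate PSL3 {y}) \<subseteq> kernel_closure \<Gamma>" if y: "y \<in> \<Gamma>" for y
  proof -
    have yc: "y \<in> carrier PSL3" using subgroup.mem_carrier[OF G(1) y] .
    have sub: "generate PSL3 {y} \<subseteq> \<Gamma>"
      using PSL3.generate_subgroup_incl[OF _ G(1), of "{y}"] y by simp
    have "subgroup (generate PSL3 {y}) PSL3" using PSL3.generate_is_subgroup[of "{y}"] yc by simp
    then show ?thesis
      using kulkarni_subset_kernel_closure[OF _ discrete_subset[OF G(2) sub]] kernel_closure_mono[OF sub]
      by blast
  qed
  then have "(\<Union>\<gamma>\<in>\<Gamma>. kulkarni_limit_set (generate PSL3 {\<gamma>})) \<subseteq> kernel_closure \<Gamma>" by blast
  then show ?thesis unfolding C_set_def using closure_minimal closed_kernel_closure by blast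
qed

text \<open>Both the limit set of Kulkarni and the closure of the union over cyclic subgroups are closed and
  invariant, so this bounds each of them from below.\<close>

lemma kernel_closure_subset_invariant:
  assumes G: "subgroup \<Gamma> PSL3" and S: "closed S" "\<And>g p. g \<in> \<Gamma> \<Longrightarrow> p \<in> S \<Longrightarrow> psl_act g p \<in> S"
    and three: "contains_three_lines_gp S"
  shows "kernel_closure \<Gamma> \<subseteq> S"
proof -
  obtain a b c where abc: "line_of a \<subseteq> S" "line_of b \<subseteq> S" "line_of c \<subseteq> S"
    "\<And>v. a \<cdot> v = 0 \<Longrightarrow> b \<cdot> v = 0 \<Longrightarrow> c \<cdot> v = 0 \<Longrightarrow> v = 0"
    using three_lines_obtains[OF three] by metis
  have inv: "psl_act (cls h) p \<in> - S" if h: "h \<in> lifts \<Gamma>" and p: "p \<in> - S" for h p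
    using S(2)[OF lifts_cls[OF lifts_adj3[OF G h]], of "psl_act (cls h) p"] p
      psl_act_adj3(1)[OF lifts_det[OF h]] by auto
  have "- S \<inter> kernel_points \<Gamma> = {}"
  proof (rule omitted_three_lines_no_kernel_points[OF _ inv _ _ _ abc(4)])
    show "open (- S)" using S(1) by (rule open_Compl)
  qed (use abc in auto)
  then have "kernel_points \<Gamma> \<subseteq> S" by blast
  then show ?thesis unfolding kernel_closure_def using closure_minimal S(1) by blast
qed

section \<open>The limit set as a union of lines\<close>

lemma line_of_scaleR: "r \<noteq> 0 \<Longrightarrow> line_of (r *\<^sub>R a) = line_of a"
  by (simp add: line_of_def)

text \<open>Compactness of the dual plane: the lines subconverge, their limit consists of limits of points of
  the lines, and it contains the limit of the chosen points.\<close>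

lemma limit_of_points_on_lines:
  assumes S: "closed S" and F: "\<And>n::nat. F n \<noteq> 0" "\<And>n. line_of (F n) \<subseteq> S"
    and x: "\<And>n. x n \<in> line_of (F n)" "x \<longlonglongrightarrow> p"
  shows "\<exists>f. f \<noteq> 0 \<and> p \<in> line_of f \<and> line_of f \<subseteq> S"
proof -
  define H where "H n = inverse (norm (F n)) *\<^sub>R F n" for n
  have H: "line_of (H n) = line_of (F n)" for n using F(1) by (simp add: H_def line_of_scaleR)
  have "\<forall>n. H n \<in> sphere 0 1" using F(1) by (simp add: H_def)
  then obtain f r where f: "f \<in> sphere 0 1" "strict_mono (r :: nat \<Rightarrow> nat)" "(H \<circ> r) \<longlonglongrightarrow> f"
    using compact_sphere[of "0 :: complex^3" 1, unfolded compact_def, rule_format, of H] by blast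
  note lim = f(3)[unfolded o_def]
  have f0: "f \<noteq> 0" using f(1) by auto
  have "line_of f \<subseteq> S" using line_limit_subset[OF lim f0 S] H F(2) by simp
  moreover have "p \<in> line_of f"
  proof -
    obtain v where v: "v \<noteq> 0" "p = point_of v" by (rule cp2_cases)
    have "(\<lambda>n. x (r n)) \<longlonglongrightarrow> point_of v"
      using LIMSEQ_subseq_LIMSEQ[OF x(2) f(2)] v(2) by (simp add: o_def)
    then obtain u where u: "\<And>n::nat. u n \<noteq> 0" "\<And>n. x (r n) = point_of (u n)" "u \<longlonglongrightarrow> v"
      using tendsto_cp2_lift[OF _ v(1)] by blast
    have "H (r n) \<cdot> u n = 0" for n
    proof -
      have "point_of (u n) \<in> line_of (H (r n))" using x(1)[of "r n"] unfolding H u(2)[of n] .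
      then show ?thesis unfolding point_of_in_line_of[OF u(1)] .
    qed
    then have "f \<cdot> v = 0"
      using tendsto_pairing[OF lim u(3)] by (simp add: LIMSEQ_const_iff)
    then show ?thesis using v by (simp add: point_of_in_line_of)
  qed
  ultimately show ?thesis using f0 by blast
qed

lemma functional_has_zero: "\<exists>v. v \<noteq> 0 \<and> a \<cdot> v = 0"
proof (cases "a = 0")
  case True
  then show ?thesis by (intro exI[of _ "axis 1 1"]) (simp add: axis_eq_0_iff)
next
  case False
  show ?thesis
  proof (rule ccontr)
    assume "\<not> ?thesis"
    then have "{v. a \<cdot> v = 0} \<subseteq> {0}" by blast
    then have "vec.dim {v. a \<cdot> v = 0} = 0" unfolding vec.dim_eq_0 .
    then show False using dim_annihilator[OF False] by simp
  qed
qed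

lemma functionals_have_common_zero: "\<exists>v. v \<noteq> 0 \<and> a \<cdot> v = 0 \<and> b \<cdot> v = 0"
proof (cases "a = 0 \<or> parallel a b")
  case True
  obtain v where v: "v \<noteq> 0" "a \<cdot> v = 0" using functional_has_zero by blast
  obtain w where w: "w \<noteq> 0" "b \<cdot> w = 0" using functional_has_zero by blast
  from True show ?thesis
  proof
    assume "a = 0"
    then show ?thesis using w by (intro exI[of _ w]) simp
  next
    assume "parallel a b"
    then show ?thesis using v by (intro exI[of _ v]) (auto simp: parallel_def)
  qed
next
  case False
  then have "cross a b \<noteq> 0" by (simp add: cross_eq_0_iff)
  then show ?thesis
    using cross_pairing[of a b] by (intro exI[of _ "cross a b"]) (simp add: pairing_commute)
qed

text \<open>Two different planes span the whole space; \<open>w\<close> witnesses that they are different.\<close>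

lemma matrix_zero_on_two_planes:
  fixes C :: "complex^3^3"
  assumes "\<And>v. a \<cdot> v = 0 \<Longrightarrow> C *v v = 0" "\<And>v. b \<cdot> v = 0 \<Longrightarrow> C *v v = 0" "b \<cdot> w = 0" "a \<cdot> w \<noteq> 0"
  shows "C = 0"
proof -
  have "C *v v = 0" for v
  proof -
    have "C *v (v - (a \<cdot> v / (a \<cdot> w)) *s w) = 0" using assms(4) by (intro assms(1)) simp
    then show ?thesis using assms(2)[OF assms(3)] by (simp add: vec.diff vec.scale)
  qed
  then show ?thesis using matrix_eq_zero_iff by blast
qed

text \<open>A limit \<open>B\<close> of rank one has a line as its kernel. If \<open>B\<close> has rank two, its kernel is a single
  point, which is the image of \<open>C\<close>; preimages of a line in the set under \<open>A n\<close> then accumulate on a line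
  through this point, provided that \<open>C\<close> does not vanish on the line. One of two given lines serves.\<close>

lemma kernel_point_on_line:
  assumes G: "subgroup \<Gamma> PSL3" and p: "p \<in> kernel_points \<Gamma>"
    and abc: "line_of a \<subseteq> kernel_closure \<Gamma>" "line_of b \<subseteq> kernel_closure \<Gamma>" "a \<noteq> 0" "b \<noteq> 0"
      "\<And>v. a \<cdot> v = 0 \<Longrightarrow> b \<cdot> v = 0 \<Longrightarrow> c \<cdot> v = 0 \<Longrightarrow> v = 0"
  shows "\<exists>f. f \<noteq> 0 \<and> p \<in> line_of f \<and> line_of f \<subseteq> kernel_closure \<Gamma>"
proof -
  obtain A B C v where k: "collapsing \<Gamma> A B C" "v \<noteq> 0" "B *v v = 0" "p = point_of v"
    using p by (rule kernel_points_cases)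
  have det: "det (A n) = 1" for n using collapsing_det[OF k(1)] .
  show ?thesis
  \<comment> \<open>Either the kernel of \<open>B\<close> contains a line through \<open>p\<close>, or it is the single point \<open>p\<close>.\<close>
  proof (cases "\<exists>u. \<not> parallel v u \<and> B *v u = 0")
    case True
    then obtain u where u: "\<not> parallel v u" "B *v u = 0" by blast
    have "cross v u \<noteq> 0" using cross_eq_0_iff[OF k(2)] u(1) by blast
    moreover have "p \<in> line_of (cross v u)" using k(2,4) by (simp add: point_of_in_line_of)
    moreover have "q \<in> kernel_points \<Gamma>" if q: "q \<in> line_of (cross v u)" for q
    proof -
      obtain x where x: "x \<noteq> 0" "q = point_of x" "cross v u \<cdot> x = 0" using q unfolding line_of_def by blast
      obtain s t where "x = s *s v + t *s u" using in_span_of_cross[OF u(1) k(2) x(3)] .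
      then have "B *v x = 0" using k(3) u(2) by (simp add: vec.add vec.scale)
      then show ?thesis using kernel_pointsI[OF k(1) x(1)] x(2) by simp
    qed
    ultimately show ?thesis using kernel_points_subset_closure by blast
  next
    case False
    have "\<exists>f y. f \<noteq> 0 \<and> line_of f \<subseteq> kernel_closure \<Gamma> \<and> f \<cdot> y = 0 \<and> C *v y \<noteq> 0"
    proof (rule ccontr)
      assume no: "\<not> ?thesis"
      obtain w where w: "w \<noteq> 0" "b \<cdot> w = 0" "c \<cdot> w = 0" using functionals_have_common_zero by blast
      then have "a \<cdot> w \<noteq> 0" using abc(5) by blast
      have "C *v x = 0" if "a \<cdot> x = 0" for x using no abc(1,3) that by blast
      moreover have "C *v x = 0" if "b \<cdot> x = 0" for x using no abc(2,4) that by blast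
      ultimately have "C = 0"
        using matrix_zero_on_two_planes[of a C b w] w(2) \<open>a \<cdot> w \<noteq> 0\<close> by blast
      then show False using collapsing_nonzero(2)[OF k(1)] by blast
    qed
    then obtain f y where f: "f \<noteq> 0" "line_of f \<subseteq> kernel_closure \<Gamma>" "f \<cdot> y = 0" "C *v y \<noteq> 0" by blast
    have y: "y \<noteq> 0" using f(4) by auto
    have "B *v (C *v y) = 0" using collapsing_mult_zero(1)[OF G k(1)] .
    then have "parallel v (C *v y)" using False by blast
    then have py: "point_of (C *v y) = p"
      using point_of_eq_iff[OF k(2) f(4)] k(4) by simp
    \<comment> \<open>The preimage of the line of \<open>f\<close> under \<open>A n\<close>.\<close>
    define F where "F n = f v* A n" for n
    have F0: "F n \<noteq> 0" for n
    proof
      assume "F n = 0"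
      then have "f \<cdot> x = 0" for x
        using pairing_matrix[of f "A n" "adj3 (A n) *v x"] by (simp add: F_def adj3_vec[OF det])
      then show False using f(1) pairing_all_zero by blast
    qed
    have Fsub: "line_of (F n) \<subseteq> kernel_closure \<Gamma>" for n
    proof
      fix q assume "q \<in> line_of (F n)"
      then obtain x where x: "x \<noteq> 0" "q = point_of x" "F n \<cdot> x = 0" unfolding line_of_def by blast
      then have "f \<cdot> (A n *v x) = 0" by (simp add: F_def pairing_matrix)
      then have "point_of (A n *v x) \<in> kernel_closure \<Gamma>"
        using f(2) point_of_in_line_of[OF det_one_vec_nonzero[OF det x(1)]] by blast
      then have "psl_act (cls (A n)) q \<in> kernel_closure \<Gamma>" by (simp add: x(2) psl_act_cls[OF det x(1)])
      then have "psl_act (cls (adj3 (A n))) (psl_act (cls (A n)) q) \<in> kernel_closure \<Gamma>"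
        by (rule kernel_closure_invariant[OF G lifts_cls[OF lifts_adj3[OF G collapsing_lifts[OF k(1)]]]])
      then show "q \<in> kernel_closure \<Gamma>" unfolding psl_act_adj3(1)[OF det] .
    qed
    have on: "point_of (adj3 (A n) *v y) \<in> line_of (F n)" for n
      using det_one_vec_nonzero[OF det_adj3[OF det] y] f(3) pairing_matrix[of f "A n" "adj3 (A n) *v y"]
      by (simp add: point_of_in_line_of F_def adj3_vec[OF det])
    have lim: "(\<lambda>n. point_of (adj3 (A n) *v y)) \<longlonglongrightarrow> p"
      using collapsing_tendsto[OF collapsing_inverse[OF G k(1)] tendsto_const y f(4)] py by simp
    show ?thesis by (rule limit_of_points_on_lines[OF closed_kernel_closure F0 Fsub on lim])
  qed
qed

lemma kernel_closure_union_of_lines: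
  assumes G: "subgroup \<Gamma> PSL3" and three: "contains_three_lines_gp (kernel_closure \<Gamma>)"
  shows "\<exists>\<L>. (\<forall>l\<in>\<L>. complex_line l) \<and> kernel_closure \<Gamma> = \<Union>\<L>"
proof -
  obtain a b c where abc: "a \<noteq> 0" "b \<noteq> 0" "c \<noteq> 0" "line_of a \<subseteq> kernel_closure \<Gamma>"
    "line_of b \<subseteq> kernel_closure \<Gamma>" "line_of c \<subseteq> kernel_closure \<Gamma>"
    "\<And>v. a \<cdot> v = 0 \<Longrightarrow> b \<cdot> v = 0 \<Longrightarrow> c \<cdot> v = 0 \<Longrightarrow> v = 0"
    using three_lines_obtains[OF three] by metis
  have "\<exists>f. f \<noteq> 0 \<and> p \<in> line_of f \<and> line_of f \<subseteq> kernel_closure \<Gamma>" if p: "p \<in> kernel_closure \<Gamma>" for p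
  proof -
    obtain x where x: "(\<forall>n. x n \<in> kernel_points \<Gamma>) \<and> x \<longlonglongrightarrow> p"
      using p unfolding kernel_closure_def closure_sequential ..
    have "\<forall>n. \<exists>f. f \<noteq> 0 \<and> x n \<in> line_of f \<and> line_of f \<subseteq> kernel_closure \<Gamma>"
      using kernel_point_on_line[OF G _ abc(4,5,1,2,7)] x by blast
    then obtain F where "\<forall>n. F n \<noteq> 0 \<and> x n \<in> line_of (F n) \<and> line_of (F n) \<subseteq> kernel_closure \<Gamma>"
      by (rule choice[THEN exE])
    then show ?thesis
      by (intro limit_of_points_on_lines[OF closed_kernel_closure, of F \<Gamma> x p]) (use x in blast)+
  qed
  then have "kernel_closure \<Gamma> = \<Union>{l. \<exists>f. f \<noteq> 0 \<and> l = line_of f \<and> l \<subseteq> kernel_closure \<Gamma>}" by blast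
  then show ?thesis
    by (intro exI[of _ "{l. \<exists>f. f \<noteq> 0 \<and> l = line_of f \<and> l \<subseteq> kernel_closure \<Gamma>}"])
      (auto intro: complex_line_line_of)
qed

section \<open>Maximality of the discontinuity region\<close>

definition omits :: "cp2 set \<Rightarrow> complex^3 \<Rightarrow> bool" where
  "omits V a \<longleftrightarrow> a \<noteq> 0 \<and> line_of a \<inter> V = {}"

definition rank_one :: "complex^3^3 \<Rightarrow> complex^3 \<Rightarrow> complex^3 \<Rightarrow> bool" where
  "rank_one M a b \<longleftrightarrow> a \<noteq> 0 \<and> b \<noteq> 0 \<and> (\<forall>w. M *v w = (a \<cdot> w) *s b)"

lemma omitsD: "omits V a \<Longrightarrow> v \<noteq> 0 \<Longrightarrow> a \<cdot> v = 0 \<Longrightarrow> point_of v \<notin> V"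
  unfolding omits_def using point_of_in_line_of by blast

lemma omitsI:
  assumes "a \<noteq> 0" "\<And>v. v \<noteq> 0 \<Longrightarrow> a \<cdot> v = 0 \<Longrightarrow> point_of v \<notin> V" shows "omits V a"
  unfolding omits_def line_of_def using assms by blast

lemma rank_one_from_image:
  fixes M :: "complex^3^3"
  assumes "M \<noteq> 0" "b \<noteq> 0" "\<And>w. parallel b (M *v w)"
  shows "\<exists>a. rank_one M a b"
proof -
  define a where "a = (inverse (conj_vec b \<cdot> b)) *s (conj_vec b v* M)"
  have bb: "conj_vec b \<cdot> b \<noteq> 0" using pairing_conj_self_nonzero[OF assms(2)] .
  have eq: "M *v w = (a \<cdot> w) *s b" for w
  proof -
    obtain c where c: "M *v w = c *s b" using assms(3) unfolding parallel_def by blast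
    have "a \<cdot> w = inverse (conj_vec b \<cdot> b) * (conj_vec b \<cdot> (M *v w))"
      by (simp add: a_def pairing_matrix)
    also have "\<dots> = c" using bb by (simp add: c)
    finally show ?thesis using c by simp
  qed
  have "a \<noteq> 0"
  proof
    assume "a = 0"
    then have "M *v w = 0" for w using eq[of w] by simp
    then show False using assms(1) matrix_eq_zero_iff by blast
  qed
  then show ?thesis unfolding rank_one_def using assms(2) eq by blast
qed

lemma rank_one_from_kernel:
  fixes M :: "complex^3^3"
  assumes "M \<noteq> 0" "u \<noteq> 0" "\<not> parallel u v" "M *v u = 0" "M *v v = 0"
  shows "\<exists>a b. rank_one M a b"
proof -
  define n where "n = cross u v"
  have n: "n \<noteq> 0" using cross_eq_0_iff[OF assms(2)] assms(3) by (simp add: n_def)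
  define w where "w = conj_vec n"
  have nw: "n \<cdot> w \<noteq> 0" using pairing_self_conj_nonzero[OF n] by (simp add: w_def)
  define b where "b = inverse (n \<cdot> w) *s (M *v w)"
  have eq: "M *v x = (n \<cdot> x) *s b" for x
  proof -
    define c where "c = (n \<cdot> x) * inverse (n \<cdot> w)"
    have "cross u v \<cdot> (x - c *s w) = 0" using nw by (simp add: c_def flip: n_def)
    then obtain s t where st: "x - c *s w = s *s u + t *s v"
      using in_span_of_cross[OF assms(3,2)] by blast
    then have "x = s *s u + t *s v + c *s w" by (simp add: algebra_simps)
    then have "M *v x = c *s (M *v w)" using assms(4,5) by (simp add: vec.add vec.scale)
    then show ?thesis by (simp add: b_def c_def)
  qed
  have "b \<noteq> 0"
  proof
    assume "b = 0"
    then have "M *v x = 0" for x using eq[of x] by simp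
    then show False using assms(1) matrix_eq_zero_iff by blast
  qed
  then show ?thesis unfolding rank_one_def using n eq by blast
qed

lemma collapsing_limit_singular:
  assumes "subgroup G PSL3" "collapsing G A B C"
  shows "\<exists>v. v \<noteq> 0 \<and> B *v v = 0"
proof -
  obtain u where "C *v u \<noteq> 0" using collapsing_nonzero(2)[OF assms(2)] matrix_eq_zero_iff by blast
  then show ?thesis using collapsing_mult_zero(1)[OF assms] by blast
qed

text \<open>If the kernel of \<open>B\<close> is spanned by \<open>v\<close>, then \<open>B C = 0\<close> puts the image of \<open>C\<close> into that span;
  otherwise the kernel of \<open>B\<close> is a plane.\<close>

lemma rank_one_dichotomy:
  assumes "subgroup G PSL3" "collapsing G A B C" "v \<noteq> 0" "B *v v = 0"
  shows "(\<exists>a b. rank_one B a b) \<or> (\<exists>c. rank_one C c v)"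
proof (cases "\<exists>u. \<not> parallel v u \<and> B *v u = 0")
  case True
  then show ?thesis
    using rank_one_from_kernel[OF collapsing_nonzero(1)[OF assms(2)] assms(3) _ assms(4)] by blast
next
  case False
  then have "parallel v (C *v w)" for w using collapsing_mult_zero(1)[OF assms(1,2)] by blast
  then show ?thesis
    using rank_one_from_image[OF collapsing_nonzero(2)[OF assms(2)] assms(3)] by blast
qed

lemma open_not_in_line:
  assumes "open V" "p \<in> V" "a \<noteq> 0"
  shows "\<exists>y. y \<noteq> 0 \<and> point_of y \<in> V \<and> a \<cdot> y \<noteq> 0"
proof -
  obtain v where v: "v \<noteq> 0" "p = point_of v" by (rule cp2_cases)
  show ?thesis
  proof (cases "a \<cdot> v = 0")
    case True
    define w where "w = conj_vec a"
    have w: "a \<cdot> w \<noteq> 0" using pairing_self_conj_nonzero[OF assms(3)] by (simp add: w_def)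
    define x where "x n = v + (1 / of_nat (Suc n)) *s w" for n
    have "x \<longlonglongrightarrow> v + 0 *s w"
      unfolding x_def by (intro tendsto_intros LIMSEQ_Suc lim_1_over_n)
    then have lim: "x \<longlonglongrightarrow> v" by simp
    have "\<forall>\<^sub>F n in sequentially. point_of (x n) \<in> V"
      using topological_tendstoD[OF tendsto_point_of[OF lim v(1)] assms(1)] assms(2) v(2) by simp
    then obtain n where n: "point_of (x n) \<in> V" using eventually_happens'[OF sequentially_bot] by blast
    have "a \<cdot> x n = (1 / of_nat (Suc n)) * (a \<cdot> w)" using True by (simp add: x_def)
    then have ax: "a \<cdot> x n \<noteq> 0" using w by (simp del: of_nat_Suc)
    then have "x n \<noteq> 0" by auto
    then show ?thesis using n ax by blast
  qed (use v assms(2) in blast)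
qed

text \<open>No two points of a properly discontinuous domain, equal or not, are dynamically related: balls
  around them would form a compact set that meets infinitely many of its translates.\<close>

lemma wandering_relation:
  assumes V: "prop_disc_domain G V" and c: "collapsing G A B C"
    and x: "x \<longlonglongrightarrow> p" "p \<in> V" and y: "(\<lambda>n. psl_act (cls (A n)) (x n)) \<longlonglongrightarrow> q"
  shows "q \<notin> V"
proof
  assume q: "q \<in> V"
  have oV: "open V" using V unfolding prop_disc_domain_def by blast
  obtain d where d: "d > 0" "cball p d \<subseteq> V" using oV x(2) open_contains_cball by blast
  obtain e where e: "e > 0" "cball q e \<subseteq> V" using oV q open_contains_cball by blast
  define K where "K = cball p d \<union> cball q e"
  have "compact K" "K \<subseteq> V" unfolding K_def using compact_cball_cp2 d e by (auto intro: compact_Un)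
  then have fin: "finite {\<gamma> \<in> G. psl_act \<gamma> ` K \<inter> K \<noteq> {}}"
    using V unfolding prop_disc_domain_def by blast
  obtain r where r: "strict_mono (r :: nat \<Rightarrow> nat)" "inj (\<lambda>n. cls (A (r n)))"
    using collapsing_obtains_inj[OF c] .
  have "\<forall>\<^sub>F n in sequentially. dist (x n) p < d" using tendstoD[OF x(1) d(1)] .
  moreover have "\<forall>\<^sub>F n in sequentially. dist (psl_act (cls (A n)) (x n)) q < e" using tendstoD[OF y e(1)] .
  ultimately have "\<forall>\<^sub>F n in sequentially. x n \<in> K \<and> psl_act (cls (A n)) (x n) \<in> K"
    by eventually_elim (simp add: K_def dist_commute)
  then obtain N where N: "\<And>n. n \<ge> N \<Longrightarrow> x n \<in> K \<and> psl_act (cls (A n)) (x n) \<in> K"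
    unfolding eventually_sequentially by blast
  have "(\<lambda>n. cls (A (r n))) ` {N..} \<subseteq> {\<gamma> \<in> G. psl_act \<gamma> ` K \<inter> K \<noteq> {}}"
  proof
    fix g assume "g \<in> (\<lambda>n. cls (A (r n))) ` {N..}"
    then obtain n where n: "n \<ge> N" "g = cls (A (r n))" by auto
    have "r n \<ge> N" using n(1) seq_suble[OF r(1), of n] by simp
    then show "g \<in> {\<gamma> \<in> G. psl_act \<gamma> ` K \<inter> K \<noteq> {}}"
      using N[of "r n"] lifts_cls[OF collapsing_lifts[OF c]] n(2) by blast
  qed
  then have "finite ((\<lambda>n. cls (A (r n))) ` {N..})" using fin finite_subset by blast
  then have "finite {N..}" using finite_imageD inj_on_subset[OF r(2)] by blast
  then show False using infinite_Ici by blast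
qed

lemma wandering_image:
  assumes V: "prop_disc_domain G V" and c: "collapsing G A B C"
    and v: "v \<noteq> 0" "point_of v \<in> V" "B *v v \<noteq> 0"
  shows "point_of (B *v v) \<notin> V"
proof (rule wandering_relation[OF V c tendsto_const v(2)])
  show "(\<lambda>n. psl_act (cls (A n)) (point_of v)) \<longlonglongrightarrow> point_of (B *v v)"
    using collapsing_tendsto[OF c tendsto_const v(1,3)] psl_act_cls[OF collapsing_det[OF c] v(1)] by simp
qed

text \<open>An open set is not contained in the kernel of \<open>B\<close>, so some of its points are attracted to the
  image of \<open>B\<close>.\<close>

lemma rank_one_image_not_in_domain:
  assumes V: "prop_disc_domain G V" "p \<in> V" and c: "collapsing G A B C" and B: "rank_one B a b"
  shows "point_of b \<notin> V"
proof -
  have "open V" using V unfolding prop_disc_domain_def by blast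
  then obtain y where y: "y \<noteq> 0" "point_of y \<in> V" "a \<cdot> y \<noteq> 0"
    using open_not_in_line[OF _ V(2)] B unfolding rank_one_def by blast
  have By: "B *v y = (a \<cdot> y) *s b" "b \<noteq> 0" using B unfolding rank_one_def by auto
  then have "B *v y \<noteq> 0" using y(3) by simp
  then show ?thesis using wandering_image[OF V(1) c y(1,2)] y(3) By by (simp add: point_of_scale)
qed

lemma cross_cyclic: "cross u v \<cdot> w = cross w u \<cdot> v"
  by (simp add: pairing_def cross_def sum_3 algebra_simps)

lemma cross_zero_of_annihilator:
  assumes "c \<noteq> 0" "c \<cdot> u = 0" "c \<cdot> v = 0" "c \<cdot> x = 0"
  shows "cross u v \<cdot> x = 0"
proof -
  have "(cross u v \<cdot> conj_vec c) * (c \<cdot> x) = (cross x v \<cdot> conj_vec c) * (c \<cdot> u) +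
      (cross u x \<cdot> conj_vec c) * (c \<cdot> v) + (cross u v \<cdot> x) * (c \<cdot> conj_vec c)"
    using arg_cong[OF cross_expansion[of u v "conj_vec c" x], of "\<lambda>y. c \<cdot> y"] by simp
  then show ?thesis using assms pairing_self_conj_nonzero[OF assms(1)] by simp
qed

lemma common_zero_parallel_cross:
  assumes "a \<noteq> 0" "\<not> parallel a b" "a \<cdot> x = 0" "b \<cdot> x = 0"
  shows "parallel (cross a b) x"
proof -
  define w where "w = conj_vec (cross a b)"
  have n: "cross a b \<cdot> w \<noteq> 0"
    using cross_eq_0_iff[OF assms(1)] assms(2) pairing_self_conj_nonzero by (simp add: w_def)
  define k where "k = (w \<cdot> x) / (cross a b \<cdot> w)"
  have "(x - k *s cross a b) \<cdot> y = 0" for y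
  proof -
    have "(cross a b \<cdot> w) * (y \<cdot> x) = (cross a b \<cdot> y) * (w \<cdot> x)"
      using arg_cong[OF cross_expansion[of a b w y], of "\<lambda>z. z \<cdot> x"] assms(3,4) by simp
    then have "y \<cdot> x = k * (cross a b \<cdot> y)"
      using n unfolding k_def by (simp add: field_simps)
    then show ?thesis by (simp add: pairing_commute[of x y])
  qed
  then have "x - k *s cross a b = 0" by (rule pairing_all_zero)
  then show ?thesis unfolding parallel_def by auto
qed

text \<open>The explicit functional \<open>cross y (conj_vec (cross b y))\<close> takes at \<open>b\<close> the value
  \<open>cross b y \<cdot> conj_vec (cross b y)\<close>.\<close>

lemma functional_separating:
  assumes "y \<noteq> 0" "\<not> parallel b y" "b \<noteq> 0"
  shows "\<exists>f. f \<cdot> y = 0 \<and> f \<cdot> b \<noteq> 0"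
proof -
  have "cross b y \<noteq> 0" using cross_eq_0_iff[OF assms(3)] assms(2) by blast
  then have "cross b y \<cdot> conj_vec (cross b y) \<noteq> 0" by (rule pairing_self_conj_nonzero)
  then have "cross y (conj_vec (cross b y)) \<cdot> b \<noteq> 0"
    using cross_cyclic[of y "conj_vec (cross b y)" b] by simp
  then show ?thesis using cross_pairing(1) by blast
qed

lemma open_perturbation:
  assumes "open V" "v \<noteq> 0" "point_of v \<in> V"
  shows "\<exists>t. t \<noteq> 0 \<and> v + t *s e \<noteq> 0 \<and> point_of (v + t *s e) \<in> V"
proof -
  define x where "x n = v + (1 / of_nat (Suc n)) *s e" for n
  have "x \<longlonglongrightarrow> v + 0 *s e"
    unfolding x_def by (intro tendsto_intros LIMSEQ_Suc lim_1_over_n)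
  then have lim: "x \<longlonglongrightarrow> v" by simp
  have "\<forall>\<^sub>F n in sequentially. point_of (x n) \<in> V"
    using topological_tendstoD[OF tendsto_point_of[OF lim assms(2)] assms(1,3)] .
  moreover have "\<forall>\<^sub>F n in sequentially. x n \<noteq> 0"
    using tendsto_imp_eventually_ne[OF lim assms(2)] .
  ultimately have "\<forall>\<^sub>F n in sequentially. x n \<noteq> 0 \<and> point_of (x n) \<in> V" by eventually_elim simp
  then obtain n where "x n \<noteq> 0 \<and> point_of (x n) \<in> V" using eventually_happens'[OF sequentially_bot] by blast
  then show ?thesis
    unfolding x_def by (intro exI[of _ "1 / of_nat (Suc n)"]) (simp del: of_nat_Suc)
qed

text \<open>A dimension count, carried out by a perturbation of rank one that makes \<open>C\<close> injective: it sends
  the kernel direction \<open>b\<close> to a multiple of \<open>conj_vec a\<close>, which lies outside of the plane.\<close>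

lemma surjective_onto_plane:
  fixes C :: "complex^3^3"
  assumes a: "a \<noteq> 0" and b: "b \<noteq> 0" and im: "\<And>w. a \<cdot> (C *v w) = 0"
    and ker: "\<And>w. C *v w = 0 \<Longrightarrow> parallel b w" and v: "a \<cdot> v = 0"
  shows "\<exists>w. C *v w = v"
proof -
  define M :: "complex^3^3" where "M = C + (\<chi> i j. conj_vec a $ i * conj_vec b $ j)"
  have M: "M *v w = C *v w + (conj_vec b \<cdot> w) *s conj_vec a" for w
    by (simp add: M_def vec_eq_iff matrix_vector_mult_def pairing_def sum_3 algebra_simps)
  have aM: "a \<cdot> (M *v w) = (conj_vec b \<cdot> w) * (a \<cdot> conj_vec a)" for w by (simp add: M im)
  have "w = 0" if w: "M *v w = 0" for w
  proof -
    have bw: "conj_vec b \<cdot> w = 0" using aM[of w] w pairing_self_conj_nonzero[OF a] by simp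
    then have "C *v w = 0" using M[of w] w by simp
    then obtain k where k: "w = k *s b" using ker unfolding parallel_def by blast
    then show ?thesis using bw pairing_conj_self_nonzero[OF b] by simp
  qed
  then obtain N where "N ** M = mat 1" using matrix_left_invertible_ker[of M] by blast
  then have MN: "M ** N = mat 1" using matrix_left_right_inverse by blast
  have Mv: "M *v (N *v v) = v" using MN by (simp add: matrix_vector_mul_assoc)
  then have "conj_vec b \<cdot> (N *v v) = 0"
    using aM[of "N *v v"] v pairing_self_conj_nonzero[OF a] by simp
  then have "C *v (N *v v) = v" using M[of "N *v v"] Mv by simp
  then show ?thesis by blast
qed

text \<open>The plane is the preimage under \<open>C\<close> of the line spanned by \<open>C w\<close>. Apart from the kernel of \<open>C\<close>, all of
  its points are attracted to the point of \<open>C w\<close>, which lies in the domain.\<close>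

lemma preimage_plane_omitted:
  assumes V: "prop_disc_domain G V" and c: "collapsing G A C B"
    and b: "b \<noteq> 0" "point_of b \<notin> V" "C *v b = 0" and w: "C *v w \<noteq> 0" "point_of (C *v w) \<in> V"
  shows "omits V (cross b w)" "\<not> parallel b w"
proof -
  show np: "\<not> parallel b w"
    using b(3) w(1) by (auto simp: parallel_def vec.scale)
  show "omits V (cross b w)"
  proof (rule omitsI)
    show "cross b w \<noteq> 0" using cross_eq_0_iff[OF b(1)] np by blast
    fix x assume x: "x \<noteq> 0" "cross b w \<cdot> x = 0"
    obtain s t where st: "x = s *s b + t *s w" using in_span_of_cross[OF np b(1) x(2)] .
    show "point_of x \<notin> V"
    proof (cases "t = 0")
      case True
      then have "x = s *s b" "s \<noteq> 0" using st x(1) by auto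
      then show ?thesis using b(1,2) by (simp add: point_of_scale)
    next
      case False
      have Cx: "C *v x = t *s (C *v w)" using b(3) by (simp add: st vec.add vec.scale)
      then have "C *v x \<noteq> 0" "point_of (C *v x) = point_of (C *v w)"
        using False w(1) by (simp_all add: point_of_scale)
      then show ?thesis using wandering_image[OF V c x(1)] w(2) by auto
    qed
  qed
qed

text \<open>If a properly discontinuous domain that omits at most one line meets the kernel of \<open>B\<close>, then both
  limits have rank one and the domain omits the kernel of \<open>C\<close>.

  The matrix \<open>B\<close> has rank one because otherwise its kernel is the point to which the inverses attract. If
  \<open>C\<close> had rank two, its image would be the kernel of \<open>B\<close>, and the preimages of the points of this kernel in
  the domain would form a pencil of omitted lines. Finally, transformations near \<open>v\<close> reach every line
  that avoids the image of \<open>B\<close>. Letting such a line pass through a given point \<open>y\<close> of the kernel of \<open>C\<close>,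
  one finds that \<open>v\<close> is dynamically related to \<open>y\<close>.\<close>

lemma kernel_meets_domain:
  assumes G: "subgroup G PSL3" and V: "prop_disc_domain G V" and c: "collapsing G A B C"
    and unique: "\<And>a a'. omits V a \<Longrightarrow> omits V a' \<Longrightarrow> parallel a a'"
    and v: "v \<noteq> 0" "point_of v \<in> V" "B *v v = 0"
  shows "\<exists>a b c d. rank_one B a b \<and> rank_one C c d \<and> omits V c"
proof -
  have oV: "open V" using V unfolding prop_disc_domain_def by blast
  have c': "collapsing G (\<lambda>n. adj3 (A n)) C B" using collapsing_inverse[OF G c] .
  have "\<not> rank_one C e v" for e using rank_one_image_not_in_domain[OF V v(2) c'] v(2) by blast
  then obtain a b where ab: "rank_one B a b" using rank_one_dichotomy[OF G c v(1,3)] by blast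
  have bV: "point_of b \<notin> V" using rank_one_image_not_in_domain[OF V v(2) c ab] .
  have a: "a \<noteq> 0" and b: "b \<noteq> 0" and Bw: "\<And>w. B *v w = (a \<cdot> w) *s b"
    using ab unfolding rank_one_def by auto
  have av: "a \<cdot> v = 0" using Bw[of v] v(3) b by simp
  have im: "a \<cdot> (C *v w) = 0" for w
    using collapsing_mult_zero(1)[OF G c, of w] b by (simp add: Bw)
  have "C *v (B *v conj_vec a) = 0" using collapsing_mult_zero(2)[OF G c] .
  then have Cb: "C *v b = 0"
    using pairing_self_conj_nonzero[OF a] by (simp add: Bw vec.scale)
  \<comment> \<open>Otherwise two points of the kernel of \<open>B\<close> in the domain have different preimage planes.\<close>
  have "\<exists>d e. rank_one C d e"
  proof (rule ccontr)
    assume no: "\<not> ?thesis"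
    have ker: "parallel b w" if "C *v w = 0" for w
      using rank_one_from_kernel[OF collapsing_nonzero(2)[OF c] b _ Cb that] no by blast
    \<comment> \<open>A second direction in the kernel of \<open>a\<close>, orthogonal to \<open>v\<close>.\<close>
    define e where "e = cross a (conj_vec v)"
    have e: "a \<cdot> e = 0" "e \<cdot> conj_vec v = 0"
      using cross_pairing[of a "conj_vec v"] by (simp_all add: e_def pairing_commute)
    have "e \<noteq> 0"
    proof
      assume "e = 0"
      then obtain k where "conj_vec v = k *s a" using cross_eq_0_iff[OF a] unfolding e_def parallel_def by blast
      then have "conj_vec v \<cdot> v = 0" using av by simp
      then show False using pairing_conj_self_nonzero[OF v(1)] by blast
    qed
    have npe: "\<not> parallel v e"
    proof
      assume "parallel v e"
      then obtain k where k: "e = k *s v" unfolding parallel_def by blast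
      then have "k = 0" using e(2) pairing_self_conj_nonzero[OF v(1)] by simp
      then show False using k \<open>e \<noteq> 0\<close> by simp
    qed
    obtain t where t: "t \<noteq> 0" "v + t *s e \<noteq> 0" "point_of (v + t *s e) \<in> V"
      using open_perturbation[OF oV v(1,2)] by blast
    obtain w1 where w1: "C *v w1 = v" using surjective_onto_plane[OF a b im ker av] by blast
    have "a \<cdot> (v + t *s e) = 0" using av e(1) by simp
    then obtain w2 where w2: "C *v w2 = v + t *s e" using surjective_onto_plane[OF a b im ker] by blast
    have o1: "omits V (cross b w1)" "\<not> parallel b w1"
      using preimage_plane_omitted[OF V c' b bV Cb, of w1] v w1 by simp_all
    have o2: "omits V (cross b w2)"
      using preimage_plane_omitted(1)[OF V c' b bV Cb, of w2] t w2 by simp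
    obtain k where k: "cross b w2 = k *s cross b w1" using unique[OF o1(1) o2] unfolding parallel_def by blast
    have "cross b w2 \<noteq> 0" using o2 unfolding omits_def by blast
    then have "k \<noteq> 0" using k by auto
    moreover have "k * (cross b w1 \<cdot> w2) = 0" using cross_pairing(2)[of b w2] unfolding k by simp
    ultimately have "cross b w1 \<cdot> w2 = 0" by simp
    then obtain s r where "w2 = s *s b + r *s w1" using in_span_of_cross[OF o1(2) b] by blast
    then have "v + t *s e = r *s v" using w1 w2 Cb by (simp add: vec.add vec.scale)
    then have "t *s e = (r - 1) *s v" by (simp add: vec.scale_left_diff_distrib algebra_simps)
    then have "e = ((r - 1) / t) *s v" using t(1) by (simp add: vec_eq_iff field_simps)
    then show False using npe unfolding parallel_def by blast
  qed
  then obtain d e where de: "rank_one C d e" by blast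
  have d: "d \<noteq> 0" and e: "e \<noteq> 0" and Cw: "\<And>w. C *v w = (d \<cdot> w) *s e"
    using de unfolding rank_one_def by auto
  have eV: "point_of e \<notin> V" using rank_one_image_not_in_domain[OF V v(2) c' de] .
  have db: "d \<cdot> b = 0" using Cw[of b] Cb e by simp
  have "omits V d"
  proof (rule omitsI[OF d])
    fix y assume y: "y \<noteq> 0" "d \<cdot> y = 0"
    show "point_of y \<notin> V"
    proof
      assume yV: "point_of y \<in> V"
      have npy: "\<not> parallel b y" using point_of_eq_iff[OF b y(1)] bV yV by auto
      \<comment> \<open>A line through \<open>y\<close> that avoids the image of \<open>B\<close> is reached from points near \<open>v\<close>.\<close>
      obtain f where f: "f \<cdot> y = 0" "f \<cdot> b \<noteq> 0" using functional_separating[OF y(1) npy b] by blast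
      have "(f v* B) \<cdot> conj_vec a \<noteq> 0"
        using f(2) pairing_self_conj_nonzero[OF a] by (simp add: Bw flip: pairing_matrix)
      then have fB: "f v* B \<noteq> 0" by auto
      obtain u where "(\<forall>n::nat. u n \<noteq> 0) \<and> u \<longlonglongrightarrow> v \<and> (\<forall>\<^sub>F n in sequentially. f \<cdot> (A n *v u n) = 0)"
        using collapsing_zeros_persist[OF c fB v(3,1)] ..
      then have u: "\<And>n. u n \<noteq> 0" "u \<longlonglongrightarrow> v" "\<forall>\<^sub>F n in sequentially. f \<cdot> (A n *v u n) = 0"
        by simp_all
      obtain r q where r: "strict_mono (r :: nat \<Rightarrow> nat)" "(\<lambda>n. point_of (A (r n) *v u (r n))) \<longlonglongrightarrow> q"
        using cp2_subsequence[of "\<lambda>n. point_of (A n *v u n)"] .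
      obtain z where z: "z \<noteq> 0" "q = point_of z" by (rule cp2_cases)
      have cr: "collapsing G (\<lambda>n. A (r n)) B C" using collapsing_subseq[OF c r(1)] .
      have ux: "(\<lambda>n. point_of (u (r n))) \<longlonglongrightarrow> point_of v"
        using LIMSEQ_subseq_LIMSEQ[OF tendsto_point_of[OF u(2) v(1)] r(1)] by (simp add: o_def)
      have act: "psl_act (cls (A (r n))) (point_of (u (r n))) = point_of (A (r n) *v u (r n))" for n
        using psl_act_cls[OF collapsing_det[OF c] u(1)] .
      have lim: "(\<lambda>n. psl_act (cls (A (r n))) (point_of (u (r n)))) \<longlonglongrightarrow> point_of z"
        unfolding act using r(2) z(2) by simp
      have "\<forall>\<^sub>F n in sequentially. f \<cdot> (A (r n) *v u (r n)) = 0"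
        using eventually_subseq[OF r(1) u(3)] .
      then have "\<forall>\<^sub>F n in sequentially. point_of (A (r n) *v u (r n)) \<in> line_of f"
        using det_one_vec_nonzero[OF collapsing_det[OF c] u(1)]
        by (auto elim!: eventually_mono simp: point_of_in_line_of)
      then have "q \<in> line_of f"
        using Lim_in_closed_set[OF closed_line_of _ sequentially_bot r(2)] by blast
      then have fz: "f \<cdot> z = 0" using z by (simp add: point_of_in_line_of)
      \<comment> \<open>The limit \<open>z\<close> lies on this line and in the kernel of \<open>C\<close>, hence it is \<open>y\<close>.\<close>
      have "C *v z = 0"
      proof (rule ccontr)
        assume nz: "C *v z \<noteq> 0"
        then have "point_of (C *v z) = point_of v"
          using collapsing_relation_preimage[OF G cr ux lim z(1)] by blast
        moreover have "point_of (C *v z) = point_of e"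
          using nz e by (simp add: Cw point_of_scale)
        ultimately show False using eV v(2) by simp
      qed
      then have "d \<cdot> z = 0" using Cw[of z] e by simp
      then have "cross b y \<cdot> z = 0" using cross_zero_of_annihilator[OF d db y(2)] by blast
      then obtain s t where st: "z = s *s b + t *s y" using in_span_of_cross[OF npy b] by blast
      then have "s = 0" using fz f by simp
      then have "q = point_of y" using st z y(1) by (auto simp: point_of_scale)
      moreover have "q \<notin> V" using wandering_relation[OF V cr ux v(2) lim] z(2) by simp
      ultimately show False using yV by simp
    qed
  qed
  then show ?thesis using ab de by blast
qed

text \<open>If the domain avoids both kernels, one of them is a line by the rank dichotomy; otherwise the
  previous lemma applies to the sequence or to its inverse.\<close>

lemma collapsing_kernel_omitted:
  assumes G: "subgroup G PSL3" and V: "prop_disc_domain G V" and c: "collapsing G A B C"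
    and unique: "\<And>a a'. omits V a \<Longrightarrow> omits V a' \<Longrightarrow> parallel a a'"
  shows "\<exists>c. omits V c \<and> ((\<forall>x. c \<cdot> x = 0 \<longrightarrow> B *v x = 0) \<or> (\<forall>x. c \<cdot> x = 0 \<longrightarrow> C *v x = 0))"
proof -
  have c': "collapsing G (\<lambda>n. adj3 (A n)) C B" using collapsing_inverse[OF G c] .
  consider (B) v where "v \<noteq> 0" "point_of v \<in> V" "B *v v = 0"
    | (C) v where "v \<noteq> 0" "point_of v \<in> V" "C *v v = 0"
    | (no) "\<And>v. v \<noteq> 0 \<Longrightarrow> B *v v = 0 \<or> C *v v = 0 \<Longrightarrow> point_of v \<notin> V" by blast
  then show ?thesis
  proof cases
    case B
    obtain a b d e where "rank_one C d e" "omits V d"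
      using kernel_meets_domain[OF G V c unique B] by blast
    then show ?thesis unfolding rank_one_def by (intro exI[of _ d]) simp
  next
    case C
    obtain a b d e where "rank_one B d e" "omits V d"
      using kernel_meets_domain[OF G V c' unique C] by blast
    then show ?thesis unfolding rank_one_def by (intro exI[of _ d]) simp
  next
    case no
    obtain v where v: "v \<noteq> 0" "B *v v = 0" using collapsing_limit_singular[OF G c] by blast
    from rank_one_dichotomy[OF G c v] show ?thesis
    proof (elim disjE exE)
      fix a b assume ab: "rank_one B a b"
      then have "omits V a" using no by (intro omitsI) (auto simp: rank_one_def)
      then show ?thesis using ab unfolding rank_one_def by (intro exI[of _ a]) simp
    next
      fix a assume ab: "rank_one C a v"
      then have "omits V a" using no by (intro omitsI) (auto simp: rank_one_def)
      then show ?thesis using ab unfolding rank_one_def by (intro exI[of _ a]) simp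
    qed
  qed
qed

text \<open>The projection along \<open>conj_vec c\<close> onto the kernel of \<open>c\<close>.\<close>

definition plane_projection :: "complex^3 \<Rightarrow> complex^3^3" where
  "plane_projection c = (\<chi> i j. (if i = j then 1 else 0) - conj_vec c $ i * c $ j / (c \<cdot> conj_vec c))"

lemma plane_projection_mult: "plane_projection c *v w = w - ((c \<cdot> w) / (c \<cdot> conj_vec c)) *s conj_vec c"
proof -
  define k where "k = c \<cdot> conj_vec c"
  have "c \<cdot> w / k = c$1 * w$1 / k + c$2 * w$2 / k + c$3 * w$3 / k"
    by (simp add: pairing_def sum_3 add_divide_distrib)
  then show ?thesis
    unfolding plane_projection_def k_def[symmetric]
    by (simp add: vec_eq_iff forall_3 matrix_vector_mult_def sum_3 algebra_simps)
qed

text \<open>Let all of the group preserve the kernel \<open>W\<close> of \<open>c\<close>. An element \<open>h\<close> acts on the quotient by \<open>W\<close> as a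
  scalar \<open>x\<close>, so \<open>h - x\<close> has its image in \<open>W\<close>, and the conjugate of \<open>h - x\<close> by \<open>A n\<close> involves \<open>adj3 (A n)\<close>
  only on \<open>W\<close>. Normalizing \<open>adj3 (A n)\<close> on \<open>W\<close> instead of on the whole space therefore bounds the conjugate of
  \<open>h\<close>. With \<open>Q\<close> denoting the limit of \<open>adj3 (A n)\<close> normalized in this way, the conjugates tend to
  \<open>Q (h - x) B\<close>. As \<open>Q\<close> restricted to \<open>W\<close> has the kernel spanned by \<open>b\<close>, this limit is nonzero on \<open>W\<close>
  whenever \<open>h\<close> moves \<open>b\<close>. The scaling factors do not depend on \<open>h\<close>, so they serve \<open>h\<close> and its inverse alike.\<close>

lemma conjugated_sequence_collapses:
  assumes c: "collapsing G A B C" and B: "rank_one B a b"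
    and c0: "c \<noteq> 0" and inv: "\<And>h x. h \<in> lifts G \<Longrightarrow> c \<cdot> x = 0 \<Longrightarrow> c \<cdot> (h *v x) = 0"
    and cb: "c \<cdot> b = 0" and u: "c \<cdot> u = 0" "a \<cdot> u \<noteq> 0"
  shows "\<exists>r. strict_mono (r :: nat \<Rightarrow> nat) \<and> (\<exists>s :: nat \<Rightarrow> real. (\<forall>n. s n > 0) \<and> s \<longlonglongrightarrow> 0 \<and>
    (\<forall>h\<in>lifts G. \<not> parallel b (h *v b) \<longrightarrow>
      (\<exists>M. M *v u \<noteq> 0 \<and> (\<lambda>n. s n *\<^sub>R (adj3 (A (r n)) ** h ** A (r n))) \<longlonglongrightarrow> M)))"
proof -
  have det: "det (A n) = 1" for n using collapsing_det[OF c] .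
  have b: "b \<noteq> 0" and Bw: "\<And>w. B *v w = (a \<cdot> w) *s b" using B unfolding rank_one_def by auto
  define P where "P = plane_projection c"
  have cc: "c \<cdot> conj_vec c \<noteq> 0" using pairing_self_conj_nonzero[OF c0] .
  have Pw: "P *v w = w - ((c \<cdot> w) / (c \<cdot> conj_vec c)) *s conj_vec c" for w
    unfolding P_def by (rule plane_projection_mult)
  have Pid: "P *v w = w" if "c \<cdot> w = 0" for w using that by (simp add: Pw)
  have Pconj: "P *v conj_vec c = 0" using cc by (simp add: Pw)
  define E where "E n = adj3 (A n) ** P" for n
  have Ew: "E n *v w = adj3 (A n) *v (P *v w)" for n w by (simp add: E_def matrix_vector_mul_assoc)
  \<comment> \<open>The vector \<open>w0\<close> lies in \<open>W\<close> and in the kernel of \<open>B\<close>; it shows that the scaling factors tend to zero.\<close>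
  obtain w0 where w0: "w0 \<noteq> 0" "c \<cdot> w0 = 0" "a \<cdot> w0 = 0" using functionals_have_common_zero by blast
  have EA: "E n *v (A n *v w) = w" if "c \<cdot> w = 0" for n w
    using inv[OF collapsing_lifts[OF c] that] by (simp add: Ew Pid adj3_vec[OF det])
  have E0: "E n \<noteq> 0" for n
  proof
    assume "E n = 0"
    then show False using EA[OF w0(2), of n] w0(1) by simp
  qed
  obtain r where r: "strict_mono (r :: nat \<Rightarrow> nat) \<and>
      (\<exists>Q. Q \<noteq> 0 \<and> (\<lambda>n. inverse (norm (E (r n))) *\<^sub>R E (r n)) \<longlonglongrightarrow> Q)"
    using unit_rescaling[of E, OF E0] ..
  obtain Q where Q: "Q \<noteq> 0 \<and> (\<lambda>n. inverse (norm (E (r n))) *\<^sub>R E (r n)) \<longlonglongrightarrow> Q"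
    using r[THEN conjunct2] ..
  define q where "q n = inverse (norm (E (r n)))" for n
  have q0: "q n > 0" for n using E0 by (simp add: q_def)
  have limQ: "(\<lambda>n. q n *\<^sub>R E (r n)) \<longlonglongrightarrow> Q" using Q unfolding q_def by blast
  obtain s :: "nat \<Rightarrow> real"
    where "(\<forall>n. s n > 0) \<and> s \<longlonglongrightarrow> 0 \<and> (\<lambda>n. s n *\<^sub>R A n) \<longlonglongrightarrow> B"
    using collapsing_scale[OF c] ..
  then have s0: "\<And>n. s n > 0" and limA: "(\<lambda>n. s n *\<^sub>R A n) \<longlonglongrightarrow> B" by simp_all
  have limB: "(\<lambda>n. s (r n) *\<^sub>R A (r n)) \<longlonglongrightarrow> B"
    using LIMSEQ_subseq_LIMSEQ[OF limA r[THEN conjunct1]] by (simp add: o_def)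
  define t where "t n = q n * s (r n)" for n
  have t0: "t n > 0" for n using q0 s0 by (simp add: t_def)
  have limt: "(\<lambda>n. t n *\<^sub>R w) \<longlonglongrightarrow> Q *v (B *v w)" if w: "c \<cdot> w = 0" for w
  proof -
    have "(q n *\<^sub>R E (r n)) *v ((s (r n) *\<^sub>R A (r n)) *v w) = t n *\<^sub>R w" for n
      by (simp add: scaleR_matrix_vector matrix_vector_scaleR EA[OF w] t_def)
    then show ?thesis
      using tendsto_matrix_vector[OF limQ tendsto_matrix_vector[OF limB tendsto_const[of w]]] by simp
  qed
  have t: "t \<longlonglongrightarrow> 0"
  proof -
    have "(\<lambda>n. t n *\<^sub>R w0) \<longlonglongrightarrow> 0" using limt[OF w0(2)] w0(3) by (simp add: Bw)
    then have "(\<lambda>n. norm (t n *\<^sub>R w0)) \<longlonglongrightarrow> 0" by (rule tendsto_norm_zero)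
    then have "(\<lambda>n. norm (t n *\<^sub>R w0) / norm w0) \<longlonglongrightarrow> 0 / norm w0"
      using w0(1) by (intro tendsto_divide tendsto_const) simp_all
    moreover have "norm (t n *\<^sub>R w0) / norm w0 = t n" for n using w0(1) t0[of n] by simp
    ultimately show ?thesis by simp
  qed
  have Qb: "Q *v b = 0"
  proof -
    have "(\<lambda>n. t n *\<^sub>R u) \<longlonglongrightarrow> 0 *\<^sub>R u" by (intro tendsto_scaleR t tendsto_const)
    then have "Q *v (B *v u) = 0" using LIMSEQ_unique[OF limt[OF u(1)]] by simp
    then show ?thesis using u(2) by (simp add: Bw vec.scale)
  qed
  have Qconj: "Q *v conj_vec c = 0"
  proof -
    have "(\<lambda>n. (q n *\<^sub>R E (r n)) *v conj_vec c) \<longlonglongrightarrow> Q *v conj_vec c"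
      using tendsto_matrix_vector[OF limQ tendsto_const] .
    moreover have "(q n *\<^sub>R E (r n)) *v conj_vec c = 0" for n
      by (simp add: scaleR_matrix_vector Ew Pconj)
    ultimately show ?thesis by (simp add: LIMSEQ_const_iff)
  qed
  have main: "\<exists>M. M *v u \<noteq> 0 \<and> (\<lambda>n. t n *\<^sub>R (adj3 (A (r n)) ** h ** A (r n))) \<longlonglongrightarrow> M"
    if h: "h \<in> lifts G" "\<not> parallel b (h *v b)" for h
  proof -
    \<comment> \<open>The scalar by which \<open>h\<close> acts on the quotient by \<open>W\<close>.\<close>
    define x where "x = (c \<cdot> (h *v conj_vec c)) / (c \<cdot> conj_vec c)"
    define h' where "h' = h - mat x"
    have h'w: "h' *v w = h *v w - x *s w" for w
      unfolding h'_def mat_mult_vec[symmetric] by (rule matrix_vector_mult_diff_rdistrib)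
    have ch: "c \<cdot> (h' *v w) = 0" for w
    proof -
      define k where "k = (c \<cdot> w) / (c \<cdot> conj_vec c)"
      have "c \<cdot> (w - k *s conj_vec c) = 0" using cc by (simp add: k_def)
      then have "c \<cdot> (h *v (w - k *s conj_vec c)) = 0" by (rule inv[OF h(1)])
      then have "c \<cdot> (h *v w) = k * (c \<cdot> (h *v conj_vec c))" by (simp add: vec.diff vec.scale)
      then show ?thesis using cc by (simp add: h'w x_def k_def)
    qed
    define M where "M = Q ** h' ** B"
    have "Q *v (h' *v b) \<noteq> 0"
    proof
      assume Qh: "Q *v (h' *v b) = 0"
      have np: "\<not> parallel b (h' *v b)"
      proof
        assume "parallel b (h' *v b)"
        then obtain k where "h *v b - x *s b = k *s b" unfolding parallel_def h'w by blast
        then have "h *v b = (k + x) *s b" by (simp add: vec.scale_left_distrib algebra_simps)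
        then show False using h(2) unfolding parallel_def by blast
      qed
      have Qc: "Q *v w = 0" if w: "c \<cdot> w = 0" for w
      proof -
        have "cross b (h' *v b) \<cdot> w = 0" using cross_zero_of_annihilator[OF c0 cb ch w] .
        then obtain i j where "w = i *s b + j *s (h' *v b)" using in_span_of_cross[OF np b] by blast
        then show ?thesis using Qb Qh by (simp add: vec.add vec.scale)
      qed
      have "Q *v w = 0" for w
      proof -
        have "Q *v (w - ((c \<cdot> w) / (c \<cdot> conj_vec c)) *s conj_vec c) = 0"
          using cc by (intro Qc) simp
        then show ?thesis using Qconj by (simp add: vec.diff vec.scale)
      qed
      then show False using Q matrix_eq_zero_iff by blast
    qed
    moreover have "M *v u = (a \<cdot> u) *s (Q *v (h' *v b))"
      by (simp add: M_def Bw vec.scale flip: matrix_vector_mul_assoc)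
    ultimately have Mu: "M *v u \<noteq> 0" using u(2) by simp
    have eq: "(q n *\<^sub>R E (r n)) ** h' ** (s (r n) *\<^sub>R A (r n)) + t n *\<^sub>R mat x
        = t n *\<^sub>R (adj3 (A (r n)) ** h ** A (r n))" for n
    proof -
      have "E (r n) *v (h' *v (A (r n) *v w)) + x *s w = adj3 (A (r n)) *v (h *v (A (r n) *v w))" for w
        unfolding Ew Pid[OF ch] by (simp add: h'w vec.diff vec.scale adj3_vec[OF det])
      then have "E (r n) ** h' ** A (r n) + mat x = adj3 (A (r n)) ** h ** A (r n)"
        unfolding matrix_eq
        by (simp add: matrix_vector_mult_add_rdistrib mat_mult_vec flip: matrix_vector_mul_assoc)
      then have "t n *\<^sub>R (E (r n) ** h' ** A (r n)) + t n *\<^sub>R mat x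
          = t n *\<^sub>R (adj3 (A (r n)) ** h ** A (r n))"
        by (simp flip: scaleR_add_right)
      then show ?thesis by (simp add: scaleR_matrix_matrix t_def mult.commute)
    qed
    have "(\<lambda>n. (q n *\<^sub>R E (r n)) ** h' ** (s (r n) *\<^sub>R A (r n)) + t n *\<^sub>R mat x) \<longlonglongrightarrow> M + 0 *\<^sub>R mat x"
      unfolding M_def
      by (intro tendsto_add tendsto_matrix_matrix limQ limB tendsto_const tendsto_scaleR t)
    then show ?thesis unfolding eq using Mu by auto
  qed
  show ?thesis
    using r t0 t main by (intro exI[of _ r] conjI exI[of _ t] ballI impI allI) simp_all
qed

text \<open>The lines omitted by the domain \<open>V\<close> form an invariant family. If it has two members, then some element moves
  their intersection point, which yields a third omitted line in general position, and
  \<open>omitted_three_lines_no_kernel_points\<close> applies. If it has at most one member and \<open>V\<close> contains a kernel point,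
  then the kernel \<open>W\<close> of \<open>C\<close> is omitted and hence invariant under the group. Conjugating by the sequence an
  element that moves the image of \<open>B\<close> gives a sequence neither of whose limits vanishes on \<open>W\<close>, although
  \<open>W\<close> is the only omitted plane and one of the limits has to vanish on an omitted plane.\<close>

lemma prop_disc_domain_disjoint_kernel_points:
  assumes G: "subgroup \<Gamma> PSL3" and V: "prop_disc_domain \<Gamma> V" and nofix: "\<nexists>p. global_fixed_point \<Gamma> p"
  shows "V \<inter> kernel_points \<Gamma> = {}"
proof (rule ccontr)
  assume "V \<inter> kernel_points \<Gamma> \<noteq> {}"
  then obtain p where p: "p \<in> V" "p \<in> kernel_points \<Gamma>" by blast
  have oV: "open V" using V unfolding prop_disc_domain_def by blast
  have inv: "psl_act (cls h) q \<in> V" if "h \<in> lifts \<Gamma>" "q \<in> V" for h q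
    using V lifts_cls[OF that(1)] that(2) unfolding prop_disc_domain_def by blast
  have trans: "omits V (a v* h)" if a: "omits V a" and h: "h \<in> lifts \<Gamma>" for a h
  proof (rule omitsI)
    have det: "det h = 1" using lifts_det[OF h] .
    show "a v* h \<noteq> 0"
    proof
      assume z: "a v* h = 0"
      have "a \<cdot> x = 0" for x
        using pairing_matrix[of a h "adj3 h *v x"] by (simp add: z adj3_vec[OF det])
      then have "a = 0" by (rule pairing_all_zero)
      then show False using a unfolding omits_def by blast
    qed
    fix x assume x: "x \<noteq> 0" "(a v* h) \<cdot> x = 0"
    have "point_of (h *v x) \<notin> V"
      using omitsD[OF a det_one_vec_nonzero[OF det x(1)]] x(2) by (simp add: pairing_matrix)
    then show "point_of x \<notin> V" using inv[OF h, of "point_of x"] psl_act_cls[OF det x(1)] by auto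
  qed
  have moves: "\<exists>h\<in>lifts \<Gamma>. \<not> parallel x (h *v x)" if x: "x \<noteq> 0" for x
  proof -
    obtain g where g: "g \<in> \<Gamma>" "psl_act g (point_of x) \<noteq> point_of x"
      using nofix unfolding global_fixed_point_def by blast
    obtain h where h: "h \<in> lifts \<Gamma>" "g = cls h" using lifts_cases[OF G g(1)] .
    have det: "det h = 1" using lifts_det[OF h(1)] .
    have "\<not> parallel x (h *v x)"
      using g(2) point_of_eq_iff[OF x det_one_vec_nonzero[OF det x]] psl_act_cls[OF det x] h(2) by simp
    then show ?thesis using h(1) by blast
  qed
  have unique: "parallel a a'" if a: "omits V a" "omits V a'" for a a'
  proof (rule ccontr)
    assume np: "\<not> parallel a a'"
    have a0: "a \<noteq> 0" using a(1) unfolding omits_def by blast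
    define o' where "o' = cross a a'"
    have o0: "o' \<noteq> 0" using cross_eq_0_iff[OF a0] np by (simp add: o'_def)
    obtain h where h: "h \<in> lifts \<Gamma>" "\<not> parallel o' (h *v o')" using moves[OF o0] by blast
    have "a \<cdot> (h *v o') \<noteq> 0 \<or> a' \<cdot> (h *v o') \<noteq> 0"
      using common_zero_parallel_cross[OF a0 np] h(2) unfolding o'_def by blast
    then obtain a'' where a'': "omits V a''" "(a'' v* h) \<cdot> o' \<noteq> 0"
      using a by (auto simp: pairing_matrix)
    have "V \<inter> kernel_points \<Gamma> = {}"
    proof (rule omitted_three_lines_no_kernel_points[OF oV inv])
      show "line_of a \<inter> V = {}" "line_of a' \<inter> V = {}" "line_of (a'' v* h) \<inter> V = {}"
        using a trans[OF a''(1) h(1)] unfolding omits_def by blast+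
      fix v assume v: "a \<cdot> v = 0" "a' \<cdot> v = 0" "(a'' v* h) \<cdot> v = 0"
      obtain k where k: "v = k *s o'"
        using common_zero_parallel_cross[OF a0 np v(1,2)] unfolding o'_def parallel_def by blast
      then have "k = 0" using v(3) a''(2) by simp
      then show "v = 0" using k by simp
    qed
    then show False using p by blast
  qed
  obtain A B C v where k: "collapsing \<Gamma> A B C" "v \<noteq> 0" "B *v v = 0" "p = point_of v"
    using p(2) by (rule kernel_points_cases)
  obtain a b c d where B: "rank_one B a b" and C: "rank_one C c d" and c: "omits V c"
    using kernel_meets_domain[OF G V k(1) unique k(2) _ k(3)] p(1) k(4) by blast
  have b: "b \<noteq> 0" and a: "a \<noteq> 0" and Bw: "\<And>w. B *v w = (a \<cdot> w) *s b" using B unfolding rank_one_def by auto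
  have c0: "c \<noteq> 0" and d: "d \<noteq> 0" and Cw: "\<And>w. C *v w = (c \<cdot> w) *s d" using C unfolding rank_one_def by auto
  have av: "a \<cdot> v = 0" using Bw[of v] k(3) b by simp
  have cv: "c \<cdot> v \<noteq> 0" using omitsD[OF c k(2)] p(1) k(4) by blast
  have cb: "c \<cdot> b = 0"
  proof -
    have "C *v (B *v conj_vec a) = 0" using collapsing_mult_zero(2)[OF G k(1)] .
    then show ?thesis using pairing_self_conj_nonzero[OF a] d by (simp add: Bw Cw)
  qed
  have cinv: "c \<cdot> (h *v x) = 0" if h: "h \<in> lifts \<Gamma>" and x: "c \<cdot> x = 0" for h x
  proof -
    obtain k where "c v* h = k *s c" using unique[OF c trans[OF c h]] unfolding parallel_def by blast
    then show ?thesis using x by (simp add: pairing_matrix)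
  qed
  obtain u where u: "c \<cdot> u = 0" "a \<cdot> u \<noteq> 0"
  proof -
    have "\<not> parallel c a"
      using av cv a by (auto simp: parallel_def)
    then have n: "cross c a \<noteq> 0" using cross_eq_0_iff[OF c0] by blast
    define u where "u = cross (conj_vec (cross c a)) c"
    have "cross c a \<cdot> conj_vec (cross c a) \<noteq> 0" using pairing_self_conj_nonzero[OF n] .
    then have "a \<cdot> u \<noteq> 0"
      unfolding cross_cyclic[of c a "conj_vec (cross c a)"] u_def pairing_commute[of a] .
    moreover have "c \<cdot> u = 0" unfolding u_def pairing_commute[of c] by (rule cross_pairing(2))
    ultimately show ?thesis using that by blast
  qed
  obtain h where h: "h \<in> lifts \<Gamma>" "\<not> parallel b (h *v b)" using moves[OF b] by blast
  have hdet: "det h = 1" using lifts_det[OF h(1)] .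
  have h': "adj3 h \<in> lifts \<Gamma>" "\<not> parallel b (adj3 h *v b)"
  proof -
    show "adj3 h \<in> lifts \<Gamma>" using lifts_adj3[OF G h(1)] .
    show "\<not> parallel b (adj3 h *v b)"
    proof
      assume "parallel b (adj3 h *v b)"
      then obtain x where x: "adj3 h *v b = x *s b" unfolding parallel_def by blast
      then have "b = x *s (h *v b)" using adj3_vec(2)[OF hdet, of b] by (simp add: vec.scale)
      then have "parallel (h *v b) b" unfolding parallel_def by blast
      then show False using parallel_sym h(2) b by blast
    qed
  qed
  obtain r where r: "strict_mono (r :: nat \<Rightarrow> nat) \<and> (\<exists>s :: nat \<Rightarrow> real. (\<forall>n. s n > 0) \<and> s \<longlonglongrightarrow> 0 \<and>
    (\<forall>h\<in>lifts \<Gamma>. \<not> parallel b (h *v b) \<longrightarrow>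
      (\<exists>M. M *v u \<noteq> 0 \<and> (\<lambda>n. s n *\<^sub>R (adj3 (A (r n)) ** h ** A (r n))) \<longlonglongrightarrow> M)))"
    using conjugated_sequence_collapses[OF k(1) B c0 cinv cb u] ..
  obtain s :: "nat \<Rightarrow> real" where s: "(\<forall>n. s n > 0) \<and> s \<longlonglongrightarrow> 0 \<and>
    (\<forall>h\<in>lifts \<Gamma>. \<not> parallel b (h *v b) \<longrightarrow>
      (\<exists>M. M *v u \<noteq> 0 \<and> (\<lambda>n. s n *\<^sub>R (adj3 (A (r n)) ** h ** A (r n))) \<longlonglongrightarrow> M))"
    using r[THEN conjunct2] ..
  \<comment> \<open>The conjugates are a collapsing sequence, and so are those of the inverse of \<open>h\<close>.\<close>
  define D where "D n = adj3 (A (r n)) ** h ** A (r n)" for n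
  have det: "det (A n) = 1" for n using collapsing_det[OF k(1)] .
  have adjD: "adj3 (D n) = adj3 (A (r n)) ** adj3 h ** A (r n)" for n
    by (simp add: D_def adj3_matrix_mult det hdet det_adj3 det_mul adj3_adj3 matrix_mul_assoc)
  have "\<exists>M. M *v u \<noteq> 0 \<and> (\<lambda>n. s n *\<^sub>R D n) \<longlonglongrightarrow> M"
    using s h unfolding D_def by blast
  then obtain M where M: "M *v u \<noteq> 0" "(\<lambda>n. s n *\<^sub>R D n) \<longlonglongrightarrow> M" by blast
  have "\<exists>M. M *v u \<noteq> 0 \<and> (\<lambda>n. s n *\<^sub>R adj3 (D n)) \<longlonglongrightarrow> M"
    using s h' unfolding adjD by blast
  then obtain M' where M': "M' *v u \<noteq> 0" "(\<lambda>n. s n *\<^sub>R adj3 (D n)) \<longlonglongrightarrow> M'" by blast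
  have "D n \<in> lifts \<Gamma>" for n
    unfolding D_def using lifts_mult[OF G lifts_mult[OF G lifts_adj3[OF G]]] collapsing_lifts[OF k(1)] h(1)
    by blast
  moreover have "M \<noteq> 0" "M' \<noteq> 0" using M(1) M'(1) by auto
  ultimately have "collapsing \<Gamma> D M M'"
    using s M(2) M'(2) by (intro collapsingI[where s = s and t = s]) simp_all
  then obtain c' where c': "omits V c'" "(\<forall>x. c' \<cdot> x = 0 \<longrightarrow> M *v x = 0) \<or> (\<forall>x. c' \<cdot> x = 0 \<longrightarrow> M' *v x = 0)"
    using collapsing_kernel_omitted[OF G V _ unique] by blast
  obtain k where "c' = k *s c" using unique[OF c c'(1)] unfolding parallel_def by blast
  then have "c' \<cdot> u = 0" using u(1) by simp
  then show False using c'(2) M(1) M'(1) by blast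
qed

theorem theorem0p2:
  fixes \<Gamma> :: "(complex^3^3) set set"
  assumes "subgroup \<Gamma> PSL3"
    and "discrete_in_PSL3 \<Gamma>"
    and "contains_three_lines_gp (kulkarni_limit_set \<Gamma>)"
    and "contains_three_lines_gp (C_set \<Gamma>)"
  shows "kulkarni_limit_set \<Gamma> = C_set \<Gamma> \<and>
         (\<exists>\<L>. (\<forall>l\<in>\<L>. complex_line l) \<and> kulkarni_limit_set \<Gamma> = \<Union>\<L>) \<and>
         kulkarni_region \<Gamma> = equicontinuity_set \<Gamma> \<and>
         ((\<nexists>p. global_fixed_point \<Gamma> p) \<longrightarrow>
           prop_disc_domain \<Gamma> (kulkarni_region \<Gamma>) \<and>
           (\<forall>V. prop_disc_domain \<Gamma> V \<longrightarrow> V \<subseteq> kulkarni_region \<Gamma>))"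
proof -
  have K: "kulkarni_limit_set \<Gamma> = kernel_closure \<Gamma>"
    using kulkarni_subset_kernel_closure[OF assms(1,2)]
      kernel_closure_subset_invariant[OF assms(1) closed_kulkarni kulkarni_invariant[OF assms(1)] assms(3)]
    by blast
  have "closed (C_set \<Gamma>)" unfolding C_set_def by (rule closed_closure)
  then have C: "C_set \<Gamma> = kernel_closure \<Gamma>"
    using C_set_subset_kernel_closure[OF assms(1,2)]
      kernel_closure_subset_invariant[OF assms(1) _ C_set_invariant[OF assms(1)] assms(4)]
    by blast
  have R: "kulkarni_region \<Gamma> = - kernel_closure \<Gamma>" unfolding kulkarni_region_def K ..
  have "V \<subseteq> - kernel_closure \<Gamma>" if "\<nexists>p. global_fixed_point \<Gamma> p" and V: "prop_disc_domain \<Gamma> V" for V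
  proof -
    have "open V" using V unfolding prop_disc_domain_def by blast
    moreover have "V \<inter> kernel_points \<Gamma> = {}"
      by (rule prop_disc_domain_disjoint_kernel_points[OF assms(1) V that(1)])
    ultimately have "V \<inter> kernel_closure \<Gamma> = {}"
      unfolding kernel_closure_def using open_Int_closure_eq_empty by blast
    then show ?thesis by blast
  qed
  then show ?thesis
    using kernel_closure_union_of_lines[OF assms(1)] assms(3) equicontinuity_set_eq[OF assms(1,2)]
      complement_kernel_closure_prop_disc[OF assms(1,2)]
    unfolding R C K by auto
qed

end
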